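(* Let $k\geq1$ be an integer and let $\mu$ be the surface measure on the graph of the $(k,1)$-additive Brownian sheet in $\mathbb{R}^{k+1}$. If $q>4$ for $k=1$, or $$q>\frac{8k+2}{3k}$$ for $k\geq2$, then, almost surely, for all $f\in L^2(\mu)$, $$\|\widehat{f\mu}\|_{L^q(\mathbb{R}^{k+1})}\lesssim\|f\|_{L^2(\mu)}.$$ Equivalently, if $1<q'<4/3$ for $k=1$, or $$1\leq q'<\frac{8k+2}{5k+2}$$ for $k\geq2$, then, almost surely, for all $f\in L^{q'}(\mathbb{R}^{k+1})$, $$\|\widehat{f}\,\|_{L^2(\mu)}\lesssim\|f\|_{L^{q'}(\mathbb{R}^{k+1})}.$$
   Context: The $(k,1)$-additive Brownian sheet is the random map $W:[0,1]^k\to\mathbb{R}$ given by $W(t)=\sum_{i=1}^k W^i(t_i)$ for $t=(t_1,\dots,t_k)\in[0,1]^k$, where $W^1,\dots,W^k:[0,1]\to\mathbb{R}$ are independent standard one-parameter Brownian motions (almost surely continuous, $W^i(0)=0$). Its graph is $G(W)=\{(t,W(t)):t\in[0,1]^k\}\subset\mathbb{R}^{k+1}$, and the surface measure $\mu$ on it is the Borel measure on $\mathbb{R}^{k+1}$ given by $\mu(E)=\mathcal{L}^k\{t\in[0,1]^k:(t,W(t))\in E\}$ for Borel $E\subset\mathbb{R}^{k+1}$, where $\mathcal{L}^k$ is $k$-dimensional Lebesgue measure. Here $\widehat{f\mu}(\xi)=\int e^{-2\pi i\xi\cdot x}f(x)\,d\mu(x)$ and $\widehat f$ is the Fourier transform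 on $\mathbb{R}^{k+1}$. The notation $A\lesssim B$ means there is a constant $c$, independent of $f$ (but possibly depending on the realisation of $W$, on $k$ and on the exponent), with $A\leq cB$. The exponent $q'$ is the Hölder conjugate of $q$, $\frac1q+\frac1{q'}=1$. The restriction estimate $\|\widehat f\,\|_{L^2(\mu)}\lesssim\|f\|_{L^{q'}}$ is understood in the usual sense: it holds for Schwartz $f$ and defines $\widehat f|_{G(W)}$ for general $f\in L^{q'}$ by density. *)

theory Defs
  imports "HOL-Probability.Probability"
begin

section \<open>Additive Brownian sheet and its surface measure\<close>

text \<open>Time is restricted to \<open>{0..1}\<close>; the values of \<open>X\<close> at other times are irrelevant.\<close>

definition brownian_motion :: "'w measure \<Rightarrow> (real \<Rightarrow> 'w \<Rightarrow> real) \<Rightarrow> bool" where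
  "brownian_motion M X \<longleftrightarrow> prob_space M \<and>
     (\<forall>t\<in>{0..1}. X t \<in> borel_measurable M) \<and>
     (AE \<omega> in M. X 0 \<omega> = 0) \<and>
     (\<forall>(n::nat) (t::nat \<Rightarrow> real). mono_on {..n} t \<and> t ` {..n} \<subseteq> {0..1} \<longrightarrow>
        prob_space.indep_vars M (\<lambda>_. borel) (\<lambda>j \<omega>. X (t (Suc j)) \<omega> - X (t j) \<omega>) {..<n}) \<and>
     (\<forall>s t. 0 \<le> s \<and> s < t \<and> t \<le> 1 \<longrightarrow>
        distributed M lborel (\<lambda>\<omega>. X t \<omega> - X s \<omega>) (normal_density 0 (sqrt (t - s)))) \<and>
     (AE \<omega> in M. continuous_on {0..1} (\<lambda>t. X t \<omega>))"

text \<open>The Brownian motions are independent as processes, i.e. as random elements of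
  the product space \<open>\<real>\<close> to the power \<open>{0..1}\<close>.\<close>

definition additive_brownian_sheet ::
  "'w measure \<Rightarrow> ('w \<Rightarrow> real ^ 'k \<Rightarrow> real) \<Rightarrow> bool" where
  "additive_brownian_sheet M W \<longleftrightarrow> prob_space M \<and>
     (\<exists>B :: 'k \<Rightarrow> real \<Rightarrow> 'w \<Rightarrow> real.
        (\<forall>i. brownian_motion M (B i)) \<and>
        prob_space.indep_vars M (\<lambda>_. PiM {0..1} (\<lambda>_. borel)) (\<lambda>i \<omega>. \<lambda>t\<in>{0..1}. B i t \<omega>) UNIV \<and>
        (\<forall>\<omega>. \<forall>t\<in>cbox 0 1. W \<omega> t = (\<Sum>i\<in>UNIV. B i (t $ i) \<omega>)))"

text \<open>\<open>\<real>\<^sup>k\<^sup>+\<^sup>1\<close> is rendered as the Euclidean space \<open>\<real>\<^sup>k \<times> \<real>\<close>; \<open>cbox 0 1\<close> is \<open>[0,1]\<^sup>k\<close>.\<close>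

definition surface_measure :: "(real ^ 'k \<Rightarrow> real) \<Rightarrow> ((real ^ 'k) \<times> real) measure" where
  "surface_measure w = distr (restrict_space lborel (cbox 0 1)) borel (\<lambda>t. (t, w t))"

section \<open>\<open>L\<^sup>p\<close> spaces, Fourier transform and Schwartz functions\<close>

text \<open>The exponent ranges over \<open>[1,\<infinity>]\<close> and the norm is an extended nonnegative real.\<close>

definition Lp_norm :: "ennreal \<Rightarrow> 'a measure \<Rightarrow> ('a \<Rightarrow> complex) \<Rightarrow> ennreal" where
  "Lp_norm p M f =
     (if p = \<infinity> then esssup M (\<lambda>x. ennreal (norm (f x)))
      else let I = (\<integral>\<^sup>+x. ennreal (norm (f x) powr enn2real p) \<partial>M) in
        if I = \<infinity> then \<infinity> else ennreal (enn2real I powr (1 / enn2real p)))"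

definition Lp_space :: "ennreal \<Rightarrow> 'a measure \<Rightarrow> ('a \<Rightarrow> complex) set" where
  "Lp_space p M = {f \<in> borel_measurable M. Lp_norm p M f < \<infinity>}"

text \<open>\<open>fourier lborel f\<close> is the Fourier transform of the function \<open>f\<close>, and \<open>fourier \<mu> f\<close> that of
  the measure \<open>f\<mu>\<close>.\<close>

definition fourier ::
  "'a::euclidean_space measure \<Rightarrow> ('a \<Rightarrow> complex) \<Rightarrow> 'a \<Rightarrow> complex" where
  "fourier M f \<xi> = (LINT x|M. exp (- 2 * of_real pi * \<i> * of_real (\<xi> \<bullet> x)) * f x)"

primrec iterated_partial ::
  "'a::euclidean_space list \<Rightarrow> ('a \<Rightarrow> complex) \<Rightarrow> 'a \<Rightarrow> complex" where
  "iterated_partial [] f = f"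
| "iterated_partial (v # vs) f = (\<lambda>x. frechet_derivative (iterated_partial vs f) (at x) v)"

definition schwartz :: "('a::euclidean_space \<Rightarrow> complex) \<Rightarrow> bool" where
  "schwartz f \<longleftrightarrow> (\<forall>vs. set vs \<subseteq> Basis \<longrightarrow>
     (\<forall>x. iterated_partial vs f differentiable at x) \<and>
     (\<forall>N::nat. bounded (range (\<lambda>x. (1 + norm x) ^ N *\<^sub>R iterated_partial vs f x))))"

section \<open>Extension and restriction estimates\<close>

definition extension_estimate :: "ennreal \<Rightarrow> 'a::euclidean_space measure \<Rightarrow> bool" where
  "extension_estimate q \<mu> \<longleftrightarrow>
     (\<exists>c::real. \<forall>f\<in>Lp_space 2 \<mu>. Lp_norm q lborel (fourier \<mu> f) \<le> ennreal c * Lp_norm 2 \<mu> f)"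

definition schwartz_approx ::
  "ennreal \<Rightarrow> ('a::euclidean_space \<Rightarrow> complex) \<Rightarrow> (nat \<Rightarrow> 'a \<Rightarrow> complex) \<Rightarrow> bool" where
  "schwartz_approx p f u \<longleftrightarrow> (\<forall>n. schwartz (u n)) \<and>
     (\<lambda>n. Lp_norm p lborel (\<lambda>x. u n x - f x)) \<longlonglongrightarrow> 0"

text \<open>\<open>g\<close> is the restriction to \<open>\<mu>\<close> of the Fourier transform of \<open>f \<in> L\<^sup>p\<close>, defined by density of the
  Schwartz functions; it is unique up to \<open>\<mu>\<close>-null sets.\<close>

definition fourier_restriction ::
  "ennreal \<Rightarrow> 'a::euclidean_space measure \<Rightarrow> ('a \<Rightarrow> complex) \<Rightarrow> ('a \<Rightarrow> complex) \<Rightarrow> bool" where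
  "fourier_restriction p \<mu> f g \<longleftrightarrow> g \<in> Lp_space 2 \<mu> \<and>
     (\<exists>u. schwartz_approx p f u) \<and>
     (\<forall>u. schwartz_approx p f u \<longrightarrow>
        (\<lambda>n. Lp_norm 2 \<mu> (\<lambda>\<xi>. fourier lborel (u n) \<xi> - g \<xi>)) \<longlonglongrightarrow> 0)"

definition restriction_estimate :: "ennreal \<Rightarrow> 'a::euclidean_space measure \<Rightarrow> bool" where
  "restriction_estimate p \<mu> \<longleftrightarrow> (\<exists>c::real.
     (\<forall>f. schwartz f \<longrightarrow> Lp_norm 2 \<mu> (fourier lborel f) \<le> ennreal c * Lp_norm p lborel f) \<and>
     (\<forall>f\<in>Lp_space p lborel. \<exists>g. fourier_restriction p \<mu> f g \<and>
        Lp_norm 2 \<mu> g \<le> ennreal c * Lp_norm p lborel f))"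

end

theory Submission
  imports Defs "HOL-Computational_Algebra.Polynomial"
begin

text \<open>
  Write \<open>e(s) = exp(-2 \<pi> i s)\<close>. The transform of the surface measure \<open>\<mu>\<close> at \<open>(\<xi>, \<eta>)\<close> factorises into the
  one-dimensional integrals of \<open>e(\<xi>\<^sub>i t + \<eta> W\<^sup>i(t))\<close>. In a Riemann sum of such an integral the increments of the
  path are independent, which bounds its exponential moments; a grid argument then shows that almost
  surely it is \<open>O(|\<eta>| powr (\<epsilon> - 1))\<close>, uniformly in \<open>\<xi>\<^sub>i\<close>. Hence the transform of \<open>\<mu>\<close> is
  \<open>O(|\<eta>| powr (- b))\<close> for every \<open>b < k\<close>.

  Let \<open>f\<close> be a unit vector of \<open>L\<^sup>2(\<mu>)\<close>, let \<open>E\<close> be the set where the transform of \<open>f\<mu>\<close> exceeds \<open>s\<close> in modulus, and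
  let \<open>h\<close> be the conjugate phase on \<open>E\<close>. By duality \<open>(s |E|)\<^sup>2\<close> is at most the energy of the transform of \<open>h\<close>
  in \<open>L\<^sup>2(\<mu>)\<close>, a quadratic form in \<open>h\<close> whose kernel is the transform of \<open>\<mu>\<close>. The part of the kernel with
  \<open>|\<eta>| \<le> R\<close> contributes \<open>O(R |E|)\<close>, by a Bessel inequality on the unit cube, and the rest
  \<open>O(R powr (- b) |E|\<^sup>2)\<close>. Optimising in \<open>R\<close> gives a weak-type bound with exponent \<open>2 + 2 / b\<close>, and so a
  strong one for every \<open>q > 2 + 2 / k\<close>; this equals \<open>4\<close> for \<open>k = 1\<close> and is at most \<open>(8 k + 2) / (3 k)\<close> for
  \<open>k \<ge> 2\<close>. The restriction estimate is the dual statement.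
\<close>

section \<open>Exponential moments of Riemann sums\<close>

text \<open>A Brownian path is too rough for stationary phase, so all decay in \<eta> has to come
  from independence. Moments of low order would not do: the bound is wanted at all frequencies at
  once, hence on grids with a high power of N many points, and a union bound over them needs
  exponential tails. Exponential moments of \<open>\<eta> * norm (osc x \<xi> \<eta>)\<close>,
  bounded uniformly in \<xi> and \<eta>, turn the number of grid points into a logarithm, and this
  is the whole \<epsilon> lost in the exponent. As \<xi> is unbounded, no finite grid covers it;
  when |\<xi>| is far larger than |\<eta>|, the linear part of the phase provides the decay instead.

  The kernel is cut in \<eta> alone because decay is known in that variable only. The bound at low
  \<eta> must then hold for an arbitrary graph, and it does: the height of the graph over a point of
  the cube enters only through unimodular factors. The strict inequality on the exponent pays for b
  < k and for the passage from weak to strong type.\<close>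

lemma exp_le_one_plus_square:
  fixes x :: real
  assumes "\<bar>x\<bar> \<le> 1"
  shows "exp x \<le> 1 + x + x\<^sup>2"
proof (cases "0 \<le> x")
  case True
  then show ?thesis using assms exp_bound[of x] by auto
next
  case False
  define y where "y = -x"
  have y: "0 \<le> y" "y \<le> 1" using False assms by (auto simp: y_def)
  have *: "1 + y + y\<^sup>2/2 \<le> exp y" using exp_lower_Taylor_quadratic[OF y(1)] .
  \<comment> \<open>The product expands to 1 plus nonnegative terms. With the Taylor minorant of
    \<open>exp y\<close> this gives \<open>1 \<le> (1 - y + y\<^sup>2) * exp y\<close>, which is the
    claim at \<open>x = - y\<close>.\<close>
  have "1 \<le> (1 - y + y\<^sup>2) * (1 + y + y\<^sup>2/2)"
  proof -
    have "(1 - y + y\<^sup>2) * (1 + y + y\<^sup>2/2) = 1 + y^2/2 + y^3/2 + y^4/2"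
      by (simp add: power2_eq_square power3_eq_cube power4_eq_xxxx field_simps)
    then show ?thesis using y by simp
  qed
  also have "\<dots> \<le> (1 - y + y\<^sup>2) * exp y"
  proof (rule mult_left_mono[OF *])
    show "0 \<le> 1 - y + y\<^sup>2" using y by (simp add: power2_eq_square)
  qed
  finally have "exp (-y) \<le> 1 - y + y\<^sup>2"
    by (simp add: exp_minus field_simps)
  then show ?thesis by (simp add: y_def)
qed

text \<open>Since \<open>c = 1 + m * c\<close> for the mean \<open>m\<close> of \<open>u\<close>,
  one has \<open>1 + u y * c = c + (u y - m) * c\<close>: a step only adds a centred term to
  \<open>c\<close>. The exponential of a centred variable bounded by 1 has mean at most 1 plus the
  variance, and |u| = 1 makes the variance of \<open>u\<close> equal to
  \<open>1 - (norm m)\<^sup>2\<close>. The bound on \<open>lam\<close> keeps the centred term below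
  1, as |u - m| \<le> 2.\<close>

lemma exp_moment_step:
  fixes u :: "'a \<Rightarrow> complex" and c z :: complex and lam :: real
  assumes "prob_space \<nu>" and u: "u \<in> borel_measurable \<nu>" and u1: "\<And>y. norm (u y) = 1"
    and c: "c = 1 + (LINT y|\<nu>. u y) * c" and lam: "0 \<le> lam" "2 * lam * norm c \<le> 1" and z: "norm z = 1"
  shows "(\<integral>\<^sup>+y. ennreal (exp (lam * Re (z * (1 + u y * c)))) \<partial>\<nu>)
    \<le> ennreal (1 + lam\<^sup>2 * (norm c)\<^sup>2 * (1 - (norm (LINT y|\<nu>. u y))\<^sup>2)) * ennreal (exp (lam * Re (z * c)))"
proof -
  interpret prob_space \<nu> by fact
  note [measurable] = u
  define m where "m = (LINT y|\<nu>. u y)"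
  define d where "d y = lam * Re (z * c * (u y - m))" for y
  have iu: "integrable \<nu> u"
    by (rule integrable_const_bound[of _ 1]) (auto simp: u1)
  have m1: "norm m \<le> 1" unfolding m_def
    by (rule order_trans[OF integral_norm_bound]) (simp add: u1 prob_space)
  have nd: "norm (z * c * (u y - m)) \<le> 2 * norm c" for y
  proof -
    have "norm (u y - m) \<le> 2" using norm_triangle_ineq4[of "u y" m] u1[of y] m1 by simp
    then show ?thesis by (simp add: norm_mult z mult.commute mult_left_mono)
  qed
  have d1: "\<bar>d y\<bar> \<le> 1" for y
  proof -
    have "\<bar>d y\<bar> = lam * \<bar>Re (z * c * (u y - m))\<bar>" using lam by (simp add: d_def abs_mult)
    also have "\<dots> \<le> lam * (2 * norm c)"
      by (intro mult_left_mono order_trans[OF abs_Re_le_cmod nd] lam)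
    finally show ?thesis using lam by simp
  qed
  have md[measurable]: "d \<in> borel_measurable \<nu>" unfolding d_def by measurable
  have id: "integrable \<nu> d" by (rule integrable_const_bound[of _ 1]) (auto simp: d1)
  have id2: "integrable \<nu> (\<lambda>y. (d y)\<^sup>2)"
    by (rule integrable_const_bound[of _ 1]) (auto simp: d1 abs_square_le_1)
  have d0: "(LINT y|\<nu>. d y) = 0"
  proof -
    have i: "integrable \<nu> (\<lambda>y. z * c * (u y - m))" using iu by auto
    have "(LINT y|\<nu>. d y) = lam * Re (LINT y|\<nu>. z * c * (u y - m))"
      unfolding d_def integral_mult_right_zero integral_Re[OF i] ..
    also have "(LINT y|\<nu>. z * c * (u y - m)) = z * c * ((LINT y|\<nu>. u y) - m)"
      using iu by (simp add: prob_space)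
    finally show ?thesis by (simp add: m_def)
  qed
  have nrm: "(norm (u y - m))\<^sup>2 = 1 + (norm m)\<^sup>2 - 2 * Re (u y * cnj m)" for y
  proof -
    have "(Re (u y))\<^sup>2 + (Im (u y))\<^sup>2 = 1" using cmod_power2[of "u y"] by (simp add: u1)
    then show ?thesis unfolding cmod_power2 by (simp add: power2_eq_square algebra_simps)
  qed
  have d2: "(LINT y|\<nu>. (d y)\<^sup>2) \<le> lam\<^sup>2 * (norm c)\<^sup>2 * (1 - (norm m)\<^sup>2)"
  proof -
    have i1: "integrable \<nu> (\<lambda>y. u y * cnj m)" using iu by auto
    have "(LINT y|\<nu>. (d y)\<^sup>2) \<le> (LINT y|\<nu>. lam\<^sup>2 * (norm c)\<^sup>2 * (1 + (norm m)\<^sup>2 - 2 * Re (u y * cnj m)))"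
    proof (rule integral_mono[OF id2])
      show "integrable \<nu> (\<lambda>y. lam\<^sup>2 * (norm c)\<^sup>2 * (1 + (norm m)\<^sup>2 - 2 * Re (u y * cnj m)))"
        using i1 by (intro integrable_mult_right Bochner_Integration.integrable_diff integrable_const integrable_Re) auto
      fix y
      have "(d y)\<^sup>2 = lam\<^sup>2 * (Re (z * c * (u y - m)))\<^sup>2" by (simp add: d_def power_mult_distrib)
      also have "\<dots> \<le> lam\<^sup>2 * (norm (z * c * (u y - m)))\<^sup>2"
        unfolding cmod_power2 by (intro mult_left_mono) auto
      also have "\<dots> = lam\<^sup>2 * (norm c)\<^sup>2 * (norm (u y - m))\<^sup>2" by (simp add: norm_mult z power_mult_distrib)
      finally show "(d y)\<^sup>2 \<le> lam\<^sup>2 * (norm c)\<^sup>2 * (1 + (norm m)\<^sup>2 - 2 * Re (u y * cnj m))" by (simp add: nrm)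
    qed
    also have "\<dots> = lam\<^sup>2 * (norm c)\<^sup>2 * (1 + (norm m)\<^sup>2 - 2 * Re ((LINT y|\<nu>. u y) * cnj m))"
      using i1 iu by (simp add: prob_space integrable_Re)
    also have "Re ((LINT y|\<nu>. u y) * cnj m) = (norm m)\<^sup>2"
      unfolding m_def[symmetric] cmod_power2 by (simp add: power2_eq_square)
    finally show ?thesis by simp
  qed
  have eq: "lam * Re (z * (1 + u y * c)) = lam * Re (z * c) + d y" for y
  proof -
    have "z * (1 + u y * c) = z * (1 + m * c) + z * c * (u y - m)" by (simp add: algebra_simps)
    also have "1 + m * c = c" using c by (simp add: m_def)
    finally show ?thesis by (simp only: d_def plus_complex.sel distrib_left)
  qed
  have "(\<integral>\<^sup>+y. ennreal (exp (lam * Re (z * (1 + u y * c)))) \<partial>\<nu>)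
     \<le> (\<integral>\<^sup>+y. ennreal (exp (lam * Re (z * c)) * (1 + d y + (d y)\<^sup>2)) \<partial>\<nu>)"
    unfolding eq exp_add
    by (intro nn_integral_mono ennreal_leI mult_left_mono exp_le_one_plus_square d1) auto
  also have "\<dots> = ennreal (LINT y|\<nu>. exp (lam * Re (z * c)) * (1 + d y + (d y)\<^sup>2))"
  proof (rule nn_integral_eq_integral)
    show "integrable \<nu> (\<lambda>y. exp (lam * Re (z * c)) * (1 + d y + (d y)\<^sup>2))" using id id2 by auto
    show "AE y in \<nu>. 0 \<le> exp (lam * Re (z * c)) * (1 + d y + (d y)\<^sup>2)"
    proof (rule AE_I2)
      fix y
      have "0 \<le> 1 + d y" using d1[of y] by simp
      then show "0 \<le> exp (lam * Re (z * c)) * (1 + d y + (d y)\<^sup>2)" by simp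
    qed
  qed
  also have "(LINT y|\<nu>. exp (lam * Re (z * c)) * (1 + d y + (d y)\<^sup>2)) = exp (lam * Re (z * c)) * (1 + (LINT y|\<nu>. (d y)\<^sup>2))"
    using id id2 d0 by (simp add: prob_space)
  also have "ennreal \<dots> \<le> ennreal (exp (lam * Re (z * c)) * (1 + lam\<^sup>2 * (norm c)\<^sup>2 * (1 - (norm m)\<^sup>2)))"
    by (intro ennreal_leI mult_left_mono add_left_mono d2) auto
  also have "\<dots> = ennreal (1 + lam\<^sup>2 * (norm c)\<^sup>2 * (1 - (norm m)\<^sup>2)) * ennreal (exp (lam * Re (z * c)))"
    using m1 by (subst ennreal_mult'') (auto simp: mult.commute abs_square_le_1 intro!: add_nonneg_nonneg mult_nonneg_nonneg)
  finally show ?thesis by (simp add: m_def)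
qed

text \<open>Conditioning from the last step backwards keeps the factor in front of the remaining
  partial sum deterministic; \<open>c\<close> is the stationary conditional mean.\<close>

lemma exp_moment_partial_products:
  fixes u :: "real \<Rightarrow> complex" and c z :: complex and lam :: real
  assumes \<nu>: "prob_space \<nu>" and u[measurable]: "u \<in> borel_measurable \<nu>" and u1: "\<And>y. norm (u y) = 1"
    and c: "c = 1 + (LINT y|\<nu>. u y) * c" and lam: "0 \<le> lam" "2 * lam * norm c \<le> 1" and z: "norm z = 1"
  shows "(\<integral>\<^sup>+Y. ennreal (exp (lam * Re (z * (\<Sum>j<n. \<Prod>i<j. u (Y (l + i)))))) \<partial>(PiM {l..<l+n} (\<lambda>_. \<nu>)))
    \<le> ennreal (exp (lam * norm c)) * ennreal (1 + lam\<^sup>2 * (norm c)\<^sup>2 * (1 - (norm (LINT y|\<nu>. u y))\<^sup>2)) ^ n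
        * ennreal (exp (lam * Re (z * c)))"
  using z
proof (induction n arbitrary: l z)
  case 0
  interpret prob_space "PiM {} (\<lambda>_. \<nu>) :: (nat \<Rightarrow> real) measure" by (rule prob_space_PiM) auto
  \<comment> \<open>The empty sum leaves 1 on the left; the prefactor
    \<open>exp (lam * norm c)\<close> is there to compensate a possibly small
    \<open>exp (lam * Re (z * c))\<close>.\<close>
  have "- Re (z * c) \<le> norm c" using abs_Re_le_cmod[of "z * c"] 0 by (simp add: norm_mult)
  then have "lam * - Re (z * c) \<le> lam * norm c" using lam(1) by (rule mult_left_mono)
  then have "0 \<le> lam * norm c + lam * Re (z * c)" unfolding mult_minus_right by linarith
  then have "1 \<le> exp (lam * norm c) * exp (lam * Re (z * c))"
    by (simp add: exp_add[symmetric])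
  then have "1 \<le> ennreal (exp (lam * norm c) * exp (lam * Re (z * c)))" by simp
  then show ?case using emeasure_space_1 by (simp add: ennreal_mult'[symmetric])
next
  case (Suc n)
  interpret pr: prob_space \<nu> by fact
  interpret product_sigma_finite "\<lambda>_::nat. \<nu>" ..
  let ?K = "ennreal (1 + lam\<^sup>2 * (norm c)\<^sup>2 * (1 - (norm (LINT y|\<nu>. u y))\<^sup>2))"
  let ?R = "\<lambda>n l Y. \<Sum>j<n. \<Prod>i<j. u (Y (l + i))"
  let ?C = "ennreal (exp (lam * norm c))"
  have set: "{l..<l + Suc n} = insert l {Suc l..<Suc l + n}" by auto
  \<comment> \<open>Horner form: the first factor \<open>u y\<close> comes out of every nonempty
    product. The remaining sum then appears with the unit phase \<open>z * u y\<close> in place of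
    \<open>z\<close>, so the induction has to run over all \<open>z\<close>.\<close>
  have R: "?R (Suc n) l (x(l := y)) = 1 + u y * ?R n (Suc l) x" for x y
  proof -
    have "?R (Suc n) l (x(l := y)) = 1 + (\<Sum>j<n. \<Prod>i<Suc j. u ((x(l := y)) (l + i)))"
      by (subst sum.lessThan_Suc_shift) simp
    also have "(\<Sum>j<n. \<Prod>i<Suc j. u ((x(l := y)) (l + i))) = (\<Sum>j<n. u y * (\<Prod>i<j. u (x (Suc l + i))))"
      by (subst prod.lessThan_Suc_shift) simp
    finally show ?thesis by (simp add: sum_distrib_left)
  qed
  have meas: "(\<lambda>Y. ennreal (exp (lam * Re (z * ?R (Suc n) l Y)))) \<in> borel_measurable (PiM (insert l {Suc l..<Suc l + n}) (\<lambda>_. \<nu>))"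
  proof -
    have mi: "(\<lambda>Y. u (Y (l + i))) \<in> borel_measurable (PiM (insert l {Suc l..<Suc l + n}) (\<lambda>_. \<nu>))" if "i < n" for i
      by (rule measurable_compose[OF measurable_component_singleton[of "_ + i"] u]) (use that in auto)
    have "(\<lambda>Y. ?R (Suc n) l Y) \<in> borel_measurable (PiM (insert l {Suc l..<Suc l + n}) (\<lambda>_. \<nu>))"
      by (intro borel_measurable_sum borel_measurable_prod mi) auto
    then show ?thesis by measurable
  qed
  have "(\<integral>\<^sup>+Y. ennreal (exp (lam * Re (z * ?R (Suc n) l Y))) \<partial>(PiM {l..<l + Suc n} (\<lambda>_. \<nu>)))
     = (\<integral>\<^sup>+y. (\<integral>\<^sup>+x. ennreal (exp (lam * Re (z * ?R (Suc n) l (x(l := y))))) \<partial>(PiM {Suc l..<Suc l + n} (\<lambda>_. \<nu>))) \<partial>\<nu>)"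
    unfolding set by (rule product_nn_integral_insert_rev[OF _ _ meas]) auto
  also have "\<dots> = (\<integral>\<^sup>+y. ennreal (exp (lam * Re z)) * (\<integral>\<^sup>+x. ennreal (exp (lam * Re ((z * u y) * ?R n (Suc l) x))) \<partial>(PiM {Suc l..<Suc l + n} (\<lambda>_. \<nu>))) \<partial>\<nu>)"
  proof (intro nn_integral_cong)
    fix y
    have e: "ennreal (exp (lam * Re (z * ?R (Suc n) l (x(l := y))))) =
       ennreal (exp (lam * Re z)) * ennreal (exp (lam * Re ((z * u y) * ?R n (Suc l) x)))" for x
      unfolding R by (simp add: ennreal_mult'[symmetric] exp_add[symmetric] algebra_simps)
    have mi: "(\<lambda>Y. u (Y (Suc l + i))) \<in> borel_measurable (PiM {Suc l..<Suc l + n} (\<lambda>_. \<nu>))" if "i < n" for i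
      by (rule measurable_compose[OF measurable_component_singleton[of "_ + i"] u]) (use that in auto)
    have m: "(\<lambda>Y. ?R n (Suc l) Y) \<in> borel_measurable (PiM {Suc l..<Suc l + n} (\<lambda>_. \<nu>))"
      by (intro borel_measurable_sum borel_measurable_prod mi) auto
    show "(\<integral>\<^sup>+x. ennreal (exp (lam * Re (z * ?R (Suc n) l (x(l := y))))) \<partial>(PiM {Suc l..<Suc l + n} (\<lambda>_. \<nu>)))
      = ennreal (exp (lam * Re z)) * (\<integral>\<^sup>+x. ennreal (exp (lam * Re ((z * u y) * ?R n (Suc l) x))) \<partial>(PiM {Suc l..<Suc l + n} (\<lambda>_. \<nu>)))"
      unfolding e using m by (intro nn_integral_cmult) measurable
  qed
  also have "\<dots> \<le> (\<integral>\<^sup>+y. ennreal (exp (lam * Re z)) * (?C * ?K ^ n * ennreal (exp (lam * Re ((z * u y) * c)))) \<partial>\<nu>)"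
    by (intro nn_integral_mono mult_left_mono Suc.IH) (auto simp: norm_mult u1 Suc.prems)
  also have "\<dots> = (\<integral>\<^sup>+y. ?C * ?K ^ n * ennreal (exp (lam * Re (z * (1 + u y * c)))) \<partial>\<nu>)"
  proof (intro nn_integral_cong)
    fix y
    have "ennreal (exp (lam * Re (z * (1 + u y * c)))) = ennreal (exp (lam * Re z)) * ennreal (exp (lam * Re ((z * u y) * c)))"
      by (simp add: ennreal_mult'[symmetric] exp_add[symmetric] algebra_simps)
    then show "ennreal (exp (lam * Re z)) * (?C * ?K ^ n * ennreal (exp (lam * Re ((z * u y) * c))))
      = ?C * ?K ^ n * ennreal (exp (lam * Re (z * (1 + u y * c))))"
      by (simp only: mult_ac)
  qed
  also have "\<dots> = ?C * ?K ^ n * (\<integral>\<^sup>+y. ennreal (exp (lam * Re (z * (1 + u y * c)))) \<partial>\<nu>)"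
    by (intro nn_integral_cmult) measurable
  also have "\<dots> \<le> ?C * ?K ^ n * (?K * ennreal (exp (lam * Re (z * c))))"
    by (intro mult_left_mono exp_moment_step[OF \<nu> u u1 c lam Suc.prems]) auto
  finally show ?case by (simp add: mult_ac)
qed

section \<open>Riemann sums and passage to almost sure limits\<close>

lemma integral_uniform_partition:
  fixes g :: "real \<Rightarrow> 'b::euclidean_space"
  assumes g: "continuous_on {a..b} g" and ab: "a \<le> b" and n: "0 < n"
  defines "t \<equiv> \<lambda>i::nat. a + real i * (b - a) / real n"
  shows "integral {a..b} g = (\<Sum>i<n. integral {t i..t (Suc i)} g)"
proof -
  have mono: "t i \<le> t j" if "i \<le> j" for i j
    using that ab n by (simp add: t_def divide_right_mono mult_right_mono)
  have t0: "t 0 = a" and tn: "t n = b" using n by (auto simp: t_def)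
  have "integral {a..t m} g = (\<Sum>i<m. integral {t i..t (Suc i)} g)" if "m \<le> n" for m
    using that
  proof (induction m)
    case 0 then show ?case by (simp add: t0)
  next
    case (Suc m)
    have "integral {a..t m} g + integral {t m..t (Suc m)} g = integral {a..t (Suc m)} g"
    proof (rule Henstock_Kurzweil_Integration.integral_combine)
      show "a \<le> t m" using mono[of 0 m] t0 by simp
      show "t m \<le> t (Suc m)" using mono by simp
      show "g integrable_on {a..t (Suc m)}"
        using mono[of "Suc m" n] Suc.prems tn
        by (intro integrable_continuous_interval continuous_on_subset[OF g]) auto
    qed
    then show ?case using Suc by simp
  qed
  from this[of n] show ?thesis by (simp add: tn)
qed

lemma Riemann_sum_tendsto:
  fixes g :: "real \<Rightarrow> 'b::euclidean_space"
  assumes g: "continuous_on {a..b} g" and ab: "a \<le> b"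
  shows "(\<lambda>n. ((b - a) / real n) *\<^sub>R (\<Sum>i<n. g (a + real i * (b - a) / real n))) \<longlonglongrightarrow> integral {a..b} g"
proof (rule LIMSEQ_I)
  fix e :: real assume e: "0 < e"
  define e' where "e' = e / (b - a + 1)"
  have e': "0 < e'" using e ab by (simp add: e'_def)
  have "uniformly_continuous_on {a..b} g" by (intro compact_uniformly_continuous g) auto
  then obtain d where d: "0 < d" "\<And>x y. x \<in> {a..b} \<Longrightarrow> y \<in> {a..b} \<Longrightarrow> dist y x < d \<Longrightarrow> dist (g y) (g x) < e'"
    unfolding uniformly_continuous_on_def using e' by metis
  obtain N :: nat where N: "(b - a) / d < real N" using reals_Archimedean2 by blast
  show "\<exists>no. \<forall>n\<ge>no. norm (((b - a) / real n) *\<^sub>R (\<Sum>i<n. g (a + real i * (b - a) / real n)) - integral {a..b} g) < e"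
  proof (intro exI allI impI)
    fix n assume nN: "N + 1 \<le> n"
    then have n: "0 < n" by simp
    define t where "t = (\<lambda>i::nat. a + real i * (b - a) / real n)"
    have nd: "(b - a) / real n < d"
    proof -
      have "(b - a) / d < real n" using N nN by linarith
      then show ?thesis using d(1) n by (simp add: field_simps)
    qed
    have mono: "t i \<le> t j" if "i \<le> j" for i j
      using that ab n by (simp add: t_def divide_right_mono mult_right_mono)
    have t0: "t 0 = a" and tn: "t n = b" using n by (auto simp: t_def)
    have step: "t (Suc i) - t i = (b - a) / real n" for i using n by (simp add: t_def field_simps)
    have *: "norm (integral {t i..t (Suc i)} g - ((b - a) / real n) *\<^sub>R g (t i)) \<le> e' * ((b - a) / real n)" if "i < n" for i
    proof -
      have sub: "{t i..t (Suc i)} \<subseteq> {a..b}" using mono[of 0 i] mono[of "Suc i" n] that t0 tn by auto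
      have le: "t i \<le> t (Suc i)" using mono by simp
      have cg: "continuous_on {t i..t (Suc i)} g" by (rule continuous_on_subset[OF g sub])
      have "integral {t i..t (Suc i)} g - ((b - a) / real n) *\<^sub>R g (t i) = integral {t i..t (Suc i)} (\<lambda>s. g s - g (t i))"
        using cg le by (subst Henstock_Kurzweil_Integration.integral_diff) (auto intro!: integrable_continuous_interval simp: step)
      also have "norm \<dots> \<le> e' * (t (Suc i) - t i)"
      proof (rule integral_bound[OF le])
        show "continuous_on {t i..t (Suc i)} (\<lambda>s. g s - g (t i))" by (intro continuous_intros cg)
        fix s assume s: "s \<in> {t i..t (Suc i)}"
        have "dist s (t i) < d" using s step[of i] nd by (auto simp: dist_real_def)
        then have "dist (g s) (g (t i)) < e'" using s le sub by (intro d(2)) auto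
        then show "norm (g s - g (t i)) \<le> e'" by (simp add: dist_norm)
      qed
      finally show ?thesis by (simp add: step)
    qed
    have "norm (((b - a) / real n) *\<^sub>R (\<Sum>i<n. g (t i)) - integral {a..b} g)
      = norm (\<Sum>i<n. integral {t i..t (Suc i)} g - ((b - a) / real n) *\<^sub>R g (t i))"
      by (subst integral_uniform_partition[OF g ab n])
        (simp add: t_def sum_subtractf scaleR_sum_right norm_minus_commute)
    also have "\<dots> \<le> (\<Sum>i<n. e' * ((b - a) / real n))"
      by (intro sum_norm_le *) auto
    also have "\<dots> = e' * (b - a)" using n by simp
    also have "\<dots> < e" using e ab by (simp add: e'_def field_simps)
    finally show "norm (((b - a) / real n) *\<^sub>R (\<Sum>i<n. g (a + real i * (b - a) / real n)) - integral {a..b} g) < e"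
      by (simp add: t_def)
  qed
qed

text \<open>Fatou's lemma without a measurability claim for the limit. Paths are continuous only
  almost surely, so functionals \<open>g\<close> of a path need not be measurable; the liminf
  \<open>h\<close> is a measurable version.\<close>

lemma nn_integral_AE_limit_le:
  fixes f :: "nat \<Rightarrow> 'a \<Rightarrow> real"
  assumes f[measurable]: "\<And>n. f n \<in> borel_measurable M" and g: "AE x in M. (\<lambda>n. f n x) \<longlonglongrightarrow> g x"
    and C: "\<forall>\<^sub>F n in sequentially. (\<integral>\<^sup>+x. ennreal (f n x) \<partial>M) \<le> C"
  obtains h where "h \<in> borel_measurable M" "AE x in M. h x = ennreal (g x)" "(\<integral>\<^sup>+x. h x \<partial>M) \<le> C"
proof
  let ?h = "\<lambda>x. liminf (\<lambda>n. ennreal (f n x))"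
  show "?h \<in> borel_measurable M" by measurable
  show "AE x in M. ?h x = ennreal (g x)"
    using g by eventually_elim (intro lim_imp_Liminf tendsto_ennrealI; simp)
  have "(\<integral>\<^sup>+x. ?h x \<partial>M) \<le> liminf (\<lambda>n. \<integral>\<^sup>+x. ennreal (f n x) \<partial>M)"
    by (rule nn_integral_liminf) measurable
  also have "\<dots> \<le> limsup (\<lambda>n. \<integral>\<^sup>+x. ennreal (f n x) \<partial>M)" by (rule Liminf_le_Limsup) simp
  also have "\<dots> \<le> C" by (rule Limsup_bounded[OF C])
  finally show "(\<integral>\<^sup>+x. ?h x \<partial>M) \<le> C" .
qed

text \<open>A Borel-Cantelli argument in expectation: after division by \<open>N ^ (p + 2)\<close>
  the expectations are dominated by a multiple of \<open>1 / N ^ 2\<close>, so the sum over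
  \<open>N\<close> is almost surely finite, and its value (or 1, if larger) serves as
  \<open>K\<close> for all \<open>N\<close> at once.\<close>

lemma AE_polynomial_bound:
  fixes f :: "nat \<Rightarrow> 'a \<Rightarrow> ennreal" and C :: real
  assumes f[measurable]: "\<And>N. f N \<in> borel_measurable M"
    and C: "\<And>N. 1 \<le> N \<Longrightarrow> (\<integral>\<^sup>+x. f N x \<partial>M) \<le> ennreal (C * real N ^ p)"
  shows "AE x in M. \<exists>K\<ge>1. \<forall>N\<ge>1. f N x \<le> ennreal (K * real N ^ (p + 2))"
proof -
  define g where "g N x = f (Suc N) x * ennreal (1 / real (Suc N) ^ (p + 2))" for N x
  have [measurable]: "g N \<in> borel_measurable M" for N unfolding g_def by measurable
  have C0: "0 \<le> \<bar>C\<bar>" by simp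
  have gN: "(\<integral>\<^sup>+x. g N x \<partial>M) \<le> ennreal (\<bar>C\<bar> * (1 / real (Suc N) ^ 2))" for N
  proof -
    have "(\<integral>\<^sup>+x. g N x \<partial>M) = (\<integral>\<^sup>+x. f (Suc N) x \<partial>M) * ennreal (1 / real (Suc N) ^ (p + 2))"
      unfolding g_def by (rule nn_integral_multc) measurable
    also have "\<dots> \<le> ennreal (\<bar>C\<bar> * real (Suc N) ^ p) * ennreal (1 / real (Suc N) ^ (p + 2))"
      by (intro mult_right_mono order_trans[OF C] ennreal_leI) (auto intro!: mult_right_mono)
    also have "\<dots> = ennreal (\<bar>C\<bar> * (1 / real (Suc N) ^ 2))"
      by (simp add: ennreal_mult'[symmetric] power_add power2_eq_square del: of_nat_Suc)
    finally show ?thesis .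
  qed
  have sm: "summable (\<lambda>N. 1 / real (Suc N) ^ 2)"
    using inverse_power_summable[of 2, where 'a=real] by (subst summable_Suc_iff) (simp add: field_simps)
  have "(\<integral>\<^sup>+x. (\<Sum>N. g N x) \<partial>M) = (\<Sum>N. \<integral>\<^sup>+x. g N x \<partial>M)"
    by (rule nn_integral_suminf) measurable
  also have "\<dots> \<le> (\<Sum>N. ennreal (\<bar>C\<bar> * (1 / real (Suc N) ^ 2)))"
    by (intro suminf_le gN) auto
  also have "\<dots> < \<infinity>"
    using summable_mult[OF sm, of "\<bar>C\<bar>"] by (subst suminf_ennreal2) auto
  finally have "AE x in M. (\<Sum>N. g N x) \<noteq> \<infinity>"
    by (intro nn_integral_PInf_AE) auto
  then show ?thesis
  proof eventually_elim
    fix x assume fin: "(\<Sum>N. g N x) \<noteq> \<infinity>"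
    define K where "K = max 1 (enn2real (\<Sum>N. g N x))"
    have "f N x \<le> ennreal (K * real N ^ (p + 2))" if "N \<ge> 1" for N
    proof -
      obtain n where n: "N = Suc n" using \<open>N \<ge> 1\<close> by (cases N) auto
      have "g n x \<le> (\<Sum>N. g N x)" using sum_le_suminf[of "\<lambda>N. g N x" "{n}"] by auto
      also have "\<dots> = ennreal (enn2real (\<Sum>N. g N x))" using fin by (simp add: less_top)
      also have "\<dots> \<le> ennreal K" unfolding K_def by (intro ennreal_leI) simp
      finally have gK: "g n x \<le> ennreal K" .
      have "f N x = g n x * ennreal (real N ^ (p + 2))"
        unfolding g_def n by (simp add: mult.assoc ennreal_mult'[symmetric] del: of_nat_Suc)
      also have "\<dots> \<le> ennreal K * ennreal (real N ^ (p + 2))" by (intro mult_right_mono gK) simp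
      finally show ?thesis by (simp add: K_def ennreal_mult'[symmetric])
    qed
    then show "\<exists>K\<ge>1. \<forall>N\<ge>1. f N x \<le> ennreal (K * real N ^ (p + 2))" by (auto simp: K_def intro!: exI[of _ K])
  qed
qed

section \<open>Exponential moments for one Brownian path\<close>

lemma expectation_normal_cis:
  assumes "0 < \<sigma>"
  shows "(LINT y|density lborel (\<lambda>x. ennreal (normal_density 0 \<sigma> x)). cis (s * y)) = of_real (exp (- (s * \<sigma>)\<^sup>2 / 2))"
proof -
  have "(LINT y|density lborel (\<lambda>x. ennreal (normal_density 0 \<sigma> x)). cis (s * y)) = (LINT y|lborel. normal_density 0 \<sigma> y *\<^sub>R cis (s * y))"
    by (rule integral_density) (auto simp: cis_conv_exp)
  also have "\<dots> = \<bar>\<sigma>\<bar> *\<^sub>R (LINT x|lborel. normal_density 0 \<sigma> (0 + \<sigma> * x) *\<^sub>R cis (s * (0 + \<sigma> * x)))"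
    by (rule lborel_integral_real_affine) (use assms in auto)
  also have "\<dots> = (LINT x|lborel. std_normal_density x *\<^sub>R iexp ((s * \<sigma>) * x))"
    using assms by (subst integral_scaleR_right[symmetric])
      (auto intro!: Bochner_Integration.integral_cong simp: normal_density_def cis_conv_exp real_sqrt_mult power_mult_distrib mult_ac)
  also have "\<dots> = char std_normal_distribution (s * \<sigma>)"
    unfolding char_def by (rule integral_density[symmetric]) (auto)
  finally show ?thesis by (simp add: char_std_normal_distribution)
qed

text \<open>The Fourier transform at \<open>(\<xi>, \<eta>)\<close> of the measure that Lebesgue
  measure on \<open>[0,1]\<close> induces on the graph of the single path \<open>x\<close>.\<close>

definition osc :: "(real \<Rightarrow> real) \<Rightarrow> real \<Rightarrow> real \<Rightarrow> complex" where
  "osc x \<xi> \<eta> = integral {0..1} (\<lambda>t. cis (- (2 * pi * (\<xi> * t + \<eta> * x t))))"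

text \<open>The phase telescopes: apart from the common initial phase, the \<open>j\<close>-th term
  is a product of \<open>j\<close> factors, each of which sees one increment of the path. For a
  Brownian path these factors are independent.\<close>

lemma Riemann_sum_eq_partial_products:
  "(\<Sum>j<m. cis (- (2 * pi * (\<xi> * (real j / real n) + \<eta> * x (real j / real n)))))
   = cis (- (2 * pi * \<eta> * x 0)) *
     (\<Sum>j<m. \<Prod>i<j. cis (- (2 * pi * (\<xi> / real n + \<eta> * (x (real (Suc i) / real n) - x (real i / real n))))))"
proof -
  have "cis (- (2 * pi * (\<xi> * (real j / real n) + \<eta> * x (real j / real n))))
    = cis (- (2 * pi * \<eta> * x 0)) * (\<Prod>i<j. cis (- (2 * pi * (\<xi> / real n + \<eta> * (x (real (Suc i) / real n) - x (real i / real n))))))" for j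
  proof (induction j)
    case 0 then show ?case by (simp add: mult_ac)
  next
    case (Suc j)
    have "cis (- (2 * pi * (\<xi> * (real (Suc j) / real n) + \<eta> * x (real (Suc j) / real n))))
      = cis (- (2 * pi * (\<xi> * (real j / real n) + \<eta> * x (real j / real n)))) *
        cis (- (2 * pi * (\<xi> / real n + \<eta> * (x (real (Suc j) / real n) - x (real j / real n)))))"
      unfolding cis_mult by (rule arg_cong[where f=cis]) (simp add: algebra_simps add_divide_distrib)
    then show ?case using Suc by (simp add: mult_ac)
  qed
  then show ?thesis by (simp add: sum_distrib_left)
qed

lemma one_minus_exp_ge:
  fixes x :: real
  assumes "0 \<le> x" "x \<le> 1"
  shows "x / 2 \<le> 1 - exp (- x)"
proof -
  have "exp (-x) \<le> 1 / (1 + x)"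
    using exp_ge_add_one_self[of x] assms by (simp add: exp_minus field_simps)
  also have "\<dots> \<le> 1 - x / 2"
  proof -
    have "x * x \<le> x * 1" using assms by (intro mult_left_mono) auto
    then show ?thesis using assms by (simp add: field_simps)
  qed
  finally show ?thesis by simp
qed

text \<open>The mean of each factor has modulus \<open>a\<close> with gap \<open>1 - a\<close> at
  least \<open>\<eta>\<^sup>2 / n\<close>, so the stationary mean \<open>c\<close> is at most
  \<open>n / \<eta>\<^sup>2\<close> in modulus. With \<open>lam = \<eta> / (2 * n)\<close> a step
  costs at most a factor \<open>1 + 1 / (2 * n)\<close>, hence \<open>n\<close> steps a bounded one.
  This scale of \<open>lam\<close> expresses that the sum divided by \<open>n\<close> is of order
  \<open>1 / \<eta>\<close>. The lower bound on \<open>n\<close> keeps the gap linear in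
  \<open>\<eta>\<^sup>2 / n\<close>.\<close>

lemma brownian_exp_moment_products:
  assumes X: "brownian_motion M X" and eta: "1 \<le> \<eta>" and n: "2 * pi\<^sup>2 * \<eta>\<^sup>2 \<le> real n" and z: "norm z = 1"
  shows "(\<integral>\<^sup>+\<omega>. ennreal (exp (\<eta> / (2 * real n) * Re (z *
     (\<Sum>j<n. \<Prod>i<j. cis (- (2 * pi * (\<xi> / real n + \<eta> * (X (real (Suc i) / real n) \<omega> - X (real i / real n) \<omega>)))))))) \<partial>M)
     \<le> ennreal (exp 2)"
proof -
  interpret M: prob_space M using X by (simp add: brownian_motion_def)
  have "0 < 2 * pi\<^sup>2 * \<eta>\<^sup>2" using eta by simp
  then have n0: "0 < n" using n by (cases n) auto
  define \<sigma> where "\<sigma> = sqrt (1 / real n)"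
  have sg: "0 < \<sigma>" "\<sigma>\<^sup>2 = 1 / real n" using n0 by (auto simp: \<sigma>_def)
  define \<nu> where "\<nu> = density lborel (\<lambda>x. ennreal (normal_density 0 \<sigma> x))"
  have p\<nu>: "prob_space \<nu>" unfolding \<nu>_def by (rule prob_space_normal_density[OF sg(1)])
  have s\<nu>[measurable_cong]: "sets \<nu> = sets borel" by (simp add: \<nu>_def)
  define Y where "Y i \<omega> = X (real (Suc i) / real n) \<omega> - X (real i / real n) \<omega>" for i \<omega>
  define u where "u y = cis (- (2 * pi * (\<xi> / real n + \<eta> * y)))" for y :: real
  have u[measurable]: "u \<in> borel_measurable borel" unfolding u_def cis_conv_exp by measurable
  have u1: "norm (u y) = 1" for y by (simp add: u_def)
  have Yd: "distr M borel (Y i) = \<nu>" if "i < n" for i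
  proof -
    have "distributed M lborel (\<lambda>\<omega>. X (real (Suc i) / real n) \<omega> - X (real i / real n) \<omega>)
       (normal_density 0 (sqrt (real (Suc i) / real n - real i / real n)))"
      using X that n0 unfolding brownian_motion_def
      by (elim conjE allE[where x="real i / real n"] allE[where x="real (Suc i) / real n"])
        (auto simp: divide_strict_right_mono)
    moreover have "real (Suc i) / real n - real i / real n = 1 / real n" by (simp add: diff_divide_distrib[symmetric])
    ultimately have "distr M lborel (Y i) = \<nu>"
      unfolding Y_def \<nu>_def \<sigma>_def by (metis distributed_distr_eq_density)
    then show ?thesis by (subst distr_cong[of M M borel lborel]) auto
  qed
  have Ym[measurable]: "Y i \<in> borel_measurable M" if "i < n" for i
    using X that unfolding brownian_motion_def Y_def by (intro borel_measurable_diff) (auto simp: field_simps)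
  have indep: "M.indep_vars (\<lambda>_. borel) Y {..<n}"
  proof -
    have "mono_on {..n} (\<lambda>j. real j / real n) \<and> (\<lambda>j. real j / real n) ` {..n} \<subseteq> {0..1}"
      using n0 by (auto simp: mono_on_def divide_right_mono)
    then have "M.indep_vars (\<lambda>_. borel) (\<lambda>j \<omega>. X (real (Suc j) / real n) \<omega> - X (real j / real n) \<omega>) {..<n}"
      using X unfolding brownian_motion_def by fast
    then show ?thesis by (simp add: Y_def[abs_def])
  qed
  have joint: "distr M (PiM {..<n} (\<lambda>_. borel)) (\<lambda>\<omega>. \<lambda>i\<in>{..<n}. Y i \<omega>) = PiM {..<n} (\<lambda>_. \<nu>)"
  proof -
    have "distr M (PiM {..<n} (\<lambda>_. borel)) (\<lambda>\<omega>. \<lambda>i\<in>{..<n}. Y i \<omega>) = PiM {..<n} (\<lambda>i. distr M borel (Y i))"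
      by (rule M.indep_vars_iff_distr_eq_PiM'[THEN iffD1, OF _ _ indep]) (use n0 Ym in auto)
    also have "\<dots> = PiM {..<n} (\<lambda>_. \<nu>)" by (rule PiM_cong) (auto simp: Yd)
    finally show ?thesis .
  qed
  define lam where "lam = \<eta> / (2 * real n)"
  have lam0: "0 \<le> lam" using eta by (simp add: lam_def)
  \<comment> \<open>The frequency \<xi> only rotates the mean \<open>m\<close>, whose modulus is
    \<open>a\<close>; this is the source of the uniformity in \<xi>.\<close>
  define a where "a = exp (- (2 * pi * \<eta>)\<^sup>2 / (2 * real n))"
  define m where "m = (LINT y|\<nu>. u y)"
  have m: "m = cis (- (2 * pi * (\<xi> / real n))) * of_real a"
  proof -
    have "m = (LINT y|\<nu>. cis (- (2 * pi * (\<xi> / real n))) * cis (- (2 * pi * \<eta>) * y))"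
      unfolding m_def u_def cis_mult by (simp add: algebra_simps)
    also have "\<dots> = cis (- (2 * pi * (\<xi> / real n))) * of_real (exp (- (- (2 * pi * \<eta>) * \<sigma>)\<^sup>2 / 2))"
      unfolding integral_mult_right_zero \<nu>_def by (subst expectation_normal_cis[OF sg(1)]) simp
    also have "- (- (2 * pi * \<eta>) * \<sigma>)\<^sup>2 / 2 = - (2 * pi * \<eta>)\<^sup>2 / (2 * real n)"
      by (simp add: power_mult_distrib sg)
    finally show ?thesis by (simp add: a_def)
  qed
  have nm: "norm m = a" unfolding m by (simp add: norm_mult a_def)
  have gap: "\<eta>\<^sup>2 / real n \<le> 1 - a"
  proof -
    define x where "x = 2 * pi\<^sup>2 * \<eta>\<^sup>2 / real n"
    have x: "0 \<le> x" "x \<le> 1" using n n0 by (auto simp: x_def)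
    have "1 * \<eta>\<^sup>2 \<le> pi\<^sup>2 * \<eta>\<^sup>2" using pi_ge_two by (intro mult_right_mono) (auto simp: power2_eq_square intro: mult_mono[of 1 pi 1 pi, simplified])
    then have "\<eta>\<^sup>2 / real n \<le> x / 2" by (simp add: x_def divide_right_mono)
    also have "\<dots> \<le> 1 - exp (- x)" by (rule one_minus_exp_ge[OF x])
    also have "exp (- x) = a" by (simp add: a_def x_def power_mult_distrib)
    finally show ?thesis .
  qed
  have eta2: "0 < \<eta>\<^sup>2 / real n" using eta n0 by simp
  have "0 \<le> a" by (simp add: a_def)
  moreover have "a < 1" using gap eta2 by linarith
  ultimately have a1: "0 \<le> a" "a < 1" .
  \<comment> \<open>The geometric series in \<open>m\<close>, that is, the means of the partial
    products summed over all \<open>j\<close>.\<close>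
  define c where "c = 1 / (1 - m)"
  have m1: "1 - m \<noteq> 0" using nm a1 by auto
  have c: "c = 1 + m * c" using m1 by (simp add: c_def field_simps)
  have nc: "norm c \<le> 1 / (1 - a)"
  proof -
    have "1 - a \<le> norm (1 - m)" using norm_triangle_ineq2[of 1 m] nm by simp
    then show ?thesis using a1 by (simp add: c_def norm_divide frac_le)
  qed
  have nc': "norm c \<le> real n / \<eta>\<^sup>2"
  proof -
    have "1 / (1 - a) \<le> 1 / (\<eta>\<^sup>2 / real n)" by (rule divide_left_mono[OF gap]) (use a1 eta2 in \<open>auto intro!: mult_pos_pos simp del: times_divide_eq_right\<close>)
    then show ?thesis using nc by simp
  qed
  have lc: "lam * norm c \<le> 1 / 2"
  proof -
    have "lam * norm c \<le> lam * (real n / \<eta>\<^sup>2)" by (rule mult_left_mono[OF nc' lam0])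
    also have "\<dots> = 1 / (2 * \<eta>)" using n0 eta by (simp add: lam_def power2_eq_square)
    also have "\<dots> \<le> 1 / 2" using eta by (simp add: field_simps)
    finally show ?thesis .
  qed
  \<comment> \<open>One factor \<open>norm c\<close> is cancelled by
    \<open>1 - a\<^sup>2 = (1 - a) * (1 + a)\<close>. Estimating both by
    \<open>n / \<eta>\<^sup>2\<close> and \<open>1 - a\<^sup>2\<close> by 1 would leave a cost per
    step that does not shrink with \<open>n\<close>.\<close>
  have K: "lam\<^sup>2 * (norm c)\<^sup>2 * (1 - (norm m)\<^sup>2) \<le> 1 / (2 * real n)"
  proof -
    have "(norm c)\<^sup>2 * (1 - a\<^sup>2) \<le> (norm c * (1 / (1 - a))) * (1 - a\<^sup>2)"
      unfolding power2_eq_square[of "norm c"] using a1 nc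
      by (intro mult_right_mono mult_left_mono) (auto simp: abs_square_le_1)
    also have "\<dots> = norm c * (1 + a)" using a1 by (simp add: power2_eq_square field_simps)
    also have "\<dots> \<le> (real n / \<eta>\<^sup>2) * 2" using a1 by (intro mult_mono nc') auto
    finally have "lam\<^sup>2 * ((norm c)\<^sup>2 * (1 - a\<^sup>2)) \<le> lam\<^sup>2 * ((real n / \<eta>\<^sup>2) * 2)" by (rule mult_left_mono) simp
    also have "\<dots> = 1 / (2 * real n)" using n0 eta by (simp add: lam_def power2_eq_square field_simps)
    finally show ?thesis by (simp add: nm mult.assoc)
  qed
  have K0: "0 \<le> lam\<^sup>2 * (norm c)\<^sup>2 * (1 - (norm m)\<^sup>2)"
    using a1 by (simp add: nm abs_square_le_1)
  let ?f = "\<lambda>Y. ennreal (exp (lam * Re (z * (\<Sum>j<n. \<Prod>i<j. u (Y i)))))"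
  have fm: "?f \<in> borel_measurable (PiM {..<n} (\<lambda>_. borel))"
  proof -
    have mi: "(\<lambda>Y. u (Y i)) \<in> borel_measurable (PiM {..<n} (\<lambda>_. borel))" if "i < n" for i
      by (rule measurable_compose[OF measurable_component_singleton[of i] u]) (use that in auto)
    have "(\<lambda>Y. (\<Sum>j<n. \<Prod>i<j. u (Y i))) \<in> borel_measurable (PiM {..<n} (\<lambda>_. borel))"
      by (intro borel_measurable_sum borel_measurable_prod mi) auto
    then show ?thesis by measurable
  qed
  have Yj: "(\<lambda>\<omega>. \<lambda>i\<in>{..<n}. Y i \<omega>) \<in> measurable M (PiM {..<n} (\<lambda>_. borel))"
    by (rule measurable_restrict) (use Ym in auto)
  have "(\<integral>\<^sup>+\<omega>. ?f (\<lambda>i. Y i \<omega>) \<partial>M) = (\<integral>\<^sup>+\<omega>. ?f (\<lambda>i\<in>{..<n}. Y i \<omega>) \<partial>M)"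
    by (intro nn_integral_cong arg_cong[where f="\<lambda>s. ennreal (exp (lam * Re (z * s)))"] sum.cong prod.cong) auto
  also have "\<dots> = (\<integral>\<^sup>+Y. ?f Y \<partial>(PiM {..<n} (\<lambda>_. \<nu>)))"
    unfolding joint[symmetric] by (subst nn_integral_distr[OF Yj]) (use fm in auto)
  also have "\<dots> = (\<integral>\<^sup>+Y. ennreal (exp (lam * Re (z * (\<Sum>j<n. \<Prod>i<j. u (Y (0 + i)))))) \<partial>(PiM {0..<0+n} (\<lambda>_. \<nu>)))"
    by (simp add: atLeast0LessThan)
  also have "\<dots> \<le> ennreal (exp (lam * norm c)) * ennreal (1 + lam\<^sup>2 * (norm c)\<^sup>2 * (1 - (norm m)\<^sup>2)) ^ n
        * ennreal (exp (lam * Re (z * c)))"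
    unfolding m_def
  proof (rule exp_moment_partial_products[OF p\<nu> _ u1 _ lam0 _ z])
    show "c = 1 + (LINT y|\<nu>. u y) * c" using c by (simp add: m_def)
    show "2 * lam * norm c \<le> 1" using lc by simp
  qed simp
  also have "\<dots> \<le> ennreal (exp (1/2)) * ennreal (exp (1/2)) * ennreal (exp (1/2))"
  proof (intro mult_mono)
    show "ennreal (exp (lam * norm c)) \<le> ennreal (exp (1/2))" using lc by simp
    have "Re (z * c) \<le> norm c" using complex_Re_le_cmod[of "z * c"] z by (simp add: norm_mult)
    then have "lam * Re (z * c) \<le> 1/2" using mult_left_mono[OF _ lam0] lc by (meson order_trans)
    then show "ennreal (exp (lam * Re (z * c))) \<le> ennreal (exp (1/2))" by simp
    have "(1 + lam\<^sup>2 * (norm c)\<^sup>2 * (1 - (norm m)\<^sup>2)) ^ n \<le> exp (1 / (2 * real n)) ^ n"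
    proof (rule power_mono)
      show "1 + lam\<^sup>2 * (norm c)\<^sup>2 * (1 - (norm m)\<^sup>2) \<le> exp (1 / (2 * real n))"
        using K exp_ge_add_one_self[of "1 / (2 * real n)"] by linarith
    qed (use K0 in linarith)
    also have "\<dots> = exp (1/2)" using n0 by (simp add: exp_of_nat_mult[symmetric])
    finally show "ennreal (1 + lam\<^sup>2 * (norm c)\<^sup>2 * (1 - (norm m)\<^sup>2)) ^ n \<le> ennreal (exp (1/2))"
      using K0 by (subst ennreal_power) auto
  qed auto
  also have "\<dots> \<le> ennreal (exp 2)" by (simp add: ennreal_mult'[symmetric] exp_add[symmetric])
  finally show ?thesis by (simp add: Y_def u_def lam_def)
qed

text \<open>The moment bounds concern real parts. The larger of |Re w| and |Im w| is at least half
  of |w|, and it is the real part of \<open>z * w\<close> for one of the four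
  \<open>z\<close>.\<close>

lemma exp_norm_le_sum_Re:
  fixes w :: complex and r :: real
  assumes "0 \<le> r"
  shows "exp (r / 2 * norm w) \<le> (\<Sum>z\<in>{1, -1, \<i>, -\<i>}. exp (r * Re (z * w)))"
proof -
  have eq: "(\<Sum>z\<in>{1, -1, \<i>, -\<i>}. exp (r * Re (z * w))) = exp (r * Re w) + exp (r * - Re w) + exp (r * - Im w) + exp (r * Im w)"
    by (simp add: complex_eq_iff)
  have "norm w \<le> \<bar>Re w\<bar> + \<bar>Im w\<bar>" by (rule cmod_le)
  then have "norm w / 2 \<le> max \<bar>Re w\<bar> \<bar>Im w\<bar>" by (simp add: max_def abs_if split: if_splits)
  then have "r * (norm w / 2) \<le> r * max \<bar>Re w\<bar> \<bar>Im w\<bar>" by (intro mult_left_mono assms)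
  then have "exp (r / 2 * norm w) \<le> exp (r * max \<bar>Re w\<bar> \<bar>Im w\<bar>)" by simp
  also have "\<dots> \<le> exp (r * Re w) + exp (r * - Re w) + exp (r * - Im w) + exp (r * Im w)"
  proof -
    have p: "0 < exp (r * s)" for s by simp
    consider "max \<bar>Re w\<bar> \<bar>Im w\<bar> = Re w" | "max \<bar>Re w\<bar> \<bar>Im w\<bar> = - Re w" | "max \<bar>Re w\<bar> \<bar>Im w\<bar> = Im w" | "max \<bar>Re w\<bar> \<bar>Im w\<bar> = - Im w"
      by (metis abs_if max_def)
    then show ?thesis
      by cases (use p[of "Re w"] p[of "- Re w"] p[of "Im w"] p[of "- Im w"] in \<open>simp_all del: exp_gt_zero\<close>)
  qed
  finally show ?thesis by (simp only: eq)
qed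

section \<open>Oscillatory integrals along a Brownian path\<close>

lemma norm_cis_diff_le: "norm (cis a - cis b) \<le> \<bar>a - b\<bar>"
proof -
  have "(norm (cis a - cis b))\<^sup>2 = 2 - 2 * cos (a - b)"
    by (simp add: cmod_power2 cos_diff power2_diff algebra_simps)
  also have "\<dots> = 4 * (sin ((a - b) / 2))\<^sup>2"
  proof -
    have "2 * ((a - b) / 2) = a - b" by simp
    then show ?thesis using cos_double_sin[of "(a - b) / 2"] by (simp only:) simp
  qed
  also have "\<dots> \<le> 4 * ((a - b) / 2)\<^sup>2"
    using abs_sin_x_le_abs_x[of "(a - b) / 2"] by (intro mult_left_mono abs_le_square_iff[THEN iffD1]) auto
  also have "\<dots> = (a - b)\<^sup>2" by (simp add: power_divide)
  finally show ?thesis by (metis abs_le_square_iff abs_norm_cancel)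
qed

lemma brownian_motionD:
  assumes "brownian_motion M X"
  shows "prob_space M" "\<And>t. 0 \<le> t \<Longrightarrow> t \<le> 1 \<Longrightarrow> X t \<in> borel_measurable M"
    "AE \<omega> in M. continuous_on {0..1} (\<lambda>t. X t \<omega>)"
    "\<And>s t. 0 \<le> s \<Longrightarrow> s < t \<Longrightarrow> t \<le> 1 \<Longrightarrow>
        distributed M lborel (\<lambda>\<omega>. X t \<omega> - X s \<omega>) (normal_density 0 (sqrt (t - s)))"
  using assms by (auto simp: brownian_motion_def)

text \<open>The Riemann sums carry the weight \<open>\<eta> / (2 * n)\<close>. Passing from real
  parts to the modulus halves it, which gives \<open>\<eta> / 4\<close>, and the four directions
  give the factor 4. Fatou's lemma then removes the discretisation.\<close>

lemma brownian_exp_moment_osc: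
  assumes X: "brownian_motion M X" and eta: "1 \<le> \<eta>"
  shows "\<exists>h\<in>borel_measurable M. (AE \<omega> in M. h \<omega> = ennreal (exp (\<eta> / 4 * norm (osc (\<lambda>t. X t \<omega>) \<xi> \<eta>)))) \<and>
     (\<integral>\<^sup>+\<omega>. h \<omega> \<partial>M) \<le> ennreal (4 * exp 2)"
proof -
  note Xm = brownian_motionD(2)[OF X]
  let ?e = "\<lambda>\<omega> t. cis (- (2 * pi * (\<xi> * t + \<eta> * X t \<omega>)))"
  define f where "f n \<omega> = exp (\<eta> / 4 * norm ((1 / real n) *\<^sub>R (\<Sum>j<n. ?e \<omega> (real j / real n))))" for n \<omega>
  have em: "(\<lambda>\<omega>. ?e \<omega> (real j / real n)) \<in> borel_measurable M" if "j < n" for j n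
  proof -
    have [measurable]: "X (real j / real n) \<in> borel_measurable M" by (rule Xm) (use that in auto)
    show ?thesis unfolding cis_conv_exp by measurable
  qed
  have fm: "f n \<in> borel_measurable M" for n
  proof -
    have "(\<lambda>\<omega>. (\<Sum>j<n. ?e \<omega> (real j / real n))) \<in> borel_measurable M"
      by (intro borel_measurable_sum em) auto
    then show ?thesis unfolding f_def by measurable
  qed
  have lim: "AE \<omega> in M. (\<lambda>n. f n \<omega>) \<longlonglongrightarrow> exp (\<eta> / 4 * norm (osc (\<lambda>t. X t \<omega>) \<xi> \<eta>))"
    using brownian_motionD(3)[OF X]
  proof eventually_elim
    fix \<omega> assume c: "continuous_on {0..1} (\<lambda>t. X t \<omega>)"
    have "continuous_on {0..1} (?e \<omega>)" unfolding cis_conv_exp by (intro continuous_intros c)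
    from Riemann_sum_tendsto[OF this] show "(\<lambda>n. f n \<omega>) \<longlonglongrightarrow> exp (\<eta> / 4 * norm (osc (\<lambda>t. X t \<omega>) \<xi> \<eta>))"
      unfolding f_def osc_def by (intro tendsto_intros) simp
  qed
  have bd: "(\<integral>\<^sup>+\<omega>. ennreal (f n \<omega>) \<partial>M) \<le> ennreal (4 * exp 2)" if n: "2 * pi\<^sup>2 * \<eta>\<^sup>2 \<le> real n" for n
  proof -
    let ?R = "\<lambda>\<omega>. \<Sum>j<n. \<Prod>i<j. cis (- (2 * pi * (\<xi> / real n + \<eta> * (X (real (Suc i) / real n) \<omega> - X (real i / real n) \<omega>))))"
    have Rm: "?R \<in> borel_measurable M"
    proof (intro borel_measurable_sum borel_measurable_prod)
      fix j i assume "j \<in> {..<n}" "i \<in> {..<j}"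
      then have [measurable]: "X (real i / real n) \<in> borel_measurable M" "X (real (Suc i) / real n) \<in> borel_measurable M"
        by (auto intro!: Xm simp del: of_nat_Suc)
      show "(\<lambda>\<omega>. cis (- (2 * pi * (\<xi> / real n + \<eta> * (X (real (Suc i) / real n) \<omega> - X (real i / real n) \<omega>))))) \<in> borel_measurable M"
        unfolding cis_conv_exp by measurable
    qed
    have "f n \<omega> \<le> (\<Sum>z\<in>{1, -1, \<i>, -\<i>}. exp (\<eta> / (2 * real n) * Re (z * ?R \<omega>)))" for \<omega>
    proof -
      have "f n \<omega> = exp (\<eta> / (2 * real n) / 2 * norm (?R \<omega>))"
        unfolding f_def Riemann_sum_eq_partial_products[where x="\<lambda>t. X t \<omega>"] by (simp add: norm_mult)
      also have "\<dots> \<le> (\<Sum>z\<in>{1, -1, \<i>, -\<i>}. exp (\<eta> / (2 * real n) * Re (z * ?R \<omega>)))"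
        by (rule exp_norm_le_sum_Re) (use eta in auto)
      finally show ?thesis .
    qed
    then have "(\<integral>\<^sup>+\<omega>. ennreal (f n \<omega>) \<partial>M) \<le> (\<integral>\<^sup>+\<omega>. (\<Sum>z\<in>{1, -1, \<i>, -\<i>}. ennreal (exp (\<eta> / (2 * real n) * Re (z * ?R \<omega>)))) \<partial>M)"
      by (intro nn_integral_mono) (simp only: sum_ennreal exp_ge_zero ennreal_leI)
    also have "\<dots> = (\<Sum>z\<in>{1, -1, \<i>, -\<i>}. \<integral>\<^sup>+\<omega>. ennreal (exp (\<eta> / (2 * real n) * Re (z * ?R \<omega>))) \<partial>M)"
    proof (intro nn_integral_sum)
      fix z
      show "(\<lambda>\<omega>. ennreal (exp (\<eta> / (2 * real n) * Re (z * ?R \<omega>)))) \<in> borel_measurable M"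
        by (rule measurable_compose[OF Rm, where g="\<lambda>w. ennreal (exp (\<eta> / (2 * real n) * Re (z * w)))"]) measurable
    qed
    also have "\<dots> \<le> (\<Sum>z\<in>{1, -1, \<i>, -\<i>}. ennreal (exp 2))"
      by (intro sum_mono brownian_exp_moment_products[OF X eta n]) auto
    also have "\<dots> = of_nat (card {1, -1, \<i>, -\<i>}) * ennreal (exp 2)" by simp
    also have "card {1, -1, \<i>, -\<i>} = 4" by (simp add: complex_eq_iff)
    finally show ?thesis by (simp add: ennreal_mult')
  qed
  have "\<forall>\<^sub>F n in sequentially. (\<integral>\<^sup>+\<omega>. ennreal (f n \<omega>) \<partial>M) \<le> ennreal (4 * exp 2)"
  proof -
    obtain N :: nat where "2 * pi\<^sup>2 * \<eta>\<^sup>2 \<le> real N" using real_arch_simple by blast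
    then show ?thesis unfolding eventually_sequentially
      by (intro exI[of _ N] allI impI bd) (meson of_nat_le_iff order_trans)
  qed
  from nn_integral_AE_limit_le[of f, OF fm lim this] show ?thesis by blast
qed

lemma brownian_increment_abs:
  assumes X: "brownian_motion M X" and st: "0 \<le> s" "s \<le> t" "t \<le> 1"
  shows "(\<integral>\<^sup>+\<omega>. ennreal \<bar>X t \<omega> - X s \<omega>\<bar> \<partial>M) \<le> ennreal (sqrt (t - s))"
proof (cases "s = t")
  case False
  then have st': "s < t" using st by simp
  define \<sigma> where "\<sigma> = sqrt (t - s)"
  have sg: "0 < \<sigma>" using st' by (simp add: \<sigma>_def)
  have d: "distributed M lborel (\<lambda>\<omega>. X t \<omega> - X s \<omega>) (normal_density 0 \<sigma>)"
    unfolding \<sigma>_def using st st' by (intro brownian_motionD(4)[OF X])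
  have b: "has_bochner_integral lborel (\<lambda>x. normal_density 0 \<sigma> x * \<bar>x\<bar>) (\<sigma> * sqrt (2 / pi))"
    using normal_moment_abs_odd[OF sg, of 0 0] by simp
  have "(\<integral>\<^sup>+\<omega>. ennreal \<bar>X t \<omega> - X s \<omega>\<bar> \<partial>M) = (\<integral>\<^sup>+x. ennreal (normal_density 0 \<sigma> x) * ennreal \<bar>x\<bar> \<partial>lborel)"
    by (rule distributed_nn_integral[OF d, symmetric]) measurable
  also have "\<dots> = (\<integral>\<^sup>+x. ennreal (normal_density 0 \<sigma> x * \<bar>x\<bar>) \<partial>lborel)"
    by (simp add: ennreal_mult')
  also have "\<dots> = ennreal (\<sigma> * sqrt (2 / pi))"
    using b by (subst nn_integral_eq_integral) (auto simp: has_bochner_integral_iff)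
  also have "\<dots> \<le> ennreal \<sigma>"
    using sg pi_ge_two by (intro ennreal_leI) (simp add: mult_le_cancel_left1)
  finally show ?thesis by (simp add: \<sigma>_def)
qed auto

text \<open>The L^1 distance on \<open>[0,1]\<close> from \<open>x\<close> to the step function that
  takes the left endpoint values of \<open>x\<close> on \<open>L\<close> equal blocks.\<close>

definition block_osc :: "nat \<Rightarrow> (real \<Rightarrow> real) \<Rightarrow> real" where
  "block_osc L x = (\<Sum>j<L. integral {real j / real L..real (Suc j) / real L} (\<lambda>t. \<bar>x t - x (real j / real L)\<bar>))"

text \<open>Increments within a block have mean modulus at most \<open>1 / sqrt L\<close>, and the
  blocks have total length 1. The time integral is handled through Riemann sums because
  \<open>brownian_motion\<close> grants measurability at each fixed time, not jointly in time and
  \<omega>.\<close>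

lemma brownian_block_osc:
  assumes X: "brownian_motion M X" and L: "1 \<le> L"
  shows "\<exists>h\<in>borel_measurable M. (AE \<omega> in M. h \<omega> = ennreal (block_osc L (\<lambda>t. X t \<omega>))) \<and>
     (\<integral>\<^sup>+\<omega>. h \<omega> \<partial>M) \<le> ennreal (1 / sqrt (real L))"
proof -
  note Xm = brownian_motionD(2)[OF X]
  define a where "a j = real j / real L" for j
  define s where "s j n i = a j + real i * (a (Suc j) - a j) / real n" for j n i
  have L0: "0 < real L" using L by simp
  have aa: "a (Suc j) - a j = 1 / real L" for j using L by (simp add: a_def diff_divide_distrib[symmetric])
  have a0: "0 \<le> a j" for j by (simp add: a_def)
  have a1: "a j \<le> 1" if "j \<le> L" for j using that L by (simp add: a_def)
  have s: "a j \<le> s j n i" "s j n i \<le> a (Suc j)" if "i < n" for j n i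
  proof -
    have "real i * (1 / real L) / real n \<le> 1 / real L" using that L0 by (simp add: field_simps)
    then show "s j n i \<le> a (Suc j)" using aa[of j] unfolding s_def by simp
    show "a j \<le> s j n i" unfolding s_def aa by simp
  qed
  define f where "f n \<omega> = (\<Sum>j<L. ((a (Suc j) - a j) / real n) *\<^sub>R (\<Sum>i<n. \<bar>X (s j n i) \<omega> - X (a j) \<omega>\<bar>))" for n \<omega>
  have Xsm: "X (s j n i) \<in> borel_measurable M" "X (a j) \<in> borel_measurable M" if "j < L" "i < n" for j n i
    using s[OF that(2), of j] a0[of j] a1[of "Suc j"] a1[of j] that by (auto intro!: Xm)
  have fm: "f n \<in> borel_measurable M" for n
    unfolding f_def
    by (intro borel_measurable_sum borel_measurable_scaleR borel_measurable_const borel_measurable_abs borel_measurable_diff Xsm) auto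
  have lim: "AE \<omega> in M. (\<lambda>n. f n \<omega>) \<longlonglongrightarrow> block_osc L (\<lambda>t. X t \<omega>)"
    using brownian_motionD(3)[OF X]
  proof eventually_elim
    fix \<omega> assume c: "continuous_on {0..1} (\<lambda>t. X t \<omega>)"
    show "(\<lambda>n. f n \<omega>) \<longlonglongrightarrow> block_osc L (\<lambda>t. X t \<omega>)"
      unfolding f_def block_osc_def
    proof (rule tendsto_sum)
      fix j assume j: "j \<in> {..<L}"
      have "continuous_on {a j..a (Suc j)} (\<lambda>t. \<bar>X t \<omega> - X (a j) \<omega>\<bar>)"
        by (intro continuous_intros continuous_on_subset[OF c]) (use a0[of j] a1[of "Suc j"] j in auto)
      from Riemann_sum_tendsto[OF this] aa[of j] L0
      show "(\<lambda>n. ((a (Suc j) - a j) / real n) *\<^sub>R (\<Sum>i<n. \<bar>X (s j n i) \<omega> - X (a j) \<omega>\<bar>))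
         \<longlonglongrightarrow> integral {real j / real L..real (Suc j) / real L} (\<lambda>t. \<bar>X t \<omega> - X (real j / real L) \<omega>\<bar>)"
        unfolding s_def by (simp add: a_def divide_right_mono del: of_nat_Suc)
    qed
  qed
  have bd: "(\<integral>\<^sup>+\<omega>. ennreal (f n \<omega>) \<partial>M) \<le> ennreal (1 / sqrt (real L))" if n: "1 \<le> n" for n
  proof -
    have "(\<integral>\<^sup>+\<omega>. ennreal (f n \<omega>) \<partial>M) = (\<integral>\<^sup>+\<omega>. (\<Sum>j<L. ennreal (1 / (real L * real n)) * (\<Sum>i<n. ennreal \<bar>X (s j n i) \<omega> - X (a j) \<omega>\<bar>)) \<partial>M)"
      unfolding f_def aa by (intro nn_integral_cong) (simp add: sum_nonneg ennreal_mult'[symmetric])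
    also have "\<dots> = (\<Sum>j<L. ennreal (1 / (real L * real n)) * (\<Sum>i<n. \<integral>\<^sup>+\<omega>. ennreal \<bar>X (s j n i) \<omega> - X (a j) \<omega>\<bar> \<partial>M))"
    proof (subst nn_integral_sum)
      show "(\<lambda>\<omega>. ennreal (1 / (real L * real n)) * (\<Sum>i<n. ennreal \<bar>X (s j n i) \<omega> - X (a j) \<omega>\<bar>)) \<in> borel_measurable M" if "j \<in> {..<L}" for j
        using that by (intro borel_measurable_times_ennreal borel_measurable_sum borel_measurable_const measurable_compose[OF _ measurable_ennreal] borel_measurable_abs borel_measurable_diff Xsm) auto
      show "(\<Sum>j<L. \<integral>\<^sup>+\<omega>. ennreal (1 / (real L * real n)) * (\<Sum>i<n. ennreal \<bar>X (s j n i) \<omega> - X (a j) \<omega>\<bar>) \<partial>M) =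
         (\<Sum>j<L. ennreal (1 / (real L * real n)) * (\<Sum>i<n. \<integral>\<^sup>+\<omega>. ennreal \<bar>X (s j n i) \<omega> - X (a j) \<omega>\<bar> \<partial>M))"
      proof (rule sum.cong[OF refl])
        fix j assume j: "j \<in> {..<L}"
        have mm: "(\<lambda>\<omega>. ennreal \<bar>X (s j n i) \<omega> - X (a j) \<omega>\<bar>) \<in> borel_measurable M" if "i \<in> {..<n}" for i
          using that j by (intro measurable_compose[OF _ measurable_ennreal] borel_measurable_abs borel_measurable_diff Xsm) auto
        show "(\<integral>\<^sup>+\<omega>. ennreal (1 / (real L * real n)) * (\<Sum>i<n. ennreal \<bar>X (s j n i) \<omega> - X (a j) \<omega>\<bar>) \<partial>M)
          = ennreal (1 / (real L * real n)) * (\<Sum>i<n. \<integral>\<^sup>+\<omega>. ennreal \<bar>X (s j n i) \<omega> - X (a j) \<omega>\<bar> \<partial>M)"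
          by (subst nn_integral_sum[of "{..<n}", OF mm, symmetric]) (auto intro!: nn_integral_cmult borel_measurable_sum mm simp del: sum_ennreal)
      qed
    qed
    also have "\<dots> \<le> (\<Sum>j<L. ennreal (1 / (real L * real n)) * (\<Sum>i<n. ennreal (1 / sqrt (real L))))"
    proof (intro sum_mono mult_left_mono)
      fix j i assume ji: "j \<in> {..<L}" "i \<in> {..<n}"
      have "(\<integral>\<^sup>+\<omega>. ennreal \<bar>X (s j n i) \<omega> - X (a j) \<omega>\<bar> \<partial>M) \<le> ennreal (sqrt (s j n i - a j))"
        by (rule brownian_increment_abs[OF X]) (use ji s[of i n j] a0[of j] a1[of "Suc j"] in auto)
      also have "\<dots> \<le> ennreal (1 / sqrt (real L))"
        using s[of i n j] ji aa[of j] real_sqrt_le_mono[of "s j n i - a j" "1 / real L"]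
        by (intro ennreal_leI) (simp add: real_sqrt_divide)
      finally show "(\<integral>\<^sup>+\<omega>. ennreal \<bar>X (s j n i) \<omega> - X (a j) \<omega>\<bar> \<partial>M) \<le> ennreal (1 / sqrt (real L))" .
    qed auto
    also have "\<dots> = ennreal (1 / sqrt (real L))"
      using L n by (simp add: ennreal_of_nat_eq_real_of_nat ennreal_mult'[symmetric])
    finally show ?thesis .
  qed
  have "\<forall>\<^sub>F n in sequentially. (\<integral>\<^sup>+\<omega>. ennreal (f n \<omega>) \<partial>M) \<le> ennreal (1 / sqrt (real L))"
    using eventually_ge_at_top[of 1] by eventually_elim (rule bd)
  from nn_integral_AE_limit_le[of f, OF fm lim this] show ?thesis by blast
qed

lemma norm_integral_cis_le:
  fixes \<xi> a b :: real
  assumes ab: "a \<le> b" and xi: "\<xi> \<noteq> 0"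
  shows "norm (integral {a..b} (\<lambda>t. cis (- (2 * pi * (\<xi> * t))))) \<le> 1 / \<bar>\<xi>\<bar>"
proof -
  define k where "k = - (2 * pi * \<xi>)"
  have k: "k \<noteq> 0" using xi by (simp add: k_def)
  define F where "F t = cis (k * t) / (\<i> * of_real k)" for t :: real
  have "((\<lambda>t. cis (k * t)) has_integral (F b - F a)) {a..b}"
  proof (rule fundamental_theorem_of_calculus[OF ab])
    fix t assume "t \<in> {a..b}"
    show "(F has_vector_derivative cis (k * t)) (at t within {a..b})"
    proof -
      have "((\<lambda>z. exp (\<i> * of_real k * z) / (\<i> * of_real k)) has_field_derivative exp (\<i> * of_real k * of_real t)) (at (of_real t))"
        by (rule derivative_eq_intros refl | simp add: k)+
      from has_vector_derivative_real_field[OF this, of "{a..b}"] show ?thesis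
        by (simp add: F_def[abs_def] cis_conv_exp mult.assoc)
    qed
  qed
  then have "integral {a..b} (\<lambda>t. cis (- (2 * pi * (\<xi> * t)))) = F b - F a"
    by (simp add: integral_unique k_def mult.assoc)
  also have "norm \<dots> \<le> norm (F b) + norm (F a)" by (rule norm_triangle_ineq4)
  also have "\<dots> = 2 / \<bar>k\<bar>" by (simp add: F_def norm_divide norm_mult)
  also have "\<dots> \<le> 1 / \<bar>\<xi>\<bar>"
    using pi_ge_two xi by (simp add: k_def abs_mult field_simps)
  finally show ?thesis .
qed

lemma continuous_on_osc_integrand:
  assumes "continuous_on S x"
  shows "continuous_on S (\<lambda>t. cis (- (2 * pi * (\<xi> * t + \<eta> * x t))))"
  unfolding cis_conv_exp by (intro continuous_intros assms)

text \<open>Freezing the path on each block costs \<open>2 * pi * \<bar>\<eta>\<bar>\<close> times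
  its oscillation there. What remains is a pure exponential, whose integral over any interval is at
  most 1 / |\<xi>|. The bound is of use when |\<xi>| is much larger than \<open>L\<close>.\<close>

lemma norm_osc_le_block_osc:
  assumes x: "continuous_on {0..1} x" and L: "1 \<le> L" and xi: "\<xi> \<noteq> 0"
  shows "norm (osc x \<xi> \<eta>) \<le> 2 * pi * \<bar>\<eta>\<bar> * block_osc L x + real L / \<bar>\<xi>\<bar>"
proof -
  define a where "a j = real j / real L" for j
  define e where "e t = cis (- (2 * pi * (\<xi> * t + \<eta> * x t)))" for t
  have ce: "continuous_on {0..1} e" unfolding e_def by (rule continuous_on_osc_integrand[OF x])
  have le: "a j \<le> a (Suc j)" for j by (simp add: a_def divide_right_mono)
  have sub: "{a j..a (Suc j)} \<subseteq> {0..1}" if "j < L" for j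
  proof -
    have "a (Suc j) \<le> 1" using that L by (simp add: a_def)
    moreover have "0 \<le> a j" by (simp add: a_def)
    ultimately show ?thesis by auto
  qed
  have block: "norm (integral {a j..a (Suc j)} e) \<le> 2 * pi * \<bar>\<eta>\<bar> * integral {a j..a (Suc j)} (\<lambda>t. \<bar>x t - x (a j)\<bar>) + 1 / \<bar>\<xi>\<bar>"
    if j: "j < L" for j
  proof -
    define b where "b t = cis (- (2 * pi * (\<xi> * t))) * cis (- (2 * pi * \<eta> * x (a j)))" for t
    have cb: "continuous_on {a j..a (Suc j)} b" unfolding b_def cis_conv_exp by (intro continuous_intros)
    have ce': "continuous_on {a j..a (Suc j)} e" by (rule continuous_on_subset[OF ce sub[OF j]])
    have cx: "continuous_on {a j..a (Suc j)} x" by (rule continuous_on_subset[OF x sub[OF j]])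
    have "integral {a j..a (Suc j)} e = integral {a j..a (Suc j)} (\<lambda>t. e t - b t) + integral {a j..a (Suc j)} b"
      using cb ce' by (subst Henstock_Kurzweil_Integration.integral_diff) (auto intro!: integrable_continuous_interval)
    also have "norm \<dots> \<le> norm (integral {a j..a (Suc j)} (\<lambda>t. e t - b t)) + norm (integral {a j..a (Suc j)} b)"
      by (rule norm_triangle_ineq)
    also have "norm (integral {a j..a (Suc j)} (\<lambda>t. e t - b t)) \<le> integral {a j..a (Suc j)} (\<lambda>t. 2 * pi * \<bar>\<eta>\<bar> * \<bar>x t - x (a j)\<bar>)"
    proof (rule integral_norm_bound_integral)
      show "(\<lambda>t. e t - b t) integrable_on {a j..a (Suc j)}"
        by (intro integrable_continuous_interval continuous_intros ce' cb)
      show "(\<lambda>t. 2 * pi * \<bar>\<eta>\<bar> * \<bar>x t - x (a j)\<bar>) integrable_on {a j..a (Suc j)}"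
        by (intro integrable_continuous_interval continuous_intros cx)
      fix t
      have "norm (e t - b t) = norm (cis (- (2 * pi * (\<xi> * t + \<eta> * x t))) - cis (- (2 * pi * (\<xi> * t + \<eta> * x (a j)))))"
        unfolding e_def b_def cis_mult by (simp add: algebra_simps)
      also have "\<dots> \<le> \<bar>- (2 * pi * (\<xi> * t + \<eta> * x t)) - - (2 * pi * (\<xi> * t + \<eta> * x (a j)))\<bar>"
        by (rule norm_cis_diff_le)
      also have "- (2 * pi * (\<xi> * t + \<eta> * x t)) - - (2 * pi * (\<xi> * t + \<eta> * x (a j))) = - (2 * pi * \<eta> * (x t - x (a j)))"
        by (simp add: algebra_simps)
      also have "\<bar>- (2 * pi * \<eta> * (x t - x (a j)))\<bar> = 2 * pi * \<bar>\<eta>\<bar> * \<bar>x t - x (a j)\<bar>"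
        by (simp add: abs_mult)
      finally show "norm (e t - b t) \<le> 2 * pi * \<bar>\<eta>\<bar> * \<bar>x t - x (a j)\<bar>" .
    qed
    also have "integral {a j..a (Suc j)} (\<lambda>t. 2 * pi * \<bar>\<eta>\<bar> * \<bar>x t - x (a j)\<bar>) = 2 * pi * \<bar>\<eta>\<bar> * integral {a j..a (Suc j)} (\<lambda>t. \<bar>x t - x (a j)\<bar>)"
      by (rule Henstock_Kurzweil_Integration.integral_mult_right)
    also have "norm (integral {a j..a (Suc j)} b) = norm (integral {a j..a (Suc j)} (\<lambda>t. cis (- (2 * pi * (\<xi> * t)))))"
      unfolding b_def by (simp add: norm_mult)
    also have "\<dots> \<le> 1 / \<bar>\<xi>\<bar>" by (rule norm_integral_cis_le[OF le xi])
    finally show ?thesis by simp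
  qed
  have "osc x \<xi> \<eta> = (\<Sum>j<L. integral {a j..a (Suc j)} e)"
    unfolding osc_def e_def[symmetric] a_def using integral_uniform_partition[OF ce, of L] L by simp
  also have "norm \<dots> \<le> (\<Sum>j<L. 2 * pi * \<bar>\<eta>\<bar> * integral {a j..a (Suc j)} (\<lambda>t. \<bar>x t - x (a j)\<bar>) + 1 / \<bar>\<xi>\<bar>)"
    by (intro sum_norm_le block) auto
  also have "\<dots> = 2 * pi * \<bar>\<eta>\<bar> * block_osc L x + real L / \<bar>\<xi>\<bar>"
    by (simp add: block_osc_def a_def sum.distrib sum_distrib_left)
  finally show ?thesis .
qed

text \<open>Carries a bound from a grid point to the frequencies around it; the path matters only
  through a bound \<open>S\<close> on its values.\<close>

lemma osc_Lipschitz: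
  assumes x: "continuous_on {0..1} x" and S: "\<And>t. t \<in> {0..1} \<Longrightarrow> \<bar>x t\<bar> \<le> S"
  shows "norm (osc x \<xi> \<eta>) \<le> norm (osc x \<xi>' \<eta>') + 2 * pi * (\<bar>\<xi> - \<xi>'\<bar> + S * \<bar>\<eta> - \<eta>'\<bar>)"
proof -
  define e where "e \<xi> \<eta> t = cis (- (2 * pi * (\<xi> * t + \<eta> * x t)))" for \<xi> \<eta> t
  have ce: "continuous_on {0..1} (e \<xi> \<eta>)" for \<xi> \<eta> unfolding e_def by (rule continuous_on_osc_integrand[OF x])
  have "osc x \<xi> \<eta> - osc x \<xi>' \<eta>' = integral {0..1} (\<lambda>t. e \<xi> \<eta> t - e \<xi>' \<eta>' t)"
    unfolding osc_def e_def[symmetric] using ce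
    by (subst Henstock_Kurzweil_Integration.integral_diff) (auto intro!: integrable_continuous_interval)
  also have "norm \<dots> \<le> (2 * pi * (\<bar>\<xi> - \<xi>'\<bar> + S * \<bar>\<eta> - \<eta>'\<bar>)) * (1 - 0)"
  proof (rule integral_bound)
    show "continuous_on {0..1} (\<lambda>t. e \<xi> \<eta> t - e \<xi>' \<eta>' t)" by (intro continuous_intros ce)
    fix t :: real assume t: "t \<in> {0..1}"
    have "norm (e \<xi> \<eta> t - e \<xi>' \<eta>' t) \<le> \<bar>- (2 * pi * (\<xi> * t + \<eta> * x t)) - - (2 * pi * (\<xi>' * t + \<eta>' * x t))\<bar>"
      unfolding e_def by (rule norm_cis_diff_le)
    also have "- (2 * pi * (\<xi> * t + \<eta> * x t)) - - (2 * pi * (\<xi>' * t + \<eta>' * x t)) = - (2 * pi * ((\<xi> - \<xi>') * t + (\<eta> - \<eta>') * x t))"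
      by (simp add: algebra_simps)
    also have "\<bar>\<dots>\<bar> = 2 * pi * \<bar>(\<xi> - \<xi>') * t + (\<eta> - \<eta>') * x t\<bar>" by (simp add: abs_mult)
    also have "\<dots> \<le> 2 * pi * (\<bar>\<xi> - \<xi>'\<bar> * 1 + \<bar>\<eta> - \<eta>'\<bar> * S)"
      using t S[OF t]
      by (intro mult_left_mono order_trans[OF abs_triangle_ineq] add_mono) (auto simp: abs_mult intro!: mult_left_le mult_left_mono)
    finally show "norm (e \<xi> \<eta> t - e \<xi>' \<eta>' t) \<le> 2 * pi * (\<bar>\<xi> - \<xi>'\<bar> + S * \<bar>\<eta> - \<eta>'\<bar>)" by (simp add: mult.commute)
  qed simp
  finally have "norm (osc x \<xi> \<eta> - osc x \<xi>' \<eta>') \<le> 2 * pi * (\<bar>\<xi> - \<xi>'\<bar> + S * \<bar>\<eta> - \<eta>'\<bar>)" by simp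
  then show ?thesis using norm_triangle_sub[of "osc x \<xi> \<eta>" "osc x \<xi>' \<eta>'"] by linarith
qed

lemma norm_osc_minus: "norm (osc x (- \<xi>) (- \<eta>)) = norm (osc x \<xi> \<eta>)"
proof -
  have "osc x (- \<xi>) (- \<eta>) = integral {0..1} (\<lambda>t. cnj (cis (- (2 * pi * (\<xi> * t + \<eta> * x t)))))"
    unfolding osc_def cis_cnj by (simp add: algebra_simps)
  also have "\<dots> = cnj (osc x \<xi> \<eta>)" unfolding osc_def by (rule integral_cnj[symmetric])
  finally show ?thesis by simp
qed

text \<open>The grid has mesh \<open>1 / N\<close> and covers |\<xi>| \<le> N^9 and \<eta> between N
  and N + 1. It has O(N^11) points, so the moments summed over it have expectation O(N^11), and
  making the bound hold for all \<open>N\<close> at once costs another \<open>N ^ 2\<close>. The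
  power 13 is harmless, since a logarithm will be taken.\<close>

lemma AE_brownian_grid_bound:
  assumes X: "brownian_motion M X"
  shows "AE \<omega> in M. \<exists>K\<ge>1. \<forall>N\<ge>1. \<forall>a b. \<bar>a\<bar> \<le> int N ^ 10 \<longrightarrow> b \<in> {N\<^sup>2..N\<^sup>2 + N} \<longrightarrow>
    exp (real b / real N / 4 * norm (osc (\<lambda>t. X t \<omega>) (of_int a / real N) (real b / real N))) \<le> K * real N ^ 13"
proof -
  \<comment> \<open>Measurable versions of the moments, one for each pair of frequencies, chosen
    globally so that they can be summed over the grid.\<close>
  obtain H where H: "\<And>\<xi> \<eta>. 1 \<le> \<eta> \<Longrightarrow> H \<xi> \<eta> \<in> borel_measurable M"
     "\<And>\<xi> \<eta>. 1 \<le> \<eta> \<Longrightarrow> AE \<omega> in M. H \<xi> \<eta> \<omega> = ennreal (exp (\<eta> / 4 * norm (osc (\<lambda>t. X t \<omega>) \<xi> \<eta>)))"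
     "\<And>\<xi> \<eta>. 1 \<le> \<eta> \<Longrightarrow> (\<integral>\<^sup>+\<omega>. H \<xi> \<eta> \<omega> \<partial>M) \<le> ennreal (4 * exp 2)"
  proof -
    define P where "P \<xi> \<eta> h \<longleftrightarrow> h \<in> borel_measurable M \<and>
      (AE \<omega> in M. h \<omega> = ennreal (exp (\<eta> / 4 * norm (osc (\<lambda>t. X t \<omega>) \<xi> \<eta>)))) \<and>
      (\<integral>\<^sup>+\<omega>. h \<omega> \<partial>M) \<le> ennreal (4 * exp 2)" for \<xi> \<eta> h
    have ex: "\<exists>h. P \<xi> \<eta> h" if "1 \<le> \<eta>" for \<xi> \<eta>
      using brownian_exp_moment_osc[OF X that, of \<xi>] by (auto simp: P_def)
    define H where "H \<xi> \<eta> = (SOME h. P \<xi> \<eta> h)" for \<xi> \<eta>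
    have H: "P \<xi> \<eta> (H \<xi> \<eta>)" if "1 \<le> \<eta>" for \<xi> \<eta>
      unfolding H_def by (rule someI_ex[OF ex[OF that]])
    show thesis
    proof (rule that[of H])
      fix \<xi> \<eta> :: real assume "1 \<le> \<eta>"
      from H[OF this, of \<xi>] show "H \<xi> \<eta> \<in> borel_measurable M"
        "AE \<omega> in M. H \<xi> \<eta> \<omega> = ennreal (exp (\<eta> / 4 * norm (osc (\<lambda>t. X t \<omega>) \<xi> \<eta>)))"
        "(\<integral>\<^sup>+\<omega>. H \<xi> \<eta> \<omega> \<partial>M) \<le> ennreal (4 * exp 2)"
        unfolding P_def by blast+
    qed
  qed
  define A where "A N = {- (int N ^ 10)..int N ^ 10}" for N
  define B where "B N = {N\<^sup>2..N\<^sup>2 + N}" for N :: nat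
  have B1: "1 \<le> real b / real N" if "1 \<le> N" "b \<in> B N" for N b
  proof -
    have "N \<le> N * N" by simp
    then have "N \<le> b" using that unfolding B_def power2_eq_square by (meson atLeastAtMost_iff order_trans)
    then show ?thesis using that by simp
  qed
  define f where "f N \<omega> = (if 1 \<le> N then \<Sum>a\<in>A N. \<Sum>b\<in>B N. H (of_int a / real N) (real b / real N) \<omega> else 0)" for N \<omega>
  have fm: "f N \<in> borel_measurable M" for N
  proof (cases "1 \<le> N")
    case True
    have "(\<lambda>\<omega>. \<Sum>a\<in>A N. \<Sum>b\<in>B N. H (of_int a / real N) (real b / real N) \<omega>) \<in> borel_measurable M"
      by (intro borel_measurable_sum H(1) B1 True)
    then show ?thesis using True by (simp add: f_def[abs_def])
  qed (simp add: f_def[abs_def])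
  have "AE \<omega> in M. \<exists>K\<ge>1. \<forall>N\<ge>1. f N \<omega> \<le> ennreal (K * real N ^ (11 + 2))"
  proof (rule AE_polynomial_bound[OF fm])
    fix N :: nat assume N: "1 \<le> N"
    have "(\<integral>\<^sup>+\<omega>. f N \<omega> \<partial>M) = (\<Sum>a\<in>A N. \<Sum>b\<in>B N. \<integral>\<^sup>+\<omega>. H (of_int a / real N) (real b / real N) \<omega> \<partial>M)"
    proof -
      have m: "H (of_int a / real N) (real b / real N) \<in> borel_measurable M" if "b \<in> B N" for a b
        by (rule H(1)[OF B1[OF N that]])
      have "(\<integral>\<^sup>+\<omega>. f N \<omega> \<partial>M) = (\<integral>\<^sup>+\<omega>. (\<Sum>a\<in>A N. \<Sum>b\<in>B N. H (of_int a / real N) (real b / real N) \<omega>) \<partial>M)"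
        using N by (simp add: f_def)
      also have "\<dots> = (\<Sum>a\<in>A N. \<integral>\<^sup>+\<omega>. (\<Sum>b\<in>B N. H (of_int a / real N) (real b / real N) \<omega>) \<partial>M)"
        by (intro nn_integral_sum borel_measurable_sum m)
      also have "\<dots> = (\<Sum>a\<in>A N. \<Sum>b\<in>B N. \<integral>\<^sup>+\<omega>. H (of_int a / real N) (real b / real N) \<omega> \<partial>M)"
        by (intro sum.cong refl nn_integral_sum m)
      finally show ?thesis .
    qed
    also have "\<dots> \<le> (\<Sum>a\<in>A N. \<Sum>b\<in>B N. ennreal (4 * exp 2))"
      by (intro sum_mono H(3) B1 N)
    also have "\<dots> = ennreal (real (card (A N)) * (real (card (B N)) * (4 * exp 2)))"
      by (simp add: ennreal_of_nat_eq_real_of_nat ennreal_mult'[symmetric])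
    also have "\<dots> \<le> ennreal ((24 * exp 2) * real N ^ 11)"
    proof (rule ennreal_leI)
      have N10: "1 \<le> real N ^ 10" using N by (intro one_le_power) simp
      have "real (card (A N)) = 2 * real N ^ 10 + 1"
        by (simp add: A_def nat_add_distrib nat_mult_distrib nat_power_eq of_nat_nat)
      then have cA: "real (card (A N)) \<le> 3 * real N ^ 10" using N10 by linarith
      have cB: "real (card (B N)) \<le> 2 * real N" using N by (simp add: B_def)
      have "real (card (A N)) * (real (card (B N)) * (4 * exp 2)) \<le> (3 * real N ^ 10) * ((2 * real N) * (4 * exp 2))"
        by (intro mult_mono cA cB) auto
      also have "\<dots> = (24 * exp 2) * real N ^ 11"
        using power_Suc2[of "real N" 10] by simp
      finally show "real (card (A N)) * (real (card (B N)) * (4 * exp 2)) \<le> (24 * exp 2) * real N ^ 11" .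
    qed
    finally show "(\<integral>\<^sup>+\<omega>. f N \<omega> \<partial>M) \<le> ennreal ((24 * exp 2) * real N ^ 11)" .
  qed
  \<comment> \<open>Each version agrees with its moment only off a null set. There are countably
    many triples \<open>N\<close>, \<open>a\<close>, \<open>b\<close>, so one null set serves all of
    them.\<close>
  moreover have "AE \<omega> in M. \<forall>N a b. 1 \<le> N \<and> b \<in> B N \<longrightarrow>
     H (of_int a / real N) (real b / real N) \<omega> = ennreal (exp (real b / real N / 4 * norm (osc (\<lambda>t. X t \<omega>) (of_int a / real N) (real b / real N))))"
  proof (intro AE_all_countable[THEN iffD2] allI)
    fix N b :: nat and a :: int
    show "AE \<omega> in M. 1 \<le> N \<and> b \<in> B N \<longrightarrow>
     H (of_int a / real N) (real b / real N) \<omega> = ennreal (exp (real b / real N / 4 * norm (osc (\<lambda>t. X t \<omega>) (of_int a / real N) (real b / real N))))"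
    proof (cases "1 \<le> N \<and> b \<in> B N")
      case True
      then have "AE \<omega> in M. H (of_int a / real N) (real b / real N) \<omega> = ennreal (exp (real b / real N / 4 * norm (osc (\<lambda>t. X t \<omega>) (of_int a / real N) (real b / real N))))"
        by (intro H(2) B1) auto
      then show ?thesis by eventually_elim blast
    qed auto
  qed
  ultimately show ?thesis
  proof eventually_elim
    fix \<omega>
    assume "\<exists>K\<ge>1. \<forall>N\<ge>1. f N \<omega> \<le> ennreal (K * real N ^ (11 + 2))"
    then obtain K where K: "1 \<le> K" "\<And>N. 1 \<le> N \<Longrightarrow> f N \<omega> \<le> ennreal (K * real N ^ 13)" by auto
    assume eq: "\<forall>N a b. 1 \<le> N \<and> b \<in> B N \<longrightarrow>
     H (of_int a / real N) (real b / real N) \<omega> = ennreal (exp (real b / real N / 4 * norm (osc (\<lambda>t. X t \<omega>) (of_int a / real N) (real b / real N))))"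
    show "\<exists>K\<ge>1. \<forall>N\<ge>1. \<forall>a b. \<bar>a\<bar> \<le> int N ^ 10 \<longrightarrow> b \<in> {N\<^sup>2..N\<^sup>2 + N} \<longrightarrow>
      exp (real b / real N / 4 * norm (osc (\<lambda>t. X t \<omega>) (of_int a / real N) (real b / real N))) \<le> K * real N ^ 13"
    proof (intro exI[of _ K] conjI allI impI K(1))
      fix N b :: nat and a :: int assume N: "1 \<le> N" and a: "\<bar>a\<bar> \<le> int N ^ 10" and b: "b \<in> {N\<^sup>2..N\<^sup>2 + N}"
      have aA: "a \<in> A N" and bB: "b \<in> B N" using a b by (auto simp: A_def B_def)
      have "H (of_int a / real N) (real b / real N) \<omega> \<le> (\<Sum>b\<in>B N. H (of_int a / real N) (real b / real N) \<omega>)"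
        by (rule member_le_sum[OF bB]) (auto simp: B_def)
      also have "\<dots> \<le> f N \<omega>"
        unfolding f_def using N
        by (simp, intro member_le_sum[OF aA, of "\<lambda>a. \<Sum>b\<in>B N. H (of_int a / real N) (real b / real N) \<omega>"]) (auto simp: A_def)
      also have "\<dots> \<le> ennreal (K * real N ^ 13)" by (rule K(2)[OF N])
      finally show "exp (real b / real N / 4 * norm (osc (\<lambda>t. X t \<omega>) (of_int a / real N) (real b / real N))) \<le> K * real N ^ 13"
        using eq N bB K(1) by (auto simp: ennreal_le_iff)
    qed
  qed
qed


text \<open>With \<open>N ^ 8\<close> blocks the mean is at most \<open>1 / N ^ 4\<close>. Weighted
  by \<open>N ^ 4\<close> it is bounded, and making the bound almost sure for all \<open>N\<close>
  gives back \<open>N ^ 2\<close>.\<close>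

lemma AE_brownian_block_osc_bound:
  assumes X: "brownian_motion M X"
  shows "AE \<omega> in M. \<exists>K\<ge>1. \<forall>N\<ge>1. block_osc (N ^ 8) (\<lambda>t. X t \<omega>) \<le> K / real N ^ 2"
proof -
  obtain H where H: "\<And>L. 1 \<le> L \<Longrightarrow> H L \<in> borel_measurable M"
     "\<And>L. 1 \<le> L \<Longrightarrow> AE \<omega> in M. H L \<omega> = ennreal (block_osc L (\<lambda>t. X t \<omega>))"
     "\<And>L. 1 \<le> L \<Longrightarrow> (\<integral>\<^sup>+\<omega>. H L \<omega> \<partial>M) \<le> ennreal (1 / sqrt (real L))"
  proof -
    define P where "P L h \<longleftrightarrow> h \<in> borel_measurable M \<and>
      (AE \<omega> in M. h \<omega> = ennreal (block_osc L (\<lambda>t. X t \<omega>))) \<and>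
      (\<integral>\<^sup>+\<omega>. h \<omega> \<partial>M) \<le> ennreal (1 / sqrt (real L))" for L h
    have ex: "\<exists>h. P L h" if "1 \<le> L" for L
      using brownian_block_osc[OF X that] by (auto simp: P_def)
    define H where "H L = (SOME h. P L h)" for L
    have H: "P L (H L)" if "1 \<le> L" for L
      unfolding H_def by (rule someI_ex[OF ex[OF that]])
    show thesis
    proof (rule that[of H])
      fix L :: nat assume "1 \<le> L"
      from H[OF this] show "H L \<in> borel_measurable M"
        "AE \<omega> in M. H L \<omega> = ennreal (block_osc L (\<lambda>t. X t \<omega>))"
        "(\<integral>\<^sup>+\<omega>. H L \<omega> \<partial>M) \<le> ennreal (1 / sqrt (real L))"
        unfolding P_def by blast+
    qed
  qed
  define f where "f N \<omega> = (if 1 \<le> N then ennreal (real N ^ 4) * H (N ^ 8) \<omega> else 0)" for N \<omega>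
  have fm: "f N \<in> borel_measurable M" for N
    using H(1)[of "N ^ 8"] by (cases "1 \<le> N") (simp_all add: f_def[abs_def])
  have "AE \<omega> in M. \<exists>K\<ge>1. \<forall>N\<ge>1. f N \<omega> \<le> ennreal (K * real N ^ (0 + 2))"
  proof (rule AE_polynomial_bound[OF fm])
    fix N :: nat assume N: "1 \<le> N"
    have N8: "1 \<le> N ^ 8" using N by (rule one_le_power)
    have "(\<integral>\<^sup>+\<omega>. f N \<omega> \<partial>M) = ennreal (real N ^ 4) * (\<integral>\<^sup>+\<omega>. H (N ^ 8) \<omega> \<partial>M)"
      using N H(1)[OF N8] by (simp add: f_def nn_integral_cmult)
    also have "\<dots> \<le> ennreal (real N ^ 4) * ennreal (1 / sqrt (real (N ^ 8)))"
      by (intro mult_left_mono H(3) N8) simp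
    also have "sqrt (real (N ^ 8)) = real N ^ 4"
      by (rule real_sqrt_unique) (simp_all flip: power_mult)
    also have "ennreal (real N ^ 4) * ennreal (1 / real N ^ 4) = 1" using N by (simp add: ennreal_mult'[symmetric])
    finally show "(\<integral>\<^sup>+\<omega>. f N \<omega> \<partial>M) \<le> ennreal (1 * real N ^ 0)" by simp
  qed
  moreover have "AE \<omega> in M. \<forall>L. 1 \<le> L \<longrightarrow> H L \<omega> = ennreal (block_osc L (\<lambda>t. X t \<omega>))"
    using H(2) by (intro AE_all_countable[THEN iffD2] allI) auto
  ultimately show ?thesis
  proof eventually_elim
    fix \<omega>
    assume "\<exists>K\<ge>1. \<forall>N\<ge>1. f N \<omega> \<le> ennreal (K * real N ^ (0 + 2))"
    then obtain K where K: "1 \<le> K" "\<And>N. 1 \<le> N \<Longrightarrow> f N \<omega> \<le> ennreal (K * real N ^ 2)" unfolding add_0 by blast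
    assume eq: "\<forall>L. 1 \<le> L \<longrightarrow> H L \<omega> = ennreal (block_osc L (\<lambda>t. X t \<omega>))"
    have "block_osc (N ^ 8) (\<lambda>t. X t \<omega>) \<le> K / real N ^ 2" if N: "1 \<le> N" for N
    proof -
      have N8: "1 \<le> N ^ 8" using N by (rule one_le_power)
      have "ennreal (real N ^ 4 * block_osc (N ^ 8) (\<lambda>t. X t \<omega>)) = f N \<omega>"
        using N eq N8 by (simp add: f_def ennreal_mult')
      also have "\<dots> \<le> ennreal (K * real N ^ 2)" by (rule K(2)[OF N])
      finally have "real N ^ 4 * block_osc (N ^ 8) (\<lambda>t. X t \<omega>) \<le> K * real N ^ 2"
        using K(1) by (simp add: ennreal_le_iff)
      then have "real N ^ 2 * (real N ^ 2 * block_osc (N ^ 8) (\<lambda>t. X t \<omega>)) \<le> real N ^ 2 * K"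
        by (simp add: power2_eq_square power4_eq_xxxx mult_ac)
      then have "real N ^ 2 * block_osc (N ^ 8) (\<lambda>t. X t \<omega>) \<le> K"
        by (subst (asm) mult_le_cancel_left_pos) (use N in auto)
      then show ?thesis using N by (simp add: pos_le_divide_eq mult.commute)
    qed
    then show "\<exists>K\<ge>1. \<forall>N\<ge>1. block_osc (N ^ 8) (\<lambda>t. X t \<omega>) \<le> K / real N ^ 2" using K(1) by blast
  qed
qed


text \<open>Frequencies up to \<open>N ^ 9\<close> are handled on a grid; beyond that the path is replaced by a
  step function with \<open>N ^ 8\<close> steps.\<close>

lemma AE_brownian_osc_decay:
  assumes X: "brownian_motion M X" and eps: "0 < \<epsilon>"
  shows "AE \<omega> in M. \<exists>C\<ge>0. \<forall>\<xi> \<eta>. 1 \<le> \<bar>\<eta>\<bar> \<longrightarrow> norm (osc (\<lambda>t. X t \<omega>) \<xi> \<eta>) \<le> C * \<bar>\<eta>\<bar> powr (- (1 - \<epsilon>))"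
  using AE_brownian_grid_bound[OF X] AE_brownian_block_osc_bound[OF X] brownian_motionD(3)[OF X]
proof eventually_elim
  fix \<omega>
  let ?x = "\<lambda>t. X t \<omega>"
  assume c: "continuous_on {0..1} ?x"
  assume "\<exists>K\<ge>1. \<forall>N\<ge>1. \<forall>a b. \<bar>a\<bar> \<le> int N ^ 10 \<longrightarrow> b \<in> {N\<^sup>2..N\<^sup>2 + N} \<longrightarrow>
    exp (real b / real N / 4 * norm (osc ?x (of_int a / real N) (real b / real N))) \<le> K * real N ^ 13"
  then obtain K where K: "1 \<le> K" and grid: "\<And>N a b. 1 \<le> N \<Longrightarrow> \<bar>a\<bar> \<le> int N ^ 10 \<Longrightarrow> b \<in> {N\<^sup>2..N\<^sup>2 + N} \<Longrightarrow>
    exp (real b / real N / 4 * norm (osc ?x (of_int a / real N) (real b / real N))) \<le> K * real N ^ 13" by blast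
  assume "\<exists>K\<ge>1. \<forall>N\<ge>1. block_osc (N ^ 8) ?x \<le> K / real N ^ 2"
  then obtain K2 where K2: "1 \<le> K2" and blk: "\<And>N. 1 \<le> N \<Longrightarrow> block_osc (N ^ 8) ?x \<le> K2 / real N ^ 2" by blast
  have "bounded (?x ` {0..1})" by (intro compact_imp_bounded compact_continuous_image c) simp
  then obtain S where "\<forall>y\<in>?x ` {0..1}. norm y \<le> S" unfolding bounded_iff by blast
  then have S: "\<bar>?x t\<bar> \<le> S" if "t \<in> {0..1}" for t using that by auto
  have S0: "0 \<le> S" using S[of 0] by auto
  \<comment> \<open>Here \<open>4 * ln K\<close> comes from the moment bound on the grid,
    \<open>2 * pi * (1 + S)\<close> from rounding the frequencies to the grid, and
    \<open>4 * pi * K2 + 1\<close> from the step function used at large |\<xi>|.\<close>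
  define C1 where "C1 = 4 * ln K + 2 * pi * (1 + S) + 4 * pi * K2 + 1"
  have C10: "0 \<le> C1" using K K2 S0 by (simp add: C1_def)
  have key: "norm (osc ?x \<xi> \<eta>) \<le> (C1 + 52 * ln (real N)) / real N"
    if eta: "1 \<le> \<eta>" and N: "N = nat \<lfloor>\<eta>\<rfloor>" for \<xi> \<eta> N
  proof -
    have N1: "1 \<le> N" using eta N by (simp add: le_nat_floor)
    have Ne: "real N \<le> \<eta>" "\<eta> \<le> real N + 1" using eta N by auto
    have N0: "0 < real N" using N1 by simp
    have lnN: "0 \<le> ln (real N)" using N1 by simp
    show ?thesis
    proof (cases "\<bar>\<xi>\<bar> \<le> real N ^ 9")
      case True
      define a where "a = \<lfloor>\<xi> * real N\<rfloor>"
      define b where "b = nat \<lfloor>\<eta> * real N\<rfloor>"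
      have xN: "\<bar>\<xi> * real N\<bar> \<le> real N ^ 10"
      proof -
        have "\<bar>\<xi> * real N\<bar> = \<bar>\<xi>\<bar> * real N" by (simp add: abs_mult)
        also have "\<dots> \<le> real N ^ 9 * real N" by (intro mult_right_mono True) simp
        also have "\<dots> = real N ^ 10" by (simp add: eval_nat_numeral)
        finally show ?thesis .
      qed
      have a: "\<bar>a\<bar> \<le> int N ^ 10"
      proof -
        have "- (int N ^ 10) \<le> a" unfolding a_def using xN by (subst le_floor_iff) (auto simp: abs_le_iff)
        moreover have "a \<le> int N ^ 10" unfolding a_def using xN by (subst floor_le_iff) (auto simp: abs_le_iff)
        ultimately show ?thesis by auto
      qed
      have eN: "(real N)\<^sup>2 \<le> \<eta> * real N" "\<eta> * real N \<le> (real N)\<^sup>2 + real N"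
        using Ne N0 by (auto simp: power2_eq_square mult_right_mono intro: order_trans[OF mult_right_mono[OF Ne(2), of "real N"]] simp: algebra_simps)
      have b0: "real b \<le> \<eta> * real N" "\<eta> * real N < real b + 1"
        using eN unfolding b_def by (auto intro: of_nat_floor order_trans[OF zero_le_power2]) linarith+
      have b: "b \<in> {N\<^sup>2..N\<^sup>2 + N}"
      proof -
        have "real (N\<^sup>2) < real (b + 1)" using eN b0 by simp
        moreover have "real b \<le> real (N\<^sup>2 + N)" using eN b0 by simp
        ultimately show ?thesis unfolding of_nat_less_iff of_nat_le_iff by simp
      qed
      define \<xi>' \<eta>' where "\<xi>' = of_int a / real N" and "\<eta>' = real b / real N"
      have e1: "real N \<le> \<eta>'"
      proof -
        have "real N * real N \<le> real b" using b by (auto simp: power2_eq_square) (metis of_nat_le_iff of_nat_mult)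
        then show ?thesis using N0 by (simp add: \<eta>'_def field_simps)
      qed
      have dx: "\<bar>\<xi> - \<xi>'\<bar> \<le> 1 / real N"
      proof -
        have "\<bar>\<xi> * real N - of_int a\<bar> \<le> 1" unfolding a_def by linarith
        moreover have "\<xi> - \<xi>' = (\<xi> * real N - of_int a) / real N" using N0 by (simp add: \<xi>'_def field_simps)
        ultimately show ?thesis using N0 by (simp add: abs_divide divide_right_mono)
      qed
      have dy: "\<bar>\<eta> - \<eta>'\<bar> \<le> 1 / real N"
      proof -
        have "\<bar>\<eta> * real N - real b\<bar> \<le> 1" using b0 by linarith
        moreover have "\<eta> - \<eta>' = (\<eta> * real N - real b) / real N" using N0 by (simp add: \<eta>'_def field_simps)
        ultimately show ?thesis using N0 by (simp add: abs_divide divide_right_mono)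
      qed
      have "exp (\<eta>' / 4 * norm (osc ?x \<xi>' \<eta>')) \<le> K * real N ^ 13"
        unfolding \<xi>'_def \<eta>'_def by (rule grid[OF N1 a b])
      \<comment> \<open>The logarithm turns the power 13 into \<open>13 * ln N\<close>; dividing by
        \<open>\<eta>' / 4\<close>, with \<eta>' \<ge> N, yields the coefficient 52.\<close>
      then have "\<eta>' / 4 * norm (osc ?x \<xi>' \<eta>') \<le> ln (K * real N ^ 13)"
        using K N0 by (subst ln_ge_iff) auto
      also have "ln (K * real N ^ 13) = ln K + 13 * ln (real N)"
        using K N0 by (simp add: ln_mult ln_realpow)
      finally have "\<eta>' / 4 * norm (osc ?x \<xi>' \<eta>') \<le> ln K + 13 * ln (real N)" .
      moreover have "real N / 4 * norm (osc ?x \<xi>' \<eta>') \<le> \<eta>' / 4 * norm (osc ?x \<xi>' \<eta>')"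
        using e1 by (intro mult_right_mono) auto
      ultimately have "norm (osc ?x \<xi>' \<eta>') \<le> (4 * ln K + 52 * ln (real N)) / real N"
        using N0 by (simp add: field_simps)
      moreover have "norm (osc ?x \<xi> \<eta>) \<le> norm (osc ?x \<xi>' \<eta>') + 2 * pi * (\<bar>\<xi> - \<xi>'\<bar> + S * \<bar>\<eta> - \<eta>'\<bar>)"
        by (rule osc_Lipschitz[OF c S])
      moreover have "2 * pi * (\<bar>\<xi> - \<xi>'\<bar> + S * \<bar>\<eta> - \<eta>'\<bar>) \<le> 2 * pi * (1 / real N + S * (1 / real N))"
        by (intro mult_left_mono add_mono dx dy S0) auto
      ultimately have "norm (osc ?x \<xi> \<eta>) \<le> (4 * ln K + 52 * ln (real N)) / real N + 2 * pi * (1 / real N + S * (1 / real N))"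
        by linarith
      also have "\<dots> = (4 * ln K + 2 * pi * (1 + S) + 52 * ln (real N)) / real N"
        by (simp add: add_divide_distrib algebra_simps)
      also have "\<dots> \<le> (C1 + 52 * ln (real N)) / real N"
        using N0 K2 by (intro divide_right_mono) (auto simp: C1_def)
      finally show ?thesis .
    next
      case False
      then have xi: "\<xi> \<noteq> 0" using N0 by auto
      have N8: "1 \<le> N ^ 8" using N1 by (rule one_le_power)
      \<comment> \<open>The second term is at most \<open>1 / N\<close> because |\<xi>| > N^9. The
        first is O(1 / N) because the block oscillation is O(1 / N^2) and \<eta> \<le> 2 N.\<close>
      have "norm (osc ?x \<xi> \<eta>) \<le> 2 * pi * \<bar>\<eta>\<bar> * block_osc (N ^ 8) ?x + real (N ^ 8) / \<bar>\<xi>\<bar>"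
        by (rule norm_osc_le_block_osc[OF c N8 xi])
      also have "2 * pi * \<bar>\<eta>\<bar> * block_osc (N ^ 8) ?x \<le> 2 * pi * \<bar>\<eta>\<bar> * (K2 / real N ^ 2)"
        by (intro mult_left_mono blk N1) auto
      also have "2 * pi * \<bar>\<eta>\<bar> * (K2 / real N ^ 2) \<le> 2 * pi * (2 * real N) * (K2 / real N ^ 2)"
        using Ne eta N1 K2 by (intro mult_right_mono mult_left_mono) auto
      also have "2 * pi * (2 * real N) * (K2 / real N ^ 2) = 4 * pi * K2 / real N"
        using N0 by (simp add: power2_eq_square field_simps)
      also have "real (N ^ 8) / \<bar>\<xi>\<bar> \<le> real (N ^ 8) / real N ^ 9"
        using False N0 xi by (intro divide_left_mono) auto
      also have "real (N ^ 8) / real N ^ 9 = 1 / real N" using N0 by (simp add: eval_nat_numeral)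
      finally have "norm (osc ?x \<xi> \<eta>) \<le> (4 * pi * K2 + 1) / real N" by (simp add: add_divide_distrib)
      also have "\<dots> \<le> (C1 + 52 * ln (real N)) / real N"
        using N0 K S0 lnN by (intro divide_right_mono) (auto simp: C1_def)
      finally show ?thesis .
    qed
  qed
  \<comment> \<open>The 2 pays for N \<ge> \<eta> / 2, and \<open>52 / \<epsilon>\<close> for
    replacing the logarithm by \<open>\<eta> powr \<epsilon> / \<epsilon>\<close>.\<close>
  define C where "C = 2 * (C1 + 52 / \<epsilon>)"
  have C0: "0 \<le> C" using C10 eps by (simp add: C_def)
  have pos: "norm (osc ?x \<xi> \<eta>) \<le> C * \<eta> powr (- (1 - \<epsilon>))" if eta: "1 \<le> \<eta>" for \<xi> \<eta>
  proof -
    define N where "N = nat \<lfloor>\<eta>\<rfloor>"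
    have N1: "1 \<le> N" using eta N_def by (simp add: le_nat_floor)
    have Ne: "real N \<le> \<eta>" "\<eta> \<le> 2 * real N" using eta N1 N_def by linarith+
    have N0: "0 < real N" using N1 by simp
    have ge1: "1 \<le> \<eta> powr \<epsilon>" using eta eps by (simp add: ge_one_powr_ge_zero)
    have "ln (real N) \<le> ln \<eta>" using Ne N0 by simp
    also have "\<dots> \<le> \<eta> powr \<epsilon> / \<epsilon>" by (rule ln_powr_bound[OF eta eps])
    finally have l: "ln (real N) \<le> \<eta> powr \<epsilon> / \<epsilon>" .
    have "C1 * 1 \<le> C1 * \<eta> powr \<epsilon>" using C10 ge1 by (intro mult_left_mono) auto
    then have num: "C1 + 52 * ln (real N) \<le> (C1 + 52 / \<epsilon>) * \<eta> powr \<epsilon>"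
    proof -
      have "(C1 + 52 / \<epsilon>) * \<eta> powr \<epsilon> = C1 * \<eta> powr \<epsilon> + 52 * (\<eta> powr \<epsilon> / \<epsilon>)"
        by (simp add: algebra_simps)
      then show ?thesis using l \<open>C1 * 1 \<le> C1 * \<eta> powr \<epsilon>\<close> by linarith
    qed
    have "norm (osc ?x \<xi> \<eta>) \<le> (C1 + 52 * ln (real N)) / real N" by (rule key[OF eta N_def])
    also have "\<dots> \<le> ((C1 + 52 / \<epsilon>) * \<eta> powr \<epsilon>) / (\<eta> / 2)"
    proof (rule frac_le[OF _ num])
      show "0 \<le> (C1 + 52 / \<epsilon>) * \<eta> powr \<epsilon>" using C10 eps by simp
    qed (use Ne eta in auto)
    also have "\<dots> = C * (\<eta> powr \<epsilon> / \<eta> powr 1)" using eta by (simp add: C_def)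
    also have "\<eta> powr \<epsilon> / \<eta> powr 1 = \<eta> powr (- (1 - \<epsilon>))" by (subst powr_diff[symmetric]) simp
    finally show ?thesis .
  qed
  show "\<exists>C\<ge>0. \<forall>\<xi> \<eta>. 1 \<le> \<bar>\<eta>\<bar> \<longrightarrow> norm (osc ?x \<xi> \<eta>) \<le> C * \<bar>\<eta>\<bar> powr (- (1 - \<epsilon>))"
  proof (intro exI[of _ C] conjI allI impI C0)
    fix \<xi> \<eta> :: real assume "1 \<le> \<bar>\<eta>\<bar>"
    then show "norm (osc ?x \<xi> \<eta>) \<le> C * \<bar>\<eta>\<bar> powr (- (1 - \<epsilon>))"
      using pos[of \<eta> \<xi>] pos[of "- \<eta>" "- \<xi>"] norm_osc_minus[of ?x \<xi> \<eta>] by (cases "0 \<le> \<eta>") auto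
  qed
qed

section \<open>Fourier transforms and the energy estimate\<close>

definition echar :: "real \<Rightarrow> complex" where
  "echar y = cis (- (2 * pi * y))"

lemma norm_echar [simp]: "norm (echar y) = 1"
  by (simp add: echar_def)

lemma borel_measurable_echar [measurable]: "echar \<in> borel_measurable borel"
  unfolding echar_def cis_conv_exp by measurable

lemma echar_add: "echar (a + b) = echar a * echar b"
  by (simp add: echar_def cis_mult algebra_simps)

lemma cnj_echar: "cnj (echar a) = echar (- a)"
  by (simp add: echar_def cis_cnj)

lemma echar_diff: "echar (a - b) = echar a * cnj (echar b)"
  using echar_add[of a "- b"] by (simp add: cnj_echar)

lemma fourier_eq_echar: "fourier M f \<xi> = (LINT x|M. echar (\<xi> \<bullet> x) * f x)"
  unfolding fourier_def echar_def cis_conv_exp by (simp add: mult_ac)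

lemma borel_measurable_fourier:
  fixes \<mu> :: "'a::euclidean_space measure"
  assumes "sigma_finite_measure \<mu>" and [measurable_cong]: "sets \<mu> = sets borel" and [measurable]: "f \<in> borel_measurable \<mu>"
  shows "fourier \<mu> f \<in> borel_measurable borel"
proof -
  interpret sigma_finite_measure \<mu> by fact
  have "(\<lambda>\<xi>. LINT x|\<mu>. echar (\<xi> \<bullet> x) * f x) \<in> borel_measurable borel"
    by (rule borel_measurable_lebesgue_integral) measurable
  then show ?thesis by (simp add: fourier_eq_echar[abs_def])
qed

lemma norm_integral_le_nn_integral:
  fixes f :: "'a \<Rightarrow> 'b::{banach, second_countable_topology}"
  shows "ennreal (norm (integral\<^sup>L M f)) \<le> (\<integral>\<^sup>+x. ennreal (norm (f x)) \<partial>M)"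
  by (cases "integrable M f") (auto simp: integral_norm_bound_ennreal not_integrable_integral_eq)

lemma norm_fourier_le:
  assumes "integrable M f"
  shows "norm (fourier M f \<xi>) \<le> (LINT x|M. norm (f x))"
  unfolding fourier_eq_echar
  by (rule order_trans[OF integral_norm_bound]) (simp add: norm_mult)

section \<open>Product integrals and the energy as a quadratic form\<close>

lemma lborel_integral_tensor:
  fixes f :: "'a::euclidean_space \<Rightarrow> real \<Rightarrow> 'c::{real_normed_field,banach,second_countable_topology}"
  assumes f: "\<And>b. b \<in> Basis \<Longrightarrow> integrable lborel (f b)"
  shows "(LINT x|lborel. (\<Prod>b\<in>Basis. f b (x \<bullet> b))) = (\<Prod>b\<in>Basis. LINT t|lborel. f b t)"
    and "integrable lborel (\<lambda>x. \<Prod>b\<in>Basis. f b (x \<bullet> b))"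
proof -
  interpret product_sigma_finite "\<lambda>_::'a. lborel :: real measure" ..
  have m: "(\<lambda>g. \<Sum>b\<in>Basis. g b *\<^sub>R b) \<in> measurable (PiM Basis (\<lambda>_::'a. lborel :: real measure)) borel"
    by measurable
  have fm: "(\<lambda>x. \<Prod>b\<in>Basis. f b (x \<bullet> b)) \<in> borel_measurable borel"
  proof (intro borel_measurable_prod)
    fix b :: 'a assume "b \<in> Basis"
    then have [measurable]: "f b \<in> borel_measurable borel" using f by force
    show "(\<lambda>x. f b (x \<bullet> b)) \<in> borel_measurable borel" by measurable
  qed
  have e: "(\<Prod>b\<in>Basis. f b ((\<Sum>b\<in>Basis. g b *\<^sub>R b) \<bullet> b)) = (\<Prod>b\<in>Basis. f b (g b))" for g
    by (intro prod.cong refl) (simp add: inner_sum_left inner_Basis if_distrib sum.delta cong: if_cong)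
  show "(LINT x|lborel. (\<Prod>b\<in>Basis. f b (x \<bullet> b))) = (\<Prod>b\<in>Basis. LINT t|lborel. f b t)"
    by (subst lborel_eq, subst integral_distr[OF m fm], subst e)
      (rule product_integral_prod[OF finite_Basis f])
  show "integrable lborel (\<lambda>x. \<Prod>b\<in>Basis. f b (x \<bullet> b))"
    by (subst lborel_eq, subst integrable_distr_eq[OF m fm], subst e)
      (rule product_integrable_prod[OF finite_Basis f])
qed

lemma prod_Basis_vec: "(\<Prod>b\<in>(Basis :: (real ^ 'k) set). g b) = (\<Prod>i\<in>UNIV. g (axis i 1))"
proof -
  have "(Basis :: (real ^ 'k) set) = range (\<lambda>i. axis i 1)" by (auto simp: Basis_vec_def)
  then have "bij_betw (\<lambda>i::'k. axis i (1::real)) UNIV Basis"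
    by (auto simp: bij_betw_def inj_def axis_eq_axis)
  from prod.reindex_bij_betw[OF this, of g] show ?thesis by simp
qed

lemma lborel_integral_tensor_vec:
  fixes f :: "'k::finite \<Rightarrow> real \<Rightarrow> 'c::{real_normed_field,banach,second_countable_topology}"
  assumes f: "\<And>i. integrable lborel (f i)"
  shows "(LINT x|lborel. (\<Prod>i\<in>UNIV. f i ((x :: real ^ 'k) $ i))) = (\<Prod>i\<in>UNIV. LINT t|lborel. f i t)"
    and "integrable lborel (\<lambda>x :: real ^ 'k. \<Prod>i\<in>UNIV. f i (x $ i))"
proof -
  \<comment> \<open>The Euclidean version indexes coordinates by basis vectors; \<open>F\<close>
    recovers the index \<open>i\<close> from \<open>axis i 1\<close>.\<close>
  define F where "F b = f (THE i. b = axis i (1::real))" for b :: "real ^ 'k"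
  have F: "F (axis i 1) = f i" for i
    unfolding F_def by (rule arg_cong[where f=f]) (auto simp: axis_eq_axis)
  have iF: "integrable lborel (F b)" for b unfolding F_def by (rule f)
  note T = lborel_integral_tensor[of F, OF iF]
  show "(LINT x|lborel. (\<Prod>i\<in>UNIV. f i ((x :: real ^ 'k) $ i))) = (\<Prod>i\<in>UNIV. LINT t|lborel. f i t)"
    using T(1) by (simp add: prod_Basis_vec F inner_axis)
  show "integrable lborel (\<lambda>x :: real ^ 'k. \<Prod>i\<in>UNIV. f i (x $ i))"
    using T(2) by (simp add: prod_Basis_vec F inner_axis)
qed

lemma integral_pair_mult:
  fixes f :: "'a::euclidean_space \<Rightarrow> complex" and g :: "'b::euclidean_space \<Rightarrow> complex"
  assumes f: "integrable lborel f" and g: "integrable lborel g"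
  shows "integrable lborel (\<lambda>p. f (fst p) * g (snd p))"
    and "(LINT p|lborel. f (fst p) * g (snd p)) = (LINT x|lborel. f x) * (LINT y|lborel. g y)"
proof -
  have [measurable]: "f \<in> borel_measurable borel" "g \<in> borel_measurable borel" using f g by auto
  show i: "integrable lborel (\<lambda>p. f (fst p) * g (snd p))"
    unfolding lborel_prod[symmetric]
  proof (rule lborel_pair.Fubini_integrable)
    show "(\<lambda>p. f (fst p) * g (snd p)) \<in> borel_measurable (lborel \<Otimes>\<^sub>M lborel)" by measurable
    show "integrable lborel (\<lambda>x. LINT y|lborel. norm (f (fst (x, y)) * g (snd (x, y))))"
      using f g by (simp add: norm_mult)
    show "AE x in lborel. integrable lborel (\<lambda>y. f (fst (x, y)) * g (snd (x, y)))"
      using g by simp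
  qed
  have "(LINT p|lborel. f (fst p) * g (snd p)) = (LINT x|lborel. LINT y|lborel. f x * g y)"
    using lborel_pair.integral_fst'[of "\<lambda>p. f (fst p) * g (snd p)"] i by (simp add: lborel_prod)
  then show "(LINT p|lborel. f (fst p) * g (snd p)) = (LINT x|lborel. f x) * (LINT y|lborel. g y)"
    by simp
qed

text \<open>Together with \<open>norm_fourier_sq\<close> this is the identity behind the Tomas-Stein
  argument: integrating a squared transform against \<mu> gives a quadratic form whose kernel is the
  transform of \<mu> at differences. The function \<open>k\<close> is left general because the
  kernel will be cut into two pieces before it is integrated.\<close>

lemma Fubini_fourier_kernel:
  fixes \<mu> :: "'a::euclidean_space measure" and k :: "'a \<times> 'a \<Rightarrow> complex"
  assumes "finite_measure \<mu>" and [measurable_cong]: "sets \<mu> = sets borel" and k: "integrable lborel k"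
  shows "(LINT \<tau>|\<mu>. LINT p|lborel. k p * echar ((fst p - snd p) \<bullet> \<tau>))
     = (LINT p|lborel. k p * fourier \<mu> (\<lambda>_. 1) (fst p - snd p))"
    and "integrable \<mu> (\<lambda>\<tau>. LINT p|lborel. k p * echar ((fst p - snd p) \<bullet> \<tau>))"
proof -
  interpret \<mu>: finite_measure \<mu> by fact
  interpret P: pair_sigma_finite \<mu> "lborel :: ('a \<times> 'a) measure" ..
  have [measurable]: "k \<in> borel_measurable borel" using k by auto
  define D where "D p = fst p - snd p" for p :: "'a \<times> 'a"
  have [measurable]: "D \<in> borel_measurable borel"
    unfolding D_def by (intro borel_measurable_continuous_onI continuous_intros)
  have i: "integrable (\<mu> \<Otimes>\<^sub>M lborel) (\<lambda>(\<tau>, p). k p * echar ((fst p - snd p) \<bullet> \<tau>))"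
  proof (rule P.Fubini_integrable)
    show "(\<lambda>(\<tau>, p). k p * echar ((fst p - snd p) \<bullet> \<tau>)) \<in> borel_measurable (\<mu> \<Otimes>\<^sub>M lborel)"
      unfolding D_def[symmetric] by measurable
    show "integrable \<mu> (\<lambda>x. LINT y|lborel. norm (case (x, y) of (\<tau>, p) \<Rightarrow> k p * echar ((fst p - snd p) \<bullet> \<tau>)))"
      by (simp add: norm_mult)
    show "AE x in \<mu>. integrable lborel (\<lambda>y. case (x, y) of (\<tau>, p) \<Rightarrow> k p * echar ((fst p - snd p) \<bullet> \<tau>))"
    proof (rule AE_I2)
      fix x show "integrable lborel (\<lambda>y. case (x, y) of (\<tau>, p) \<Rightarrow> k p * echar ((fst p - snd p) \<bullet> \<tau>))"
        unfolding D_def[symmetric]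
        by (rule Bochner_Integration.integrable_bound[OF k]) (auto simp: norm_mult)
    qed
  qed
  show "integrable \<mu> (\<lambda>\<tau>. LINT p|lborel. k p * echar ((fst p - snd p) \<bullet> \<tau>))"
    using P.integrable_fst'[OF i] by simp
  show "(LINT \<tau>|\<mu>. LINT p|lborel. k p * echar ((fst p - snd p) \<bullet> \<tau>))
     = (LINT p|lborel. k p * fourier \<mu> (\<lambda>_. 1) (fst p - snd p))"
    using P.Fubini_integral[OF i] by (simp add: fourier_eq_echar)
qed

lemma norm_fourier_sq:
  fixes h :: "'a::euclidean_space \<Rightarrow> complex"
  assumes h: "integrable lborel h"
  shows "of_real ((norm (fourier lborel h \<tau>))\<^sup>2)
     = (LINT p|lborel. (h (fst p) * cnj (h (snd p))) * echar ((fst p - snd p) \<bullet> \<tau>))"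
proof -
  have [measurable]: "h \<in> borel_measurable borel" using h by auto
  define H where "H x = echar (\<tau> \<bullet> x) * h x" for x
  have iH: "integrable lborel H" unfolding H_def
    by (rule Bochner_Integration.integrable_bound[OF h]) (auto simp: norm_mult)
  have icH: "integrable lborel (\<lambda>x. cnj (H x))" using iH by simp
  have "of_real ((norm (fourier lborel h \<tau>))\<^sup>2) = (LINT x|lborel. H x) * cnj (LINT x|lborel. H x)"
    by (simp only: complex_norm_square fourier_eq_echar H_def)
  also have "\<dots> = (LINT x|lborel. H x) * (LINT x|lborel. cnj (H x))" by simp
  also have "\<dots> = (LINT p|lborel. H (fst p) * cnj (H (snd p)))"
    by (rule integral_pair_mult(2)[OF iH icH, symmetric])
  also have "\<dots> = (LINT p|lborel. (h (fst p) * cnj (h (snd p))) * echar ((fst p - snd p) \<bullet> \<tau>))"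
    by (intro Bochner_Integration.integral_cong refl)
      (simp add: H_def inner_diff_left echar_diff inner_commute[of \<tau>] mult_ac)
  finally show ?thesis .
qed

text \<open>Dominate the indicator of the unit cube by a multiple of the Gaussian density, whose
  Fourier transform is integrable, and apply Schur's test.\<close>

lemma integral_fourier_sq_le_unit_cube:
  obtains C :: real where "0 \<le> C"
    "\<And>H :: real ^ 'k::finite \<Rightarrow> complex. integrable lborel H \<Longrightarrow> integrable lborel (\<lambda>x. (norm (H x))\<^sup>2) \<Longrightarrow>
       (\<integral>\<^sup>+t\<in>cbox 0 1. ennreal ((norm (fourier lborel H t))\<^sup>2) \<partial>lborel) \<le> ennreal C * (\<integral>\<^sup>+x. ennreal ((norm (H x))\<^sup>2) \<partial>lborel)"
proof -
  define \<Phi> where "\<Phi> t = (\<Prod>i\<in>UNIV. std_normal_density (t $ i))" for t :: "real ^ 'k"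
  define G where "G z = (\<Prod>i\<in>UNIV. exp (- (2 * pi * (z $ i))\<^sup>2 / 2))" for z :: "real ^ 'k"
  have \<Phi>0: "0 \<le> \<Phi> t" for t unfolding \<Phi>_def by (intro prod_nonneg) auto
  have i\<Phi>: "integrable lborel \<Phi>" unfolding \<Phi>_def by (rule lborel_integral_tensor_vec(2)) simp
  have [measurable]: "\<Phi> \<in> borel_measurable borel" using i\<Phi> by auto
  have G0: "0 \<le> G z" for z unfolding G_def by (intro prod_nonneg) auto
  have Gm: "G (- z) = G z" for z by (simp add: G_def)
  have ig: "integrable lborel (\<lambda>t::real. exp (- (2 * pi * t)\<^sup>2 / 2))"
  proof -
    have s: "0 < (1 / (2 * pi))" by simp
    \<comment> \<open>This Gaussian is a multiple of the normal density with standard deviation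
      \<open>1 / (2 * pi)\<close>; the first summand is zero.\<close>
    have "integrable lborel (\<lambda>t. (1 / sqrt (2 * pi * (1 / (2 * pi))\<^sup>2))\<^sup>2 * 0 + sqrt (2 * pi * (1 / (2 * pi))\<^sup>2) * normal_density 0 (1 / (2 * pi)) t)"
      using integrable_normal_density[OF s] by auto
    also have "(\<lambda>t. (1 / sqrt (2 * pi * (1 / (2 * pi))\<^sup>2))\<^sup>2 * 0 + sqrt (2 * pi * (1 / (2 * pi))\<^sup>2) * normal_density 0 (1 / (2 * pi)) t) = (\<lambda>t::real. exp (- (2 * pi * t)\<^sup>2 / 2))"
      by (auto simp: fun_eq_iff normal_density_def power_mult_distrib power_divide)
    finally show ?thesis .
  qed
  have iG: "integrable lborel G" unfolding G_def by (rule lborel_integral_tensor_vec(2)[OF ig])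
  have [measurable]: "G \<in> borel_measurable borel" using iG by auto
  define IG where "IG = (LINT z|lborel. G z)"
  have IG0: "0 \<le> IG" unfolding IG_def using G0 by (intro integral_nonneg_AE) auto
  define \<mu> where "\<mu> = density lborel (\<lambda>t. ennreal (\<Phi> t))"
  have s\<mu>[measurable_cong]: "sets \<mu> = sets borel" by (simp add: \<mu>_def)
  have f\<mu>: "finite_measure \<mu>"
  proof
    show "emeasure \<mu> (space \<mu>) \<noteq> \<infinity>"
      using i\<Phi> \<Phi>0 by (simp add: \<mu>_def emeasure_density nn_integral_eq_integral)
  qed
  have \<mu>hat: "fourier \<mu> (\<lambda>_. 1) z = of_real (G z)" for z
  proof -
    have "fourier \<mu> (\<lambda>_. 1) z = (LINT t|lborel. \<Phi> t *\<^sub>R echar (z \<bullet> t))"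
      unfolding fourier_eq_echar \<mu>_def using \<Phi>0 by (subst integral_density) auto
    also have "\<dots> = (LINT t|lborel. (\<Prod>i\<in>UNIV. std_normal_density (t $ i) *\<^sub>R iexp ((- (2 * pi * (z $ i))) * t $ i)))"
    proof (intro Bochner_Integration.integral_cong refl)
      fix t :: "real ^ 'k"
      have "echar (z \<bullet> t) = (\<Prod>i\<in>UNIV. iexp ((- (2 * pi * (z $ i))) * t $ i))"
        unfolding echar_def cis_conv_exp inner_vec_def
        by (simp add: exp_sum[symmetric] sum_distrib_left sum_negf mult_ac)
      then show "\<Phi> t *\<^sub>R echar (z \<bullet> t) = (\<Prod>i\<in>UNIV. std_normal_density (t $ i) *\<^sub>R iexp ((- (2 * pi * (z $ i))) * t $ i))"
        by (simp add: \<Phi>_def scaleR_conv_of_real prod.distrib)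
    qed
    also have "\<dots> = (\<Prod>i\<in>UNIV. LINT t|lborel. std_normal_density t *\<^sub>R iexp ((- (2 * pi * (z $ i))) * t))"
    proof (rule lborel_integral_tensor_vec(1))
      fix i
      show "integrable lborel (\<lambda>t. std_normal_density t *\<^sub>R iexp ((- (2 * pi * (z $ i))) * t))"
        by (rule Bochner_Integration.integrable_bound[OF integrable_normal_density[of 1 0]]) auto
    qed
    also have "\<dots> = (\<Prod>i\<in>UNIV. char std_normal_distribution (- (2 * pi * (z $ i))))"
      unfolding char_def by (intro prod.cong refl integral_density[symmetric]) auto
    also have "\<dots> = of_real (G z)"
      by (simp add: char_std_normal_distribution G_def)
    finally show ?thesis .
  qed
  \<comment> \<open>The minimum of \<Phi> over the unit cube, attained at the corner whose
    coordinates are all 1.\<close>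
  define c0 where "c0 = std_normal_density 1 ^ CARD('k)"
  have c0: "0 < c0" unfolding c0_def by (simp add: normal_density_pos)
  have \<Phi>c: "c0 \<le> \<Phi> t" if "t \<in> cbox 0 1" for t
  proof -
    have "(\<Prod>i\<in>(UNIV::'k set). std_normal_density 1) \<le> \<Phi> t"
      unfolding \<Phi>_def
    proof (intro prod_mono conjI)
      fix i :: 'k
      have "0 \<le> t $ i" "t $ i \<le> 1" using that by (auto simp: mem_box_cart)
      then have "(t $ i)\<^sup>2 \<le> 1" by (simp add: abs_square_le_1)
      then show "std_normal_density 1 \<le> std_normal_density (t $ i)"
        by (simp add: std_normal_density_def mult_left_mono divide_right_mono)
    qed auto
    then show ?thesis by (simp add: c0_def)
  qed
  have main: "(\<integral>\<^sup>+t\<in>cbox 0 1. ennreal ((norm (fourier lborel H t))\<^sup>2) \<partial>lborel) \<le> ennreal (IG / c0) * (\<integral>\<^sup>+x. ennreal ((norm (H x))\<^sup>2) \<partial>lborel)"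
    if H: "integrable lborel H" and H2: "integrable lborel (\<lambda>x. (norm (H x))\<^sup>2)" for H :: "real ^ 'k \<Rightarrow> complex"
  proof -
    have [measurable]: "H \<in> borel_measurable borel" using H by auto
    have mF[measurable]: "fourier lborel H \<in> borel_measurable borel"
      by (rule borel_measurable_fourier) (auto simp: sigma_finite_lborel)
    define k where "k p = H (fst p) * cnj (H (snd p))" for p
    have ik: "integrable lborel k" unfolding k_def
      by (rule integral_pair_mult(1)) (use H in auto)
    have [measurable]: "k \<in> borel_measurable borel" using ik by auto
    have en: "of_real ((norm (fourier lborel H \<tau>))\<^sup>2) = (LINT p|lborel. k p * echar ((fst p - snd p) \<bullet> \<tau>))" for \<tau>
      unfolding k_def by (rule norm_fourier_sq[OF H])
    have i1: "integrable \<mu> (\<lambda>\<tau>. complex_of_real ((norm (fourier lborel H \<tau>))\<^sup>2))"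
      unfolding en by (rule Fubini_fourier_kernel(2)[OF f\<mu> s\<mu> ik])
    have i2: "integrable \<mu> (\<lambda>\<tau>. (norm (fourier lborel H \<tau>))\<^sup>2)"
      using integrable_norm[OF i1] by (simp add: norm_power)
    \<comment> \<open>By translation and reflection invariance, every row and every column of the
      Schur kernel \<open>G (x - y)\<close> has integral \<open>IG\<close>.\<close>
    have shift: "(\<integral>\<^sup>+y. ennreal (G (x - y)) \<partial>lborel) = ennreal IG" for x
    proof -
      have "(\<integral>\<^sup>+y. ennreal (G (x - y)) \<partial>lborel) = (\<integral>\<^sup>+y. ennreal (G (- x + y)) \<partial>lborel)"
        using Gm[of "x - _"] by (intro nn_integral_cong) (metis Gm minus_diff_eq uminus_add_conv_diff)
      also have "\<dots> = (\<integral>\<^sup>+y. ennreal (G y) \<partial>(distr lborel borel ((+) (- x))))"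
        by (subst nn_integral_distr) auto
      also have "\<dots> = (\<integral>\<^sup>+y. ennreal (G y) \<partial>lborel)" by (simp only: lborel_distr_plus)
      also have "\<dots> = ennreal IG" unfolding IG_def using iG G0 by (intro nn_integral_eq_integral) auto
      finally show ?thesis .
    qed
    have half: "(\<integral>\<^sup>+p. ennreal ((norm (H (fst p)))\<^sup>2 * G (fst p - snd p)) \<partial>lborel) = ennreal IG * (\<integral>\<^sup>+x. ennreal ((norm (H x))\<^sup>2) \<partial>lborel)"
    proof -
      have "(\<integral>\<^sup>+p. ennreal ((norm (H (fst p)))\<^sup>2 * G (fst p - snd p)) \<partial>lborel)
         = (\<integral>\<^sup>+x. \<integral>\<^sup>+y. ennreal ((norm (H x))\<^sup>2) * ennreal (G (x - y)) \<partial>lborel \<partial>lborel)"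
        unfolding lborel_prod[symmetric] by (subst lborel.nn_integral_fst[symmetric]) (auto simp: ennreal_mult G0)
      also have "\<dots> = (\<integral>\<^sup>+x. ennreal ((norm (H x))\<^sup>2) * ennreal IG \<partial>lborel)"
        by (intro nn_integral_cong) (simp add: nn_integral_cmult shift)
      also have "\<dots> = (\<integral>\<^sup>+x. ennreal ((norm (H x))\<^sup>2) \<partial>lborel) * ennreal IG"
        by (rule nn_integral_multc) measurable
      finally show ?thesis by (simp add: mult.commute)
    qed
    have half': "(\<integral>\<^sup>+p. ennreal ((norm (H (snd p)))\<^sup>2 * G (fst p - snd p)) \<partial>lborel) = ennreal IG * (\<integral>\<^sup>+x. ennreal ((norm (H x))\<^sup>2) \<partial>lborel)"
    proof -
      have "(\<integral>\<^sup>+p. ennreal ((norm (H (snd p)))\<^sup>2 * G (fst p - snd p)) \<partial>lborel)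
         = (\<integral>\<^sup>+y. \<integral>\<^sup>+x. ennreal ((norm (H y))\<^sup>2) * ennreal (G (y - x)) \<partial>lborel \<partial>lborel)"
        unfolding lborel_prod[symmetric]
        by (subst lborel_pair.nn_integral_snd[symmetric]) (auto simp: ennreal_mult G0 intro!: nn_integral_cong, metis Gm minus_diff_eq)
      also have "\<dots> = (\<integral>\<^sup>+y. ennreal ((norm (H y))\<^sup>2) * ennreal IG \<partial>lborel)"
        by (intro nn_integral_cong) (simp add: nn_integral_cmult shift)
      also have "\<dots> = (\<integral>\<^sup>+x. ennreal ((norm (H x))\<^sup>2) \<partial>lborel) * ennreal IG"
        by (rule nn_integral_multc) measurable
      finally show ?thesis by (simp add: mult.commute)
    qed
    let ?N = "\<integral>\<^sup>+x. ennreal ((norm (H x))\<^sup>2) \<partial>lborel"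
    have "(\<integral>\<^sup>+\<tau>. ennreal ((norm (fourier lborel H \<tau>))\<^sup>2) \<partial>\<mu>) = ennreal (LINT \<tau>|\<mu>. (norm (fourier lborel H \<tau>))\<^sup>2)"
      using i2 by (intro nn_integral_eq_integral) auto
    also have "(LINT \<tau>|\<mu>. (norm (fourier lborel H \<tau>))\<^sup>2) = norm (LINT \<tau>|\<mu>. complex_of_real ((norm (fourier lborel H \<tau>))\<^sup>2))"
      by (subst integral_complex_of_real) (auto intro!: abs_of_nonneg[symmetric] integral_nonneg_AE)
    also have "(LINT \<tau>|\<mu>. complex_of_real ((norm (fourier lborel H \<tau>))\<^sup>2)) = (LINT p|lborel. k p * of_real (G (fst p - snd p)))"
      unfolding en Fubini_fourier_kernel(1)[OF f\<mu> s\<mu> ik] \<mu>hat ..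
    also have "ennreal (norm \<dots>) \<le> (\<integral>\<^sup>+p. ennreal (norm (k p * of_real (G (fst p - snd p)))) \<partial>lborel)"
      by (rule norm_integral_le_nn_integral)
    \<comment> \<open>Schur's test by hand: the arithmetic-geometric mean inequality separates the
      two points, so that each half involves only row or only column integrals.\<close>
    also have "\<dots> \<le> (\<integral>\<^sup>+p. ennreal (1/2) * (ennreal ((norm (H (fst p)))\<^sup>2 * G (fst p - snd p)) + ennreal ((norm (H (snd p)))\<^sup>2 * G (fst p - snd p))) \<partial>lborel)"
    proof (intro nn_integral_mono)
      fix p :: "(real ^ 'k) \<times> (real ^ 'k)"
      let ?a = "norm (H (fst p))" and ?b = "norm (H (snd p))" and ?g = "G (fst p - snd p)"
      have "?a * ?b \<le> 1/2 * (?a\<^sup>2 + ?b\<^sup>2)" using sum_squares_bound[of ?a ?b] by simp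
      then have "?a * ?b * ?g \<le> 1/2 * (?a\<^sup>2 + ?b\<^sup>2) * ?g" by (intro mult_right_mono G0)
      then have "norm (k p * of_real ?g) \<le> 1/2 * (?a\<^sup>2 * ?g + ?b\<^sup>2 * ?g)"
        by (simp add: k_def norm_mult G0 algebra_simps)
      then have "ennreal (norm (k p * of_real ?g)) \<le> ennreal (1/2 * (?a\<^sup>2 * ?g + ?b\<^sup>2 * ?g))" by (rule ennreal_leI)
      also have "\<dots> = ennreal (1/2) * (ennreal (?a\<^sup>2 * ?g) + ennreal (?b\<^sup>2 * ?g))"
        by (simp only: ennreal_mult' ennreal_plus[symmetric] G0 mult_nonneg_nonneg zero_le_power2) (simp add: ennreal_mult' G0)
      finally show "ennreal (norm (k p * of_real ?g)) \<le> ennreal (1/2) * (ennreal (?a\<^sup>2 * ?g) + ennreal (?b\<^sup>2 * ?g))" .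
    qed
    also have "\<dots> = ennreal (1/2) * (ennreal IG * ?N + ennreal IG * ?N)"
    proof -
      have m1: "(\<lambda>p. ennreal ((norm (H (fst p)))\<^sup>2 * G (fst p - snd p))) \<in> borel_measurable lborel"
        and m2: "(\<lambda>p. ennreal ((norm (H (snd p)))\<^sup>2 * G (fst p - snd p))) \<in> borel_measurable lborel"
        unfolding lborel_prod[symmetric] by measurable
      show ?thesis
        by (subst nn_integral_cmult[OF borel_measurable_add[OF m1 m2]], subst nn_integral_add[OF m1 m2])
          (simp only: half half')
    qed
    also have "\<dots> = ennreal (1/2 * 2) * (ennreal IG * ?N)"
      by (simp only: mult_2[symmetric] ennreal_mult'[of 2] ennreal_numeral mult.assoc ennreal_mult''[of 2])
    finally have b: "(\<integral>\<^sup>+\<tau>. ennreal ((norm (fourier lborel H \<tau>))\<^sup>2) \<partial>\<mu>) \<le> ennreal IG * ?N" by simp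
    have "(\<integral>\<^sup>+t\<in>cbox 0 1. ennreal ((norm (fourier lborel H t))\<^sup>2) \<partial>lborel)
       \<le> (\<integral>\<^sup>+t. ennreal (1 / c0) * (ennreal (\<Phi> t) * ennreal ((norm (fourier lborel H t))\<^sup>2)) \<partial>lborel)"
    proof (intro nn_integral_mono)
      fix t :: "real ^ 'k"
      have "1 * (norm (fourier lborel H t))\<^sup>2 \<le> (1 / c0 * \<Phi> t) * (norm (fourier lborel H t))\<^sup>2" if "t \<in> cbox 0 1"
        using \<Phi>c[OF that] c0 by (intro mult_right_mono) (auto simp: field_simps)
      then show "ennreal ((norm (fourier lborel H t))\<^sup>2) * indicator (cbox 0 1) t \<le> ennreal (1 / c0) * (ennreal (\<Phi> t) * ennreal ((norm (fourier lborel H t))\<^sup>2))"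
        using \<Phi>0[of t] c0 by (auto simp: ennreal_mult'[symmetric] mult.assoc split: split_indicator intro!: ennreal_leI)
    qed
    also have "\<dots> = ennreal (1 / c0) * (\<integral>\<^sup>+\<tau>. ennreal ((norm (fourier lborel H \<tau>))\<^sup>2) \<partial>\<mu>)"
      unfolding \<mu>_def by (subst nn_integral_density) (auto simp: nn_integral_cmult)
    also have "\<dots> \<le> ennreal (1 / c0) * (ennreal IG * ?N)" by (intro mult_left_mono b) auto
    also have "\<dots> = ennreal (IG / c0) * ?N" using IG0 c0 by (simp add: mult.assoc[symmetric] ennreal_mult'[symmetric])
    finally show ?thesis .
  qed
  show thesis by (rule that[of "IG / c0"]) (use main IG0 c0 in auto)
qed

lemma borel_measurable_cnj [measurable]:
  "f \<in> borel_measurable M \<Longrightarrow> (\<lambda>x. cnj (f x)) \<in> borel_measurable M"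
  by (erule measurable_compose) (intro borel_measurable_continuous_onI continuous_intros)

lemma nn_integral_cmult_add:
  assumes "f \<in> borel_measurable M" "g \<in> borel_measurable M"
  shows "(\<integral>\<^sup>+x. c * (f x + g x) \<partial>M) = c * ((\<integral>\<^sup>+x. f x \<partial>M) + (\<integral>\<^sup>+x. g x \<partial>M))"
  using assms by (subst nn_integral_cmult) (auto simp: nn_integral_add)

lemma lborel_integral_pair_iterated:
  fixes f :: "'a::euclidean_space \<times> 'b::euclidean_space \<Rightarrow> complex"
  assumes "integrable lborel f"
  shows "(LINT p|lborel. f p) = (LINT x|lborel. LINT y|lborel. f (x, y))"
    and "(LINT p|lborel. f p) = (LINT y|lborel. LINT x|lborel. f (x, y))"
    and "integrable lborel (\<lambda>x. LINT y|lborel. f (x, y))"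
  using lborel_pair.integral_fst'[of f] lborel_pair.integral_snd[of "curry f"] lborel_pair.integrable_fst'[of f] assms
  by (simp_all add: lborel_prod curry_def)

lemma integrable_bounded_support:
  fixes h :: "'a::euclidean_space \<Rightarrow> complex"
  assumes "h \<in> borel_measurable borel" "\<And>x. norm (h x) \<le> B" "\<And>x. x \<notin> cball 0 r \<Longrightarrow> h x = 0"
  shows "integrable lborel h"
  by (rule integrableI_bounded_set[of "cball 0 r" _ _ B])
    (use assms emeasure_bounded_finite[OF bounded_cball, of "0 :: 'a" r] in auto)

text \<open>Integrating out the first frequency variables leaves a double integral of
  \<open>A \<eta>\<close> against the conjugate of \<open>A \<eta>'\<close> over |\<eta> - \<eta>'|
  \<le> R, and Schur's test applies with row integrals \<open>2 * R\<close>. The height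
  \<open>s\<close> survives only in unimodular factors, so the bound does not see which graph
  \<open>(t, s)\<close> lies on.\<close>

lemma norm_low_frequency_kernel_le:
  fixes h :: "'v::euclidean_space \<times> real \<Rightarrow> complex"
  assumes hm[measurable]: "h \<in> borel_measurable borel" and h1: "\<And>x. norm (h x) \<le> 1"
    and hr: "\<And>x. x \<notin> cball 0 r \<Longrightarrow> h x = 0" and R: "0 \<le> R"
  shows "ennreal (norm (LINT p|lborel. (h (fst p) * cnj (h (snd p)) * of_real (indicat_real {..R} (\<bar>snd (fst p) - snd (snd p)\<bar>)))
             * echar ((fst p - snd p) \<bullet> (t, s))))
    \<le> ennreal (2 * R) * (\<integral>\<^sup>+\<eta>. ennreal ((norm (fourier lborel (\<lambda>\<xi>. h (\<xi>, \<eta>)) t))\<^sup>2) \<partial>lborel)"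
proof -
  define A where "A \<eta> = fourier lborel (\<lambda>\<xi>. h (\<xi>, \<eta>)) t" for \<eta>
  define \<beta> where "\<beta> \<eta> \<eta>' = indicat_real {..R} (\<bar>\<eta> - \<eta>'\<bar>)" for \<eta> \<eta>' :: real
  have \<beta>01: "0 \<le> \<beta> \<eta> \<eta>'" "\<beta> \<eta> \<eta>' \<le> 1" "\<beta> \<eta> \<eta>' = \<beta> \<eta>' \<eta>" for \<eta> \<eta>'
    by (auto simp: \<beta>_def abs_minus_commute split: split_indicator)
  have \<beta>m[measurable]: "(\<lambda>x. \<beta> (f x) (g x)) \<in> borel_measurable N" if [measurable]: "f \<in> borel_measurable N" "g \<in> borel_measurable N" for f g N
    unfolding \<beta>_def by measurable
  have mp: "fst \<in> borel_measurable (borel :: ('v \<times> real) measure)" "snd \<in> borel_measurable (borel :: ('v \<times> real) measure)"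
    by (intro borel_measurable_continuous_onI continuous_intros)+
  define f where "f x = echar (x \<bullet> (t, s)) * h x" for x
  have fm[measurable]: "f \<in> borel_measurable borel" unfolding f_def by measurable
  have fi: "integrable lborel f"
    by (rule integrable_bounded_support[OF fm, of 1 r]) (auto simp: f_def norm_mult h1 hr)
  have fe: "f (\<xi>, \<eta>) = echar (\<eta> * s) * (echar (t \<bullet> \<xi>) * h (\<xi>, \<eta>))" for \<xi> \<eta>
    by (simp add: f_def echar_add inner_commute mult_ac)
  have fA: "(LINT \<xi>|lborel. f (\<xi>, \<eta>)) = echar (\<eta> * s) * A \<eta>" for \<eta>
    by (simp add: fe A_def fourier_eq_echar)
  have Am[measurable]: "A \<in> borel_measurable borel"
  proof -
    have "(\<lambda>\<eta>. LINT \<xi>|lborel. echar (t \<bullet> \<xi>) * h (\<xi>, \<eta>)) \<in> borel_measurable borel"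
    proof (rule lborel.borel_measurable_lebesgue_integral)
      have "(\<lambda>(\<eta>, \<xi>). echar (t \<bullet> \<xi>) * h (\<xi>, \<eta>)) \<in> borel_measurable (borel :: (real \<times> 'v) measure)"
      proof -
        have [measurable]: "(\<lambda>p. h (snd p, fst p)) \<in> borel_measurable (borel :: (real \<times> 'v) measure)"
          by (rule measurable_compose[OF _ hm]) (intro borel_measurable_continuous_onI continuous_intros)
        have [measurable]: "(\<lambda>p. t \<bullet> snd p) \<in> borel_measurable (borel :: (real \<times> 'v) measure)"
          by (intro borel_measurable_continuous_onI continuous_intros)
        show ?thesis unfolding case_prod_beta by measurable
      qed
      then show "(\<lambda>(\<eta>, \<xi>). echar (t \<bullet> \<xi>) * h (\<xi>, \<eta>)) \<in> borel_measurable (borel \<Otimes>\<^sub>M lborel)"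
        by (simp add: borel_prod[symmetric] cong: measurable_cong_sets)
    qed
    then show ?thesis by (simp add: A_def[abs_def] fourier_eq_echar)
  qed
  define k where "k p = f (fst p) * (cnj (f (snd p)) * of_real (\<beta> (snd (fst p)) (snd (snd p))))" for p
  have ki: "integrable lborel k"
  proof (rule Bochner_Integration.integrable_bound)
    show "integrable lborel (\<lambda>p. f (fst p) * cnj (f (snd p)))"
      by (rule integral_pair_mult(1)) (use fi in auto)
    let ?B = "borel \<Otimes>\<^sub>M borel :: (('v \<times> real) \<times> ('v \<times> real)) measure"
    have s1: "(\<lambda>p. snd (fst p)) \<in> borel_measurable ?B" and s2: "(\<lambda>p. snd (snd p)) \<in> borel_measurable ?B"
      by (rule measurable_compose[OF measurable_fst mp(2)], rule measurable_compose[OF measurable_snd mp(2)])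
    have f1: "(\<lambda>p. f (fst p)) \<in> borel_measurable ?B" and f2: "(\<lambda>p. f (snd p)) \<in> borel_measurable ?B"
      by (rule measurable_compose[OF measurable_fst fm], rule measurable_compose[OF measurable_snd fm])
    have f3: "(\<lambda>p. cnj (f (snd p))) \<in> borel_measurable ?B"
      by (rule borel_measurable_cnj[OF f2])
    have b: "(\<lambda>p. complex_of_real (\<beta> (snd (fst p)) (snd (snd p)))) \<in> borel_measurable ?B"
      by (rule measurable_compose[OF \<beta>m[OF s1 s2]]) simp
    have "k \<in> borel_measurable (borel \<Otimes>\<^sub>M borel)" unfolding k_def
      by (intro borel_measurable_times f1 f3 b)
    then show "k \<in> borel_measurable lborel" by (simp add: borel_prod)
    show "AE p in lborel. norm (k p) \<le> norm (f (fst p) * cnj (f (snd p)))"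
    proof (rule AE_I2)
      fix p
      show "norm (k p) \<le> norm (f (fst p) * cnj (f (snd p)))"
        unfolding k_def norm_mult mult.assoc[symmetric] norm_of_real using \<beta>01 by (intro mult_left_le) auto
    qed
  qed
  \<comment> \<open>The integral over the second point depends on the first only through its last
    coordinate. This lets the remaining spatial integral collapse to \<open>A\<close>.\<close>
  define J where "J \<eta> = (LINT y|lborel. cnj (f y) * of_real (\<beta> \<eta> (snd y)))" for \<eta>
  have J: "J \<eta> = (LINT \<eta>'|lborel. cnj (echar (\<eta>' * s) * A \<eta>') * of_real (\<beta> \<eta> \<eta>'))" for \<eta>
  proof -
    have b: "(\<lambda>y. complex_of_real (\<beta> \<eta> (snd y))) \<in> borel_measurable (borel :: ('v \<times> real) measure)"
      by (rule measurable_compose[OF \<beta>m[OF _ mp(2)]]) simp_all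
    have "integrable lborel (\<lambda>y. cnj (f y) * of_real (\<beta> \<eta> (snd y)))"
    proof (rule Bochner_Integration.integrable_bound[OF fi])
      show "(\<lambda>y. cnj (f y) * of_real (\<beta> \<eta> (snd y))) \<in> borel_measurable lborel"
        by (simp, intro borel_measurable_times borel_measurable_cnj fm b)
      show "AE y in lborel. norm (cnj (f y) * of_real (\<beta> \<eta> (snd y))) \<le> norm (f y)"
        using \<beta>01 by (intro AE_I2) (simp add: norm_mult mult_left_le)
    qed
    from lborel_integral_pair_iterated(2)[OF this]
    have "J \<eta> = (LINT \<eta>'|lborel. (LINT \<xi>|lborel. cnj (f (\<xi>, \<eta>'))) * of_real (\<beta> \<eta> \<eta>'))"
      by (simp add: J_def)
    then show ?thesis by (simp only: integral_cnj[symmetric] fA Bochner_Integration.integral_cnj)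
  qed
  have k1: "(LINT y|lborel. k (x, y)) = f x * J (snd x)" for x
    by (simp add: k_def J_def)
  have L: "(LINT p|lborel. k p) = (LINT \<eta>|lborel. echar (\<eta> * s) * A \<eta> * J \<eta>)"
  proof -
    have "(LINT p|lborel. k p) = (LINT x|lborel. f x * J (snd x))"
      using lborel_integral_pair_iterated(1)[OF ki] by (simp add: k1)
    also have "\<dots> = (LINT \<eta>|lborel. LINT \<xi>|lborel. f (\<xi>, \<eta>) * J (snd (\<xi>, \<eta>)))"
      by (rule lborel_integral_pair_iterated(2)) (use lborel_integral_pair_iterated(3)[OF ki] in \<open>simp add: k1\<close>)
    also have "\<dots> = (LINT \<eta>|lborel. (LINT \<xi>|lborel. f (\<xi>, \<eta>)) * J \<eta>)" by simp
    finally show ?thesis by (simp add: fA)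
  qed
  have eq: "(LINT p|lborel. (h (fst p) * cnj (h (snd p)) * of_real (indicat_real {..R} (\<bar>snd (fst p) - snd (snd p)\<bar>)))
             * echar ((fst p - snd p) \<bullet> (t, s))) = (LINT p|lborel. k p)"
    by (intro Bochner_Integration.integral_cong refl)
      (simp only: k_def f_def \<beta>_def inner_diff_left echar_diff complex_cnj_mult mult_ac)
  let ?a = "\<lambda>\<eta>. ennreal ((norm (A \<eta>))\<^sup>2)"
  have \<beta>int: "(\<integral>\<^sup>+\<eta>'. ennreal (\<beta> \<eta> \<eta>') \<partial>lborel) = ennreal (2 * R)" for \<eta>
  proof -
    have "(\<integral>\<^sup>+\<eta>'. ennreal (\<beta> \<eta> \<eta>') \<partial>lborel) = (\<integral>\<^sup>+\<eta>'. indicator {\<eta> - R..\<eta> + R} \<eta>' \<partial>lborel)"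
      by (intro nn_integral_cong) (auto simp: \<beta>_def abs_le_iff split: split_indicator)
    also have "\<dots> = emeasure lborel {\<eta> - R..\<eta> + R}" by (rule nn_integral_indicator) simp
    also have "\<dots> = ennreal (2 * R)" using R by simp
    finally show ?thesis .
  qed
  have T1: "(\<integral>\<^sup>+\<eta>. \<integral>\<^sup>+\<eta>'. ennreal (\<beta> \<eta> \<eta>') * ?a \<eta> \<partial>lborel \<partial>lborel) = ennreal (2 * R) * (\<integral>\<^sup>+\<eta>. ?a \<eta> \<partial>lborel)"
    by (simp add: nn_integral_multc \<beta>int nn_integral_cmult)
  have T2: "(\<integral>\<^sup>+\<eta>. \<integral>\<^sup>+\<eta>'. ennreal (\<beta> \<eta> \<eta>') * ?a \<eta>' \<partial>lborel \<partial>lborel) = ennreal (2 * R) * (\<integral>\<^sup>+\<eta>. ?a \<eta> \<partial>lborel)"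
  proof -
    have "(\<integral>\<^sup>+\<eta>. \<integral>\<^sup>+\<eta>'. ennreal (\<beta> \<eta> \<eta>') * ?a \<eta>' \<partial>lborel \<partial>lborel) = (\<integral>\<^sup>+\<eta>'. \<integral>\<^sup>+\<eta>. ennreal (\<beta> \<eta> \<eta>') * ?a \<eta>' \<partial>lborel \<partial>lborel)"
      by (rule lborel_pair.Fubini') measurable
    also have "\<dots> = (\<integral>\<^sup>+\<eta>'. \<integral>\<^sup>+\<eta>. ennreal (\<beta> \<eta>' \<eta>) * ?a \<eta>' \<partial>lborel \<partial>lborel)"
      by (simp only: \<beta>01(3))
    finally show ?thesis using T1 by simp
  qed
  have "ennreal (norm (LINT p|lborel. k p)) \<le> (\<integral>\<^sup>+\<eta>. ennreal (norm (A \<eta>)) * ennreal (norm (J \<eta>)) \<partial>lborel)"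
    unfolding L by (rule order_trans[OF norm_integral_le_nn_integral]) (simp add: norm_mult ennreal_mult)
  also have "\<dots> \<le> (\<integral>\<^sup>+\<eta>. ennreal (norm (A \<eta>)) * (\<integral>\<^sup>+\<eta>'. ennreal (norm (A \<eta>') * \<beta> \<eta> \<eta>') \<partial>lborel) \<partial>lborel)"
  proof (intro nn_integral_mono mult_left_mono)
    fix \<eta>
    show "ennreal (norm (J \<eta>)) \<le> (\<integral>\<^sup>+\<eta>'. ennreal (norm (A \<eta>') * \<beta> \<eta> \<eta>') \<partial>lborel)"
      unfolding J by (rule order_trans[OF norm_integral_le_nn_integral]) (simp add: norm_mult \<beta>01)
  qed simp
  also have "\<dots> = (\<integral>\<^sup>+\<eta>. \<integral>\<^sup>+\<eta>'. ennreal (norm (A \<eta>) * norm (A \<eta>') * \<beta> \<eta> \<eta>') \<partial>lborel \<partial>lborel)"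
    by (intro nn_integral_cong, subst nn_integral_cmult[symmetric]) (auto simp: ennreal_mult'[symmetric] mult.assoc)
  also have "\<dots> \<le> (\<integral>\<^sup>+\<eta>. \<integral>\<^sup>+\<eta>'. ennreal (1/2) * (ennreal (\<beta> \<eta> \<eta>') * ?a \<eta> + ennreal (\<beta> \<eta> \<eta>') * ?a \<eta>') \<partial>lborel \<partial>lborel)"
  proof (intro nn_integral_mono)
    fix \<eta> \<eta>'
    have "norm (A \<eta>) * norm (A \<eta>') \<le> 1/2 * ((norm (A \<eta>))\<^sup>2 + (norm (A \<eta>'))\<^sup>2)"
      using sum_squares_bound[of "norm (A \<eta>)" "norm (A \<eta>')"] by simp
    then have "norm (A \<eta>) * norm (A \<eta>') * \<beta> \<eta> \<eta>' \<le> 1/2 * ((norm (A \<eta>))\<^sup>2 + (norm (A \<eta>'))\<^sup>2) * \<beta> \<eta> \<eta>'"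
      by (rule mult_right_mono) (rule \<beta>01)
    also have "\<dots> = 1/2 * (\<beta> \<eta> \<eta>' * (norm (A \<eta>))\<^sup>2 + \<beta> \<eta> \<eta>' * (norm (A \<eta>'))\<^sup>2)" by (simp add: algebra_simps)
    finally have "ennreal (norm (A \<eta>) * norm (A \<eta>') * \<beta> \<eta> \<eta>') \<le> ennreal (1/2 * (\<beta> \<eta> \<eta>' * (norm (A \<eta>))\<^sup>2 + \<beta> \<eta> \<eta>' * (norm (A \<eta>'))\<^sup>2))"
      by (rule ennreal_leI)
    also have "\<dots> = ennreal (1/2) * (ennreal (\<beta> \<eta> \<eta>') * ?a \<eta> + ennreal (\<beta> \<eta> \<eta>') * ?a \<eta>')"
      using \<beta>01 by (simp only: ennreal_mult'[of "1/2"] ennreal_plus mult_nonneg_nonneg zero_le_power2 ennreal_mult zero_le_divide_1_iff zero_le_numeral)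
    finally show "ennreal (norm (A \<eta>) * norm (A \<eta>') * \<beta> \<eta> \<eta>') \<le> ennreal (1/2) * (ennreal (\<beta> \<eta> \<eta>') * ?a \<eta> + ennreal (\<beta> \<eta> \<eta>') * ?a \<eta>')" .
  qed
  also have "\<dots> = ennreal (1/2) * ((\<integral>\<^sup>+\<eta>. \<integral>\<^sup>+\<eta>'. ennreal (\<beta> \<eta> \<eta>') * ?a \<eta> \<partial>lborel \<partial>lborel) + (\<integral>\<^sup>+\<eta>. \<integral>\<^sup>+\<eta>'. ennreal (\<beta> \<eta> \<eta>') * ?a \<eta>' \<partial>lborel \<partial>lborel))"
  proof -
    have i: "(\<integral>\<^sup>+\<eta>'. ennreal (1/2) * (ennreal (\<beta> \<eta> \<eta>') * ?a \<eta> + ennreal (\<beta> \<eta> \<eta>') * ?a \<eta>') \<partial>lborel)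
       = ennreal (1/2) * ((\<integral>\<^sup>+\<eta>'. ennreal (\<beta> \<eta> \<eta>') * ?a \<eta> \<partial>lborel) + (\<integral>\<^sup>+\<eta>'. ennreal (\<beta> \<eta> \<eta>') * ?a \<eta>' \<partial>lborel))" for \<eta>
      by (rule nn_integral_cmult_add) measurable
    show ?thesis unfolding i
      by (rule nn_integral_cmult_add) measurable
  qed
  also have "\<dots> = ennreal (1/2 * 2) * (ennreal (2 * R) * (\<integral>\<^sup>+\<eta>. ?a \<eta> \<partial>lborel))"
    unfolding T1 T2 by (simp only: mult_2[symmetric] ennreal_numeral mult.assoc ennreal_mult''[of 2])
  finally show ?thesis unfolding eq A_def by simp
qed

section \<open>The surface measure of a continuous graph over the unit cube\<close>

lemma measurable_graph:
  fixes w :: "real ^ 'k::finite \<Rightarrow> real"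
  assumes "continuous_on (cbox 0 1) w"
  shows "(\<lambda>t. (t, w t)) \<in> measurable (restrict_space lborel (cbox 0 1)) borel"
proof -
  have "(\<lambda>t. (t, w t)) \<in> measurable (restrict_space borel (cbox 0 1)) borel"
    by (intro borel_measurable_continuous_on_restrict continuous_intros assms)
  then show ?thesis by (simp cong: measurable_cong_sets add: sets_restrict_space)
qed

lemma sets_surface_measure [simp, measurable_cong]: "sets (surface_measure w) = sets borel"
  by (simp add: surface_measure_def)

lemma space_surface_measure [simp]: "space (surface_measure w) = UNIV"
  by (simp add: surface_measure_def)

lemma nn_integral_surface_measure:
  fixes w :: "real ^ 'k::finite \<Rightarrow> real"
  assumes w: "continuous_on (cbox 0 1) w" and F: "F \<in> borel_measurable borel"
  shows "(\<integral>\<^sup>+x. F x \<partial>surface_measure w) = (\<integral>\<^sup>+t\<in>cbox 0 1. F (t, w t) \<partial>lborel)"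
  unfolding surface_measure_def
  by (subst nn_integral_distr[OF measurable_graph[OF w]]) (simp_all add: F nn_integral_restrict_space)

lemma integral_surface_measure:
  fixes w :: "real ^ 'k::finite \<Rightarrow> real" and F :: "_ \<Rightarrow> complex"
  assumes w: "continuous_on (cbox 0 1) w" and F: "F \<in> borel_measurable borel"
  shows "(LINT x|surface_measure w. F x) = (LINT t|lborel. indicator (cbox 0 1) t *\<^sub>R F (t, w t))"
  unfolding surface_measure_def
  by (subst integral_distr[OF measurable_graph[OF w]]) (simp_all add: F integral_restrict_space)

lemma emeasure_unit_cube: "emeasure lborel (cbox 0 1 :: (real ^ 'k::finite) set) = 1"
proof -
  have "emeasure lborel (cbox 0 1 :: (real ^ 'k) set) = (\<Prod>b\<in>Basis. ((1 :: real ^ 'k) - 0) \<bullet> b)"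
    by (rule emeasure_lborel_cbox) (auto simp: Basis_vec_def inner_axis)
  also have "(\<Prod>b\<in>Basis. ((1 :: real ^ 'k) - 0) \<bullet> b) = 1"
    unfolding prod_Basis_vec by (simp add: inner_axis)
  finally show ?thesis by simp
qed

lemma prob_space_surface_measure:
  fixes w :: "real ^ 'k::finite \<Rightarrow> real"
  assumes w: "continuous_on (cbox 0 1) w"
  shows "prob_space (surface_measure w)"
proof
  have "emeasure (surface_measure w) (space (surface_measure w)) = (\<integral>\<^sup>+x. 1 \<partial>surface_measure w)" by simp
  also have "\<dots> = (\<integral>\<^sup>+t\<in>cbox 0 1. 1 \<partial>(lborel :: (real ^ 'k) measure))"
    by (rule nn_integral_surface_measure[OF w]) simp
  also have "\<dots> = 1" by (simp add: emeasure_unit_cube)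
  finally show "emeasure (surface_measure w) (space (surface_measure w)) = 1" .
qed

text \<open>The kernel is split at \<open>R\<close> in the last frequency variable only. The low part has no
  decay to exploit but acts like a convolution of length \<open>2 R\<close>; the high part is bounded by \<open>D\<close>.\<close>

lemma fourier_energy_le:
  fixes w :: "real ^ 'k::finite \<Rightarrow> real" and h :: "(real ^ 'k) \<times> real \<Rightarrow> complex"
  assumes w: "continuous_on (cbox 0 1) w"
    and C: "\<And>H :: real ^ 'k \<Rightarrow> complex. integrable lborel H \<Longrightarrow> integrable lborel (\<lambda>x. (norm (H x))\<^sup>2) \<Longrightarrow>
       (\<integral>\<^sup>+t\<in>cbox 0 1. ennreal ((norm (fourier lborel H t))\<^sup>2) \<partial>lborel) \<le> ennreal C * (\<integral>\<^sup>+x. ennreal ((norm (H x))\<^sup>2) \<partial>lborel)"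
    and D: "\<And>\<xi> \<eta>. R < \<bar>\<eta>\<bar> \<Longrightarrow> norm (fourier (surface_measure w) (\<lambda>_. 1) (\<xi>, \<eta>)) \<le> D"
    and hm[measurable]: "h \<in> borel_measurable borel" and hS: "\<And>x. norm (h x) \<le> indicator S x"
    and S: "S \<in> sets borel" "S \<subseteq> cball 0 r" and R: "0 \<le> R" and D0: "0 \<le> D"
  shows "(\<integral>\<^sup>+\<tau>. ennreal ((norm (fourier lborel h \<tau>))\<^sup>2) \<partial>surface_measure w)
     \<le> ennreal (2 * R) * ennreal C * emeasure lborel S + ennreal D * (emeasure lborel S)\<^sup>2"
proof -
  let ?\<mu> = "surface_measure w"
  interpret \<mu>: prob_space ?\<mu> by (rule prob_space_surface_measure[OF w])
  have f\<mu>: "finite_measure ?\<mu>" by (rule \<mu>.finite_measure_axioms)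
  have h1: "norm (h x) \<le> 1" for x using hS[of x] by (auto split: split_indicator_asm)
  have hr: "h x = 0" if "x \<notin> cball 0 r" for x
    using hS[of x] S(2) that by (auto split: split_indicator_asm)
  have hi: "integrable lborel h" by (rule integrable_bounded_support[OF hm h1 hr])
  define \<beta> where "\<beta> p = indicat_real {..R} (\<bar>snd (fst p) - snd (snd p)\<bar>)" for p :: "((real ^ 'k) \<times> real) \<times> ((real ^ 'k) \<times> real)"
  have \<beta>m: "\<beta> \<in> borel_measurable borel"
  proof -
    have "(\<lambda>p :: ((real ^ 'k) \<times> real) \<times> ((real ^ 'k) \<times> real). \<bar>snd (fst p) - snd (snd p)\<bar>) \<in> borel_measurable borel"
      by (intro borel_measurable_continuous_onI continuous_intros)
    from measurable_compose[OF this, of "indicat_real {..R}" borel] show ?thesis by (simp add: \<beta>_def[abs_def])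
  qed
  have \<beta>01: "0 \<le> \<beta> p" "\<beta> p \<le> 1" for p by (auto simp: \<beta>_def)
  define k where "k p = h (fst p) * cnj (h (snd p))" for p
  have ki: "integrable lborel k" unfolding k_def by (rule integral_pair_mult(1)) (use hi in auto)
  have km: "k \<in> borel_measurable borel" using ki by auto
  define kl where "kl p = k p * of_real (\<beta> p)" for p
  define kh where "kh p = k p * of_real (1 - \<beta> p)" for p
  have kli: "integrable lborel kl"
  proof (rule Bochner_Integration.integrable_bound[OF ki])
    show "kl \<in> borel_measurable lborel" unfolding kl_def using km \<beta>m by measurable
    show "AE p in lborel. norm (kl p) \<le> norm (k p)" using \<beta>01 by (simp add: kl_def norm_mult mult_left_le)
  qed
  have khi: "integrable lborel kh"
  proof (rule Bochner_Integration.integrable_bound[OF ki])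
    show "kh \<in> borel_measurable lborel" unfolding kh_def using km \<beta>m by measurable
    show "AE p in lborel. norm (kh p) \<le> norm (k p)"
    proof (rule AE_I2)
      fix p
      have "\<bar>1 - \<beta> p\<bar> \<le> 1" using \<beta>01[of p] by auto
      then show "norm (kh p) \<le> norm (k p)" unfolding kh_def norm_mult norm_of_real by (intro mult_left_le) auto
    qed
  qed
  define L where "L \<tau> = (LINT p|lborel. kl p * echar ((fst p - snd p) \<bullet> \<tau>))" for \<tau>
  define U where "U \<tau> = (LINT p|lborel. kh p * echar ((fst p - snd p) \<bullet> \<tau>))" for \<tau>
  have Li: "integrable ?\<mu> L" unfolding L_def by (rule Fubini_fourier_kernel(2)[OF f\<mu> _ kli]) simp
  have Ui: "integrable ?\<mu> U" unfolding U_def by (rule Fubini_fourier_kernel(2)[OF f\<mu> _ khi]) simp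
  have Lm: "L \<in> borel_measurable borel" using Li by (auto cong: measurable_cong_sets)
  have split: "of_real ((norm (fourier lborel h \<tau>))\<^sup>2) = L \<tau> + U \<tau>" for \<tau>
  proof -
    have em: "(\<lambda>p. echar ((fst p - snd p) \<bullet> \<tau>)) \<in> borel_measurable (borel :: (((real ^ 'k) \<times> real) \<times> ((real ^ 'k) \<times> real)) measure)"
      by (rule measurable_compose[OF _ borel_measurable_echar]) (intro borel_measurable_continuous_onI continuous_intros)
    have b: "integrable lborel (\<lambda>p. g p * echar ((fst p - snd p) \<bullet> \<tau>))" if "integrable lborel g" for g
    proof (rule Bochner_Integration.integrable_bound[OF that])
      show "(\<lambda>p. g p * echar ((fst p - snd p) \<bullet> \<tau>)) \<in> borel_measurable lborel"
        using borel_measurable_integrable[OF that] em by (auto intro!: borel_measurable_times)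
    qed (auto simp: norm_mult)
    have "of_real ((norm (fourier lborel h \<tau>))\<^sup>2) = (LINT p|lborel. k p * echar ((fst p - snd p) \<bullet> \<tau>))"
      unfolding k_def by (rule norm_fourier_sq[OF hi])
    also have "\<dots> = (LINT p|lborel. kl p * echar ((fst p - snd p) \<bullet> \<tau>) + kh p * echar ((fst p - snd p) \<bullet> \<tau>))"
      by (intro Bochner_Integration.integral_cong refl) (simp add: kl_def kh_def algebra_simps)
    also have "\<dots> = L \<tau> + U \<tau>"
      unfolding L_def U_def by (rule Bochner_Integration.integral_add[OF b[OF kli] b[OF khi]])
    finally show ?thesis .
  qed
  have Ei: "integrable ?\<mu> (\<lambda>\<tau>. complex_of_real ((norm (fourier lborel h \<tau>))\<^sup>2))"
    unfolding split using Li Ui by simp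
  have Ei': "integrable ?\<mu> (\<lambda>\<tau>. (norm (fourier lborel h \<tau>))\<^sup>2)"
    using integrable_norm[OF Ei] by (simp add: norm_power)
  have low: "ennreal (norm (LINT \<tau>|?\<mu>. L \<tau>)) \<le> ennreal (2 * R) * ennreal C * emeasure lborel S"
  proof -
    define a where "a t \<eta> = ennreal ((norm (fourier lborel (\<lambda>\<xi>. h (\<xi>, \<eta>)) t))\<^sup>2)" for t \<eta>
    have am: "(\<lambda>p. a (fst p) (snd p)) \<in> borel_measurable (lborel \<Otimes>\<^sub>M lborel)"
    proof -
      have "(\<lambda>((t, \<eta>), \<xi>). echar (t \<bullet> \<xi>) * h (\<xi>, \<eta>)) \<in> borel_measurable (borel :: (((real ^ 'k) \<times> real) \<times> (real ^ 'k)) measure)"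
      proof -
        have [measurable]: "(\<lambda>p. h (snd p, snd (fst p))) \<in> borel_measurable (borel :: (((real ^ 'k) \<times> real) \<times> (real ^ 'k)) measure)"
          by (rule measurable_compose[OF _ hm]) (intro borel_measurable_continuous_onI continuous_intros)
        have [measurable]: "(\<lambda>p. fst (fst p) \<bullet> snd p) \<in> borel_measurable (borel :: (((real ^ 'k) \<times> real) \<times> (real ^ 'k)) measure)"
          by (intro borel_measurable_continuous_onI continuous_intros)
        show ?thesis unfolding case_prod_beta by measurable
      qed
      then have m: "(\<lambda>(q, \<xi>). echar (fst q \<bullet> \<xi>) * h (\<xi>, snd q)) \<in> borel_measurable (borel \<Otimes>\<^sub>M lborel)"
        by (simp add: borel_prod[symmetric] case_prod_beta cong: measurable_cong_sets)
      have "(\<lambda>q. LINT \<xi>|lborel. echar (fst q \<bullet> \<xi>) * h (\<xi>, snd q)) \<in> borel_measurable borel"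
        by (rule lborel.borel_measurable_lebesgue_integral[OF m])
      then have "(\<lambda>p. fourier lborel (\<lambda>\<xi>. h (\<xi>, snd p)) (fst p)) \<in> borel_measurable (lborel \<Otimes>\<^sub>M lborel)"
        by (simp add: fourier_eq_echar lborel_prod)
      then show ?thesis unfolding a_def by measurable
    qed
    \<comment> \<open>For fixed \<eta> the slice of \<open>h\<close> is a function of the spatial
      frequency alone, to which the Bessel inequality on the cube applies. The integrals over
      \<open>t\<close> and \<eta> are exchanged below so that this can be used slice by
      slice.\<close>
    have slice: "(\<integral>\<^sup>+t\<in>cbox 0 1. a t \<eta> \<partial>lborel) \<le> ennreal C * (\<integral>\<^sup>+\<xi>. ennreal ((norm (h (\<xi>, \<eta>)))\<^sup>2) \<partial>lborel)" for \<eta>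
      unfolding a_def
    proof (rule C)
      have pm: "(\<lambda>\<xi>. h (\<xi>, \<eta>)) \<in> borel_measurable borel"
        by (rule measurable_compose[OF _ hm]) (intro borel_measurable_continuous_onI continuous_intros)
      have z: "h (\<xi>, \<eta>) = 0" if "\<xi> \<notin> cball 0 r" for \<xi>
      proof (rule hr)
        show "(\<xi>, \<eta>) \<notin> cball 0 r"
          using that norm_fst_le[of \<xi> \<eta>] by (simp add: mem_cball_0)
      qed
      show "integrable lborel (\<lambda>\<xi>. h (\<xi>, \<eta>))"
        by (rule integrable_bounded_support[OF pm h1 z])
      have "integrable lborel (\<lambda>\<xi>. complex_of_real ((norm (h (\<xi>, \<eta>)))\<^sup>2))"
        by (rule integrable_bounded_support[of _ 1 r]) (use pm h1 z in \<open>auto simp: norm_power power_le_one\<close>)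
      then show "integrable lborel (\<lambda>\<xi>. (norm (h (\<xi>, \<eta>)))\<^sup>2)"
        using integrable_norm by (force simp: norm_power)
    qed
    have "ennreal (norm (LINT \<tau>|?\<mu>. L \<tau>)) \<le> (\<integral>\<^sup>+\<tau>. ennreal (norm (L \<tau>)) \<partial>?\<mu>)"
      by (rule norm_integral_le_nn_integral)
    also have "\<dots> = (\<integral>\<^sup>+t\<in>cbox 0 1. ennreal (norm (L (t, w t))) \<partial>lborel)"
      by (rule nn_integral_surface_measure[OF w]) (use Lm in measurable)
    also have "\<dots> \<le> (\<integral>\<^sup>+t\<in>cbox 0 1. ennreal (2 * R) * (\<integral>\<^sup>+\<eta>. a t \<eta> \<partial>lborel) \<partial>lborel)"
    proof (intro nn_integral_mono mult_right_mono)
      fix t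
      show "ennreal (norm (L (t, w t))) \<le> ennreal (2 * R) * (\<integral>\<^sup>+\<eta>. a t \<eta> \<partial>lborel)"
        unfolding L_def kl_def k_def \<beta>_def a_def by (rule norm_low_frequency_kernel_le[OF hm h1 hr R])
    qed simp
    also have "\<dots> = (\<integral>\<^sup>+t. \<integral>\<^sup>+\<eta>. ennreal (2 * R) * (a t \<eta> * indicator (cbox 0 1) t) \<partial>lborel \<partial>lborel)"
    proof (intro nn_integral_cong)
      fix t
      have "(\<lambda>\<eta>. a t \<eta>) \<in> borel_measurable lborel"
        using measurable_compose[OF measurable_Pair1' am, of t] by simp
      then show "ennreal (2 * R) * (\<integral>\<^sup>+\<eta>. a t \<eta> \<partial>lborel) * indicator (cbox 0 1) t = (\<integral>\<^sup>+\<eta>. ennreal (2 * R) * (a t \<eta> * indicator (cbox 0 1) t) \<partial>lborel)"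
        by (simp add: nn_integral_cmult nn_integral_multc mult.assoc)
    qed
    also have "\<dots> = (\<integral>\<^sup>+\<eta>. \<integral>\<^sup>+t. ennreal (2 * R) * (a t \<eta> * indicator (cbox 0 1) t) \<partial>lborel \<partial>lborel)"
    proof (rule lborel_pair.Fubini'[symmetric])
      have "(\<lambda>p. indicator (cbox 0 1) (fst p) :: ennreal) \<in> borel_measurable (lborel \<Otimes>\<^sub>M (lborel :: real measure))" by measurable
      then show "(\<lambda>(t, \<eta>). ennreal (2 * R) * (a t \<eta> * indicator (cbox 0 1) t)) \<in> borel_measurable (lborel \<Otimes>\<^sub>M lborel)"
        using am unfolding case_prod_beta by measurable
    qed
    also have "\<dots> = (\<integral>\<^sup>+\<eta>. ennreal (2 * R) * (\<integral>\<^sup>+t\<in>cbox 0 1. a t \<eta> \<partial>lborel) \<partial>lborel)"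
    proof (intro nn_integral_cong nn_integral_cmult)
      fix \<eta>
      have "(\<lambda>t. a t \<eta>) \<in> borel_measurable lborel"
        using measurable_compose[OF measurable_Pair2' am, of \<eta>] by simp
      then show "(\<lambda>t. a t \<eta> * indicator (cbox 0 1) t) \<in> borel_measurable lborel" by measurable
    qed
    also have "\<dots> \<le> (\<integral>\<^sup>+\<eta>. ennreal (2 * R) * (ennreal C * (\<integral>\<^sup>+\<xi>. ennreal ((norm (h (\<xi>, \<eta>)))\<^sup>2) \<partial>lborel)) \<partial>lborel)"
      by (intro nn_integral_mono mult_left_mono slice) simp
    also have "\<dots> = ennreal (2 * R) * (ennreal C * (\<integral>\<^sup>+x. ennreal ((norm (h x))\<^sup>2) \<partial>lborel))"
    proof -
      have hm2: "(\<lambda>x. ennreal ((norm (h x))\<^sup>2)) \<in> borel_measurable (lborel \<Otimes>\<^sub>M lborel)"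
        by (simp add: lborel_prod)
      have "(\<integral>\<^sup>+\<eta>. (\<integral>\<^sup>+\<xi>. ennreal ((norm (h (\<xi>, \<eta>)))\<^sup>2) \<partial>lborel) \<partial>lborel) = (\<integral>\<^sup>+x. ennreal ((norm (h x))\<^sup>2) \<partial>lborel)"
        using lborel_pair.nn_integral_snd[OF hm2] by (simp add: lborel_prod)
      moreover have "(\<lambda>\<eta>. \<integral>\<^sup>+\<xi>. ennreal ((norm (h (\<xi>, \<eta>)))\<^sup>2) \<partial>lborel) \<in> borel_measurable lborel"
      proof -
        have "(\<lambda>(\<eta>, \<xi>). ennreal ((norm (h (\<xi>, \<eta>)))\<^sup>2)) \<in> borel_measurable (lborel \<Otimes>\<^sub>M lborel)"
          using measurable_compose[OF measurable_pair_swap' hm2] by (simp add: case_prod_beta)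
        then show ?thesis by (rule lborel.borel_measurable_nn_integral)
      qed
      ultimately show ?thesis by (simp add: nn_integral_cmult)
    qed
    also have "\<dots> \<le> ennreal (2 * R) * (ennreal C * (\<integral>\<^sup>+x. indicator S x \<partial>lborel))"
    proof (intro mult_left_mono nn_integral_mono)
      fix x
      show "ennreal ((norm (h x))\<^sup>2) \<le> indicator S x"
        using hS[of x] h1[of x] by (auto simp: power_le_one ennreal_le_1 split: split_indicator split_indicator_asm)
    qed auto
    finally show ?thesis using S by (simp add: mult.assoc)
  qed
  have high: "ennreal (norm (LINT \<tau>|?\<mu>. U \<tau>)) \<le> ennreal D * (emeasure lborel S)\<^sup>2"
  proof -
    have "(LINT \<tau>|?\<mu>. U \<tau>) = (LINT p|lborel. kh p * fourier ?\<mu> (\<lambda>_. 1) (fst p - snd p))"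
      unfolding U_def by (rule Fubini_fourier_kernel(1)[OF f\<mu> _ khi]) simp
    also have "ennreal (norm \<dots>) \<le> (\<integral>\<^sup>+p. ennreal (norm (kh p * fourier ?\<mu> (\<lambda>_. 1) (fst p - snd p))) \<partial>lborel)"
      by (rule norm_integral_le_nn_integral)
    also have "\<dots> \<le> (\<integral>\<^sup>+p. ennreal D * (indicator S (fst p) * indicator S (snd p)) \<partial>lborel)"
    proof (intro nn_integral_mono)
      fix p :: "((real ^ 'k) \<times> real) \<times> ((real ^ 'k) \<times> real)"
      have kS: "norm (k p) \<le> indicator S (fst p) * indicator S (snd p)"
        unfolding k_def norm_mult complex_mod_cnj by (intro mult_mono hS) auto
      show "ennreal (norm (kh p * fourier ?\<mu> (\<lambda>_. 1) (fst p - snd p))) \<le> ennreal D * (indicator S (fst p) * indicator S (snd p))"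
      \<comment> \<open>If the last coordinates differ by at most \<open>R\<close>, then
        \<open>kh\<close> vanishes; otherwise \<open>D\<close> bounds the transform of the
        measure.\<close>
      proof (cases "\<bar>snd (fst p) - snd (snd p)\<bar> \<le> R")
        case True
        then show ?thesis by (simp add: kh_def \<beta>_def)
      next
        case False
        then have "norm (fourier ?\<mu> (\<lambda>_. 1) (fst (fst p) - fst (snd p), snd (fst p) - snd (snd p))) \<le> D"
          by (intro D) auto
        moreover have "(fst (fst p) - fst (snd p), snd (fst p) - snd (snd p)) = fst p - snd p"
          by (simp add: prod_eq_iff)
        ultimately have "norm (fourier ?\<mu> (\<lambda>_. 1) (fst p - snd p)) \<le> D" by simp
        then have "norm (kh p * fourier ?\<mu> (\<lambda>_. 1) (fst p - snd p)) \<le> (indicator S (fst p) * indicator S (snd p)) * D"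
          unfolding norm_mult using kS False by (intro mult_mono) (auto simp: kh_def \<beta>_def)
        then have "ennreal (norm (kh p * fourier ?\<mu> (\<lambda>_. 1) (fst p - snd p))) \<le> ennreal ((indicator S (fst p) * indicator S (snd p)) * D)"
          by (rule ennreal_leI)
        also have "\<dots> = ennreal D * (indicator S (fst p) * indicator S (snd p))"
          by (auto split: split_indicator)
        finally show ?thesis .
      qed
    qed
    also have "\<dots> = ennreal D * (emeasure lborel S)\<^sup>2"
    proof -
      have "(\<integral>\<^sup>+p. indicator S (fst p) * indicator S (snd p) \<partial>lborel) = (\<integral>\<^sup>+x. \<integral>\<^sup>+y. indicator S x * indicator S y \<partial>lborel \<partial>(lborel :: ((real ^ 'k) \<times> real) measure))"
        unfolding lborel_prod[symmetric, where 'a="(real ^ 'k) \<times> real" and 'b="(real ^ 'k) \<times> real"] using S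
        by (subst lborel.nn_integral_fst[symmetric]) (auto intro!: borel_measurable_times_ennreal measurable_compose[OF measurable_fst] measurable_compose[OF measurable_snd])
      also have "\<dots> = (emeasure lborel S)\<^sup>2" using S
        by (simp add: nn_integral_cmult nn_integral_multc power2_eq_square)
      finally have e: "(\<integral>\<^sup>+p. indicator S (fst p) * indicator S (snd p) \<partial>lborel) = (emeasure lborel S)\<^sup>2" .
      have "(\<lambda>p. indicator S (fst p) * indicator S (snd p) :: ennreal) \<in> borel_measurable (lborel \<Otimes>\<^sub>M lborel)"
        using S by (auto intro!: borel_measurable_times_ennreal measurable_compose[OF measurable_fst] measurable_compose[OF measurable_snd])
      then have "(\<lambda>p. indicator S (fst p) * indicator S (snd p) :: ennreal) \<in> borel_measurable lborel"
        by (simp add: lborel_prod)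
      then show ?thesis by (simp only: nn_integral_cmult e)
    qed
    finally show ?thesis .
  qed
  have "(\<integral>\<^sup>+\<tau>. ennreal ((norm (fourier lborel h \<tau>))\<^sup>2) \<partial>?\<mu>) = ennreal (LINT \<tau>|?\<mu>. (norm (fourier lborel h \<tau>))\<^sup>2)"
    using Ei' by (intro nn_integral_eq_integral) auto
  also have "(LINT \<tau>|?\<mu>. (norm (fourier lborel h \<tau>))\<^sup>2) = norm (LINT \<tau>|?\<mu>. complex_of_real ((norm (fourier lborel h \<tau>))\<^sup>2))"
    by (subst integral_complex_of_real) (auto intro!: abs_of_nonneg[symmetric] integral_nonneg_AE)
  also have "(LINT \<tau>|?\<mu>. complex_of_real ((norm (fourier lborel h \<tau>))\<^sup>2)) = (LINT \<tau>|?\<mu>. L \<tau>) + (LINT \<tau>|?\<mu>. U \<tau>)"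
    unfolding split by (rule Bochner_Integration.integral_add[OF Li Ui])
  also have "ennreal (norm \<dots>) \<le> ennreal (norm (LINT \<tau>|?\<mu>. L \<tau>)) + ennreal (norm (LINT \<tau>|?\<mu>. U \<tau>))"
    by (rule order_trans[OF ennreal_leI[OF norm_triangle_ineq]]) simp
  also have "\<dots> \<le> ennreal (2 * R) * ennreal C * emeasure lborel S + ennreal D * (emeasure lborel S)\<^sup>2"
    by (intro add_mono low high)
  finally show ?thesis .
qed

section \<open>Lebesgue norms and the strong-type extension bound\<close>

text \<open>Translates norm bounds into bounds on the integral of the \<open>P\<close>-th power, the
  form in which the estimates are proved; a finite \<open>c\<close> makes the infinite branch of
  \<open>Lp_norm\<close> harmless.\<close>

lemma Lp_norm_le_iff:
  assumes P: "0 < P" and c: "0 \<le> c"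
  shows "Lp_norm (ennreal P) M f \<le> ennreal c \<longleftrightarrow> (\<integral>\<^sup>+x. ennreal (norm (f x) powr P) \<partial>M) \<le> ennreal (c powr P)"
proof (cases "(\<integral>\<^sup>+x. ennreal (norm (f x) powr P) \<partial>M) = \<infinity>")
  case True
  then show ?thesis using P by (simp add: Lp_norm_def top_unique)
next
  case False
  then obtain r where r: "0 \<le> r" "(\<integral>\<^sup>+x. ennreal (norm (f x) powr P) \<partial>M) = ennreal r"
    by (metis ennreal_cases infinity_ennreal_def)
  have "r powr (1 / P) \<le> c \<longleftrightarrow> r \<le> c powr P"
  proof
    assume "r powr (1 / P) \<le> c"
    then have "(r powr (1 / P)) powr P \<le> c powr P" using P by (intro powr_mono2) auto
    then show "r \<le> c powr P" using P r by (simp add: powr_powr)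
  next
    assume "r \<le> c powr P"
    then have "r powr (1 / P) \<le> (c powr P) powr (1 / P)" using P r by (intro powr_mono2) auto
    then show "r powr (1 / P) \<le> c" using P c by (simp add: powr_powr)
  qed
  then show ?thesis using P r c by (simp add: Lp_norm_def)
qed

lemma Lp_norm_finite_iff:
  assumes P: "0 < P"
  shows "Lp_norm (ennreal P) M f < \<infinity> \<longleftrightarrow> (\<integral>\<^sup>+x. ennreal (norm (f x) powr P) \<partial>M) < \<infinity>"
  using P by (auto simp: Lp_norm_def Let_def less_top)

text \<open>Young's inequality for \<open>f / A\<close> and \<open>g / B\<close>, integrated.
  Positive bounds \<open>A\<close> and \<open>B\<close> stand in for the norms, so that vanishing or
  infinite norms need no separate cases.\<close>

lemma nn_integral_Holder:
  fixes p q A B :: real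
  assumes pq: "1 < p" "1 < q" "1 / p + 1 / q = 1" and AB: "0 < A" "0 < B"
    and f[measurable]: "f \<in> borel_measurable M" and g[measurable]: "g \<in> borel_measurable M"
    and f0: "\<And>x. 0 \<le> f x" and g0: "\<And>x. 0 \<le> g x"
    and fA: "(\<integral>\<^sup>+x. ennreal (f x powr p) \<partial>M) \<le> ennreal (A powr p)"
    and gB: "(\<integral>\<^sup>+x. ennreal (g x powr q) \<partial>M) \<le> ennreal (B powr q)"
  shows "(\<integral>\<^sup>+x. ennreal (f x * g x) \<partial>M) \<le> ennreal (A * B)"
proof -
  define a where "a = A * B / (A powr p * p)"
  define b where "b = A * B / (B powr q * q)"
  have ab: "0 \<le> a" "0 \<le> b" using AB pq by (auto simp: a_def b_def)
  have pt: "f x * g x \<le> a * f x powr p + b * g x powr q" for x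
  proof -
    have "(f x / A) * (g x / B) \<le> (f x / A) powr p / p + (g x / B) powr q / q"
      by (rule Youngs_inequality) (use pq AB f0 g0 in auto)
    then have "(A * B) * ((f x / A) * (g x / B)) \<le> (A * B) * ((f x / A) powr p / p + (g x / B) powr q / q)"
      using AB by (intro mult_left_mono) auto
    then show ?thesis using AB f0 g0
      by (simp add: a_def b_def powr_divide distrib_left)
  qed
  have "(\<integral>\<^sup>+x. ennreal (f x * g x) \<partial>M) \<le> (\<integral>\<^sup>+x. ennreal a * ennreal (f x powr p) + ennreal b * ennreal (g x powr q) \<partial>M)"
    using ab by (intro nn_integral_mono) (simp add: ennreal_mult'[symmetric] ennreal_leI pt flip: ennreal_plus)
  also have "\<dots> = ennreal a * (\<integral>\<^sup>+x. ennreal (f x powr p) \<partial>M) + ennreal b * (\<integral>\<^sup>+x. ennreal (g x powr q) \<partial>M)"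
    by (simp add: nn_integral_add nn_integral_cmult)
  also have "\<dots> \<le> ennreal a * ennreal (A powr p) + ennreal b * ennreal (B powr q)"
    by (intro add_mono mult_left_mono fA gB) auto
  also have "\<dots> = ennreal (a * A powr p + b * B powr q)"
    using ab by (simp add: ennreal_mult'[symmetric])
  also have "a * A powr p + b * B powr q = A * B * (1 / p + 1 / q)"
    using AB pq by (simp add: a_def b_def field_simps)
  finally show ?thesis using pq by simp
qed

text \<open>The multiplication formula: restriction is the transpose of extension. Both the
  weak-type bound and the dual estimate rest on it.\<close>

lemma fourier_duality:
  fixes \<mu> :: "'a::euclidean_space measure"
  assumes "finite_measure \<mu>" and s[measurable_cong]: "sets \<mu> = sets borel"
    and f: "integrable \<mu> f" and h: "integrable lborel h"
  shows "(LINT \<xi>|lborel. fourier \<mu> f \<xi> * h \<xi>) = (LINT x|\<mu>. f x * fourier lborel h x)"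
proof -
  interpret \<mu>: finite_measure \<mu> by fact
  interpret P: pair_sigma_finite \<mu> "lborel :: 'a measure" ..
  have [measurable]: "f \<in> borel_measurable \<mu>" "h \<in> borel_measurable borel" using f h by auto
  have i: "integrable (\<mu> \<Otimes>\<^sub>M lborel) (\<lambda>(x, \<xi>). echar (\<xi> \<bullet> x) * f x * h \<xi>)"
  proof (rule P.Fubini_integrable)
    show "(\<lambda>(x, \<xi>). echar (\<xi> \<bullet> x) * f x * h \<xi>) \<in> borel_measurable (\<mu> \<Otimes>\<^sub>M lborel)" by measurable
    show "integrable \<mu> (\<lambda>x. LINT \<xi>|lborel. norm (case (x, \<xi>) of (x, \<xi>) \<Rightarrow> echar (\<xi> \<bullet> x) * f x * h \<xi>))"
      using f h by (simp add: norm_mult)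
    show "AE x in \<mu>. integrable lborel (\<lambda>\<xi>. case (x, \<xi>) of (x, \<xi>) \<Rightarrow> echar (\<xi> \<bullet> x) * f x * h \<xi>)"
    proof (rule AE_I2)
      fix x
      have "integrable lborel (\<lambda>\<xi>. f x * h \<xi>)" using h by simp
      then show "integrable lborel (\<lambda>\<xi>. case (x, \<xi>) of (x, \<xi>) \<Rightarrow> echar (\<xi> \<bullet> x) * f x * h \<xi>)"
        by (rule Bochner_Integration.integrable_bound) (auto simp: norm_mult)
    qed
  qed
  have "(LINT \<xi>|lborel. fourier \<mu> f \<xi> * h \<xi>) = (LINT \<xi>|lborel. LINT x|\<mu>. echar (\<xi> \<bullet> x) * f x * h \<xi>)"
    by (simp add: fourier_eq_echar)
  also have "\<dots> = (LINT x|\<mu>. LINT \<xi>|lborel. echar (\<xi> \<bullet> x) * f x * h \<xi>)"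
    by (rule P.Fubini_integral[OF i])
  also have "\<dots> = (LINT x|\<mu>. f x * fourier lborel h x)"
  proof (intro Bochner_Integration.integral_cong refl)
    fix x
    have "(LINT \<xi>|lborel. echar (\<xi> \<bullet> x) * f x * h \<xi>) = (LINT \<xi>|lborel. f x * (echar (x \<bullet> \<xi>) * h \<xi>))"
      by (intro Bochner_Integration.integral_cong refl) (simp add: inner_commute)
    then show "(LINT \<xi>|lborel. echar (\<xi> \<bullet> x) * f x * h \<xi>) = f x * fourier lborel h x"
      by (simp add: fourier_eq_echar)
  qed
  finally show ?thesis .
qed

text \<open>A dyadic decomposition of the values of \<open>u\<close>: where \<open>u\<close> lies
  between \<open>s (Suc j)\<close> and \<open>s j\<close>, the weak bound gives a contribution of at
  most \<open>K * 2 powr r\<close> times \<open>2 powr (r - q)\<close> to the power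
  \<open>j\<close>. The series is geometric because \<open>r < q\<close>, and
  \<open>u \<le> 1\<close> means that levels above 1 do not occur.\<close>

lemma nn_integral_powr_weak_type:
  fixes u :: "'a \<Rightarrow> real"
  assumes u[measurable]: "u \<in> borel_measurable M" and u01: "\<And>x. 0 \<le> u x" "\<And>x. u x \<le> 1"
    and weak: "\<And>s. 0 < s \<Longrightarrow> s \<le> 1 \<Longrightarrow> emeasure M {x\<in>space M. s < u x} \<le> ennreal (K * s powr (- r))"
    and K: "0 \<le> K" and r: "0 \<le> r" "r < q"
  shows "(\<integral>\<^sup>+x. ennreal (u x powr q) \<partial>M) \<le> ennreal (K * 2 powr r / (1 - 2 powr (r - q)))"
proof -
  define s where "s j = (1 / 2 :: real) ^ j" for j :: nat
  have s0: "0 < s j" "s j \<le> 1" for j by (auto simp: s_def power_le_one)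
  have s2: "s j = 2 powr (- real j)" for j
    by (simp add: s_def powr_minus powr_realpow power_one_over inverse_eq_divide)
  have pt: "ennreal (u x powr q) \<le> (\<Sum>j. ennreal (s j powr q) * indicator {x\<in>space M. s (Suc j) < u x} x)"
    if x: "x \<in> space M" for x
  proof (cases "u x = 0")
    case False
    then have "0 < u x" using u01(1)[of x] by simp
    then obtain n where "(1 / 2) ^ n < u x" using real_arch_pow_inv[of "u x" "1 / 2"] by auto
    then have "\<exists>j. s (Suc j) < u x"
      by (intro exI[of _ n] order_le_less_trans[of "s (Suc n)" "s n"]) (auto simp: s_def)
    then have ex: "s (Suc (LEAST j. s (Suc j) < u x)) < u x" by (rule LeastI_ex)
    define j where "j = (LEAST j. s (Suc j) < u x)"
    have lt: "s (Suc j) < u x" unfolding j_def by (rule ex)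
    have le: "u x \<le> s j"
    proof (cases j)
      case 0 then show ?thesis using u01(2)[of x] by (simp add: s_def)
    next
      case (Suc i)
      then have "\<not> s (Suc i) < u x" unfolding j_def by (intro not_less_Least) simp
      then show ?thesis using Suc by simp
    qed
    have "ennreal (u x powr q) \<le> ennreal (s j powr q)"
      using le u01(1)[of x] r by (intro ennreal_leI powr_mono2) auto
    also have "\<dots> = (\<Sum>i\<in>{j}. ennreal (s i powr q) * indicator {x\<in>space M. s (Suc i) < u x} x)" using lt x by simp
    also have "\<dots> \<le> (\<Sum>j. ennreal (s j powr q) * indicator {x\<in>space M. s (Suc j) < u x} x)"
      by (rule sum_le_suminf) auto
    finally show ?thesis .
  qed simp
  define \<rho> where "\<rho> = 2 powr (r - q)"
  have \<rho>: "0 < \<rho>" "\<rho> < 1" using r by (auto simp: \<rho>_def powr_less_one)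
  have trm: "s j powr q * (K * s (Suc j) powr (- r)) = K * 2 powr r * \<rho> ^ j" for j
  proof -
    have "s j powr q * s (Suc j) powr (- r) = 2 powr (- real j * q + real (Suc j) * r)"
      by (simp add: s2 powr_powr powr_add[symmetric] algebra_simps)
    also have "\<dots> = 2 powr r * \<rho> ^ j"
      by (simp add: \<rho>_def powr_realpow[symmetric] powr_powr powr_add[symmetric] algebra_simps)
    finally show ?thesis by simp
  qed
  have "(\<integral>\<^sup>+x. ennreal (u x powr q) \<partial>M) \<le> (\<integral>\<^sup>+x. (\<Sum>j. ennreal (s j powr q) * indicator {x\<in>space M. s (Suc j) < u x} x) \<partial>M)"
    by (intro nn_integral_mono pt)
  also have "\<dots> = (\<Sum>j. \<integral>\<^sup>+x. ennreal (s j powr q) * indicator {x\<in>space M. s (Suc j) < u x} x \<partial>M)"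
    by (rule nn_integral_suminf) measurable
  also have "\<dots> = (\<Sum>j. ennreal (s j powr q) * emeasure M {x\<in>space M. s (Suc j) < u x})"
    by (intro suminf_cong nn_integral_cmult_indicator) measurable
  also have "\<dots> \<le> (\<Sum>j. ennreal (K * 2 powr r * \<rho> ^ j))"
  proof (intro suminf_le)
    fix j
    have "ennreal (s j powr q) * emeasure M {x\<in>space M. s (Suc j) < u x} \<le> ennreal (s j powr q) * ennreal (K * s (Suc j) powr (- r))"
      by (intro mult_left_mono weak s0) simp
    also have "\<dots> = ennreal (K * 2 powr r * \<rho> ^ j)" by (simp add: ennreal_mult'[symmetric] trm)
    finally show "ennreal (s j powr q) * emeasure M {x\<in>space M. s (Suc j) < u x} \<le> ennreal (K * 2 powr r * \<rho> ^ j)" .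
  qed auto
  also have "\<dots> = ennreal (\<Sum>j. K * 2 powr r * \<rho> ^ j)"
    using K \<rho> by (intro suminf_ennreal2 summable_mult summable_geometric) auto
  also have "(\<Sum>j. K * 2 powr r * \<rho> ^ j) = K * 2 powr r / (1 - \<rho>)"
    using \<rho> by (subst suminf_mult) (auto simp: suminf_geometric summable_geometric)
  finally show ?thesis by (simp add: \<rho>_def)
qed

text \<open>Cauchy-Schwarz against the constant 1 on a probability space. The pointwise bound
  confines the level sets below to levels at most \<open>N\<close>.\<close>

lemma integrable_norm_fourier_surface_le:
  fixes w :: "real ^ 'k::finite \<Rightarrow> real"
  assumes w: "continuous_on (cbox 0 1) w" and N: "0 < N"
    and f: "f \<in> borel_measurable borel"
    and f2: "(\<integral>\<^sup>+x. ennreal (norm (f x) powr 2) \<partial>surface_measure w) \<le> ennreal (N powr 2)"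
  shows "integrable (surface_measure w) f" and "norm (fourier (surface_measure w) f \<xi>) \<le> N"
proof -
  interpret \<mu>: prob_space "surface_measure w" by (rule prob_space_surface_measure[OF w])
  have f'[measurable]: "f \<in> borel_measurable (surface_measure w)" using f by simp
  have "(\<integral>\<^sup>+x. ennreal (norm (f x) * 1) \<partial>surface_measure w) \<le> ennreal (N * 1)"
    by (rule nn_integral_Holder[of 2 2, OF _ _ _ N _ _ _ _ _ f2]) (use \<mu>.emeasure_space_1 in auto)
  then have n1: "(\<integral>\<^sup>+x. ennreal (norm (f x)) \<partial>surface_measure w) \<le> ennreal N" by simp
  then show i: "integrable (surface_measure w) f"
    by (intro integrableI_bounded) (auto intro: le_less_trans)
  have "ennreal (norm (fourier (surface_measure w) f \<xi>)) \<le> ennreal N"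
    unfolding fourier_eq_echar
    by (rule order_trans[OF norm_integral_le_nn_integral]) (use n1 in \<open>simp add: norm_mult\<close>)
  then show "norm (fourier (surface_measure w) f \<xi>) \<le> N" using N by (simp add: ennreal_le_iff)
qed

text \<open>The radius \<open>R\<close> is chosen so that the high-frequency part of the energy is
  \<open>\<sigma>\<^sup>2 / 2\<close> times the squared volume of the level set. That is half of the
  left side and can be absorbed; the low-frequency part then bounds the volume by
  \<open>4 * R * C / \<sigma>\<^sup>2\<close>, with \<open>R\<close> of order
  \<open>\<sigma> powr (- (2 / b))\<close>. The restriction \<sigma> \<le> 1 ensures
  \<open>R \<ge> 1\<close>, the range where decay is assumed.\<close>

lemma fourier_surface_weak_type:
  fixes w :: "real ^ 'k::finite \<Rightarrow> real"
  assumes w: "continuous_on (cbox 0 1) w"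
    and C0: "0 \<le> C" and C: "\<And>H :: real ^ 'k \<Rightarrow> complex. integrable lborel H \<Longrightarrow> integrable lborel (\<lambda>x. (norm (H x))\<^sup>2) \<Longrightarrow>
       (\<integral>\<^sup>+t\<in>cbox 0 1. ennreal ((norm (fourier lborel H t))\<^sup>2) \<partial>lborel) \<le> ennreal C * (\<integral>\<^sup>+x. ennreal ((norm (H x))\<^sup>2) \<partial>lborel)"
    and A: "1 \<le> A" and b: "0 < b"
    and decay: "\<And>\<xi> \<eta>. 1 \<le> \<bar>\<eta>\<bar> \<Longrightarrow> norm (fourier (surface_measure w) (\<lambda>_. 1) (\<xi>, \<eta>)) \<le> A * \<bar>\<eta>\<bar> powr (- b)"
    and f: "f \<in> borel_measurable borel" and N: "0 < N"
    and f2: "(\<integral>\<^sup>+x. ennreal (norm (f x) powr 2) \<partial>surface_measure w) \<le> ennreal (N powr 2)"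
    and \<sigma>: "0 < \<sigma>" "\<sigma> \<le> 1"
  shows "emeasure lborel {\<xi>. \<sigma> * N < norm (fourier (surface_measure w) f \<xi>)}
     \<le> ennreal (4 * C * (2 * A) powr (1 / b) * \<sigma> powr (- (2 + 2 / b)))"
proof -
  let ?\<mu> = "surface_measure w"
  let ?K = "4 * C * (2 * A) powr (1 / b) * \<sigma> powr (- (2 + 2 / b))"
  interpret \<mu>: prob_space ?\<mu> by (rule prob_space_surface_measure[OF w])
  note fi = integrable_norm_fourier_surface_le(1)[OF w N f f2]
  define g where "g = fourier ?\<mu> f"
  have gm[measurable]: "g \<in> borel_measurable borel"
    unfolding g_def by (rule borel_measurable_fourier) (use f \<mu>.sigma_finite_measure_axioms in auto)
  define R where "R = (2 * A / \<sigma>\<^sup>2) powr (1 / b)"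
  define D where "D = \<sigma>\<^sup>2 / 2"
  have \<sigma>2: "0 < \<sigma>\<^sup>2" "\<sigma>\<^sup>2 \<le> 1" using \<sigma> by (auto simp: power_le_one)
  have X1: "1 \<le> 2 * A / \<sigma>\<^sup>2" using \<sigma>2 A by (simp add: field_simps)
  have R1: "1 \<le> R" unfolding R_def using X1 b by (intro ge_one_powr_ge_zero) auto
  have RD: "A * R powr (- b) = D"
  proof -
    have "R powr (- b) = (2 * A / \<sigma>\<^sup>2) powr (- 1)" unfolding R_def powr_powr using b by simp
    also have "\<dots> = \<sigma>\<^sup>2 / (2 * A)" using X1 \<sigma>2 A by (simp add: powr_minus powr_one inverse_eq_divide)
    finally show ?thesis using A by (simp add: D_def)
  qed
  have Dd: "norm (fourier ?\<mu> (\<lambda>_. 1) (\<xi>, \<eta>)) \<le> D" if "R < \<bar>\<eta>\<bar>" for \<xi> \<eta>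
  proof -
    have "norm (fourier ?\<mu> (\<lambda>_. 1) (\<xi>, \<eta>)) \<le> A * \<bar>\<eta>\<bar> powr (- b)" using that R1 by (intro decay) auto
    also have "\<dots> \<le> A * R powr (- b)" using that R1 A b by (intro mult_left_mono powr_mono2') auto
    finally show ?thesis by (simp add: RD)
  qed
  have RK: "4 * R * C / \<sigma>\<^sup>2 = ?K"
  proof -
    have "R = (2 * A) powr (1 / b) / (\<sigma>\<^sup>2) powr (1 / b)" unfolding R_def by (rule powr_divide)
    also have "(\<sigma>\<^sup>2) powr (1 / b) = \<sigma> powr (2 / b)" using \<sigma> by (simp add: powr_powr flip: powr_numeral)
    finally have R: "R = (2 * A) powr (1 / b) * \<sigma> powr (- (2 / b))" by (simp add: powr_minus divide_inverse)
    have "1 / \<sigma>\<^sup>2 = \<sigma> powr (- 2)" using \<sigma> by (simp add: powr_minus inverse_eq_divide)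
    then have "4 * R * C / \<sigma>\<^sup>2 = 4 * C * (2 * A) powr (1 / b) * (\<sigma> powr (- (2 / b)) * \<sigma> powr (- 2))"
      unfolding R by (simp add: divide_inverse mult_ac)
    also have "\<sigma> powr (- (2 / b)) * \<sigma> powr (- 2) = \<sigma> powr (- (2 + 2 / b))"
    proof -
      have "- (2 / b) + - 2 = - (2 + 2 / b)" by simp
      then show ?thesis by (metis powr_add)
    qed
    finally show ?thesis .
  qed
  define E where "E = {\<xi>. \<sigma> * N < norm (g \<xi>)}"
  have Em: "E \<in> sets borel" unfolding E_def by measurable
  \<comment> \<open>Cutting to a ball makes the volume finite, so that absorption is legitimate, and
    the test function integrable. The balls are exhausted at the end.\<close>
  have bound: "emeasure lborel (E \<inter> cball 0 (real n)) \<le> ennreal ?K" for n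
  proof -
    define S where "S = E \<inter> cball 0 (real n)"
    have S[measurable]: "S \<in> sets borel" unfolding S_def using Em by auto
    have Sf: "emeasure lborel S < \<infinity>" by (rule emeasure_bounded_finite) (auto simp: S_def intro: bounded_subset[OF bounded_cball])
    define v where "v = measure lborel S"
    have v: "emeasure lborel S = ennreal v" unfolding v_def using Sf by (intro emeasure_eq_ennreal_measure) auto
    have v0: "0 \<le> v" by (simp add: v_def)
    show ?thesis
    proof (cases "v = 0")
      case True then show ?thesis using v by (simp add: S_def)
    next
      case False
      then have vp: "0 < v" using v0 by simp
      define h where "h \<xi> = indicator S \<xi> *\<^sub>R cnj (sgn (g \<xi>))" for \<xi>
      have hm[measurable]: "h \<in> borel_measurable borel"
        unfolding h_def sgn_div_norm by measurable
      have hS: "norm (h \<xi>) \<le> indicator S \<xi>" for \<xi> by (auto simp: h_def norm_sgn split: split_indicator)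
      have gh: "g \<xi> * h \<xi> = of_real (norm (g \<xi>) * indicator S \<xi>)" for \<xi>
      proof -
        have "g \<xi> * cnj (sgn (g \<xi>)) = of_real (norm (g \<xi>))"
          by (cases "g \<xi> = 0") (simp_all add: sgn_div_norm complex_norm_square[symmetric] power2_eq_square scaleR_conv_of_real field_simps)
        then show ?thesis by (simp add: h_def split: split_indicator)
      qed
      have hi: "integrable lborel h"
        by (rule integrable_bounded_support[OF hm, of 1 "real n"])
          (use hS in \<open>auto simp: h_def S_def norm_sgn split: split_indicator\<close>)
      define Q where "Q = 2 * R * C * v + D * v\<^sup>2"
      have Qp: "0 < Q" unfolding Q_def using vp R1 C0 \<sigma>2 by (intro add_nonneg_pos) (auto simp: D_def)
      have "(\<integral>\<^sup>+\<tau>. ennreal ((norm (fourier lborel h \<tau>))\<^sup>2) \<partial>?\<mu>) \<le> ennreal (2 * R) * ennreal C * emeasure lborel S + ennreal D * (emeasure lborel S)\<^sup>2"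
        by (rule fourier_energy_le[OF w C Dd hm hS S, where r="real n"]) (use R1 \<sigma>2 in \<open>auto simp: D_def S_def\<close>)
      also have "\<dots> = ennreal Q"
        unfolding v Q_def using R1 C0 v0 \<sigma>2 by (simp add: ennreal_mult'[symmetric] ennreal_power D_def)
      finally have en: "(\<integral>\<^sup>+\<tau>. ennreal (norm (fourier lborel h \<tau>) powr 2) \<partial>?\<mu>) \<le> ennreal (sqrt Q powr 2)"
        using Qp by simp
      have hhat[measurable]: "fourier lborel h \<in> borel_measurable borel"
        by (rule borel_measurable_fourier) (auto simp: sigma_finite_lborel)
      have "ennreal (\<sigma> * N * v) = (\<integral>\<^sup>+\<xi>. ennreal (\<sigma> * N) * indicator S \<xi> \<partial>lborel)"
        using \<sigma> N v0 S by (subst nn_integral_cmult_indicator) (simp_all add: v ennreal_mult'')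
      also have "\<dots> \<le> (\<integral>\<^sup>+\<xi>. ennreal (norm (g \<xi>) * indicator S \<xi>) \<partial>lborel)"
        by (intro nn_integral_mono) (auto simp: S_def E_def split: split_indicator intro!: ennreal_leI)
      also have "\<dots> = ennreal (LINT \<xi>|lborel. norm (g \<xi>) * indicator S \<xi>)"
      proof (rule nn_integral_eq_integral)
        have ghm: "(\<lambda>\<xi>. g \<xi> * h \<xi>) \<in> borel_measurable borel" by measurable
        have "integrable lborel (\<lambda>\<xi>. g \<xi> * h \<xi>)"
          by (rule integrable_bounded_support[OF ghm, of N "real n"])
            (use integrable_norm_fourier_surface_le(2)[OF w N f f2] N in \<open>auto simp: gh g_def[symmetric] S_def split: split_indicator\<close>)
        from integrable_norm[OF this] show "integrable lborel (\<lambda>\<xi>. norm (g \<xi>) * indicator S \<xi>)"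
          by (simp add: gh norm_mult)
      qed auto
      also have "(LINT \<xi>|lborel. norm (g \<xi>) * indicator S \<xi>) = norm (LINT \<xi>|lborel. g \<xi> * h \<xi>)"
        unfolding gh integral_complex_of_real norm_of_real
        by (intro abs_of_nonneg[symmetric] integral_nonneg_AE) auto
      also have "(LINT \<xi>|lborel. g \<xi> * h \<xi>) = (LINT x|?\<mu>. f x * fourier lborel h x)"
        unfolding g_def by (rule fourier_duality[OF \<mu>.finite_measure_axioms _ fi hi]) simp
      also have "ennreal (norm \<dots>) \<le> (\<integral>\<^sup>+x. ennreal (norm (f x) * norm (fourier lborel h x)) \<partial>?\<mu>)"
        by (rule order_trans[OF norm_integral_le_nn_integral]) (simp add: norm_mult)
      also have "\<dots> \<le> ennreal (N * sqrt Q)"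
        by (rule nn_integral_Holder[of 2 2, OF _ _ _ N _ _ _ _ _ f2 en]) (use Qp f in auto)
      finally have "\<sigma> * N * v \<le> N * sqrt Q" using N Qp by (simp add: ennreal_le_iff)
      then have "\<sigma> * v \<le> sqrt Q" using N by (simp add: mult.assoc mult.left_commute[of \<sigma> N])
      then have "(\<sigma> * v)\<^sup>2 \<le> (sqrt Q)\<^sup>2" using \<sigma> v0 by (intro power_mono) auto
      then have "\<sigma>\<^sup>2 * v\<^sup>2 \<le> 2 * R * C * v + \<sigma>\<^sup>2 / 2 * v\<^sup>2" using Qp by (simp add: power_mult_distrib Q_def D_def)
      then have "v * (\<sigma>\<^sup>2 * v) \<le> v * (4 * R * C)" by (simp add: power2_eq_square[of v] algebra_simps)
      then have "\<sigma>\<^sup>2 * v \<le> 4 * R * C" using vp by (simp only: mult_le_cancel_left_pos)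
      then have "v \<le> 4 * R * C / \<sigma>\<^sup>2" using \<sigma>2 by (simp add: field_simps)
      then show ?thesis unfolding RK using v by (simp add: S_def ennreal_leI)
    qed
  qed
  have "emeasure lborel (\<Union>n. E \<inter> cball 0 (real n)) = (SUP n. emeasure lborel (E \<inter> cball 0 (real n)))"
    by (rule SUP_emeasure_incseq[symmetric]) (use Em in \<open>auto simp: incseq_def\<close>)
  also have "\<dots> \<le> ennreal ?K" by (intro SUP_least bound)
  also have "(\<Union>n. E \<inter> cball 0 (real n)) = E" using real_arch_simple by auto
  finally show ?thesis by (simp add: E_def g_def)
qed

lemma fourier_surface_strong_type:
  fixes w :: "real ^ 'k::finite \<Rightarrow> real"
  assumes w: "continuous_on (cbox 0 1) w" and A: "1 \<le> A" and b: "0 < b"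
    and decay: "\<And>\<xi> \<eta>. 1 \<le> \<bar>\<eta>\<bar> \<Longrightarrow> norm (fourier (surface_measure w) (\<lambda>_. 1) (\<xi>, \<eta>)) \<le> A * \<bar>\<eta>\<bar> powr (- b)"
    and q: "2 + 2 / b < q"
  obtains c where "0 < c" "\<And>f N. f \<in> borel_measurable borel \<Longrightarrow> 0 < N \<Longrightarrow>
      (\<integral>\<^sup>+x. ennreal (norm (f x) powr 2) \<partial>surface_measure w) \<le> ennreal (N powr 2) \<Longrightarrow>
      (\<integral>\<^sup>+\<xi>. ennreal (norm (fourier (surface_measure w) f \<xi>) powr q) \<partial>lborel) \<le> ennreal ((c * N) powr q)"
proof -
  obtain C where C0: "0 \<le> C" and C: "\<And>H :: real ^ 'k \<Rightarrow> complex. integrable lborel H \<Longrightarrow> integrable lborel (\<lambda>x. (norm (H x))\<^sup>2) \<Longrightarrow>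
       (\<integral>\<^sup>+t\<in>cbox 0 1. ennreal ((norm (fourier lborel H t))\<^sup>2) \<partial>lborel) \<le> ennreal C * (\<integral>\<^sup>+x. ennreal ((norm (H x))\<^sup>2) \<partial>lborel)"
    by (rule integral_fourier_sq_le_unit_cube) blast
  interpret \<mu>: prob_space "surface_measure w" by (rule prob_space_surface_measure[OF w])
  define r where "r = 2 + 2 / b"
  define K where "K = 4 * C * (2 * A) powr (1 / b)"
  \<comment> \<open>The summand 1 keeps the constant positive even if \<open>C = 0\<close>.\<close>
  define T where "T = K * 2 powr r / (1 - 2 powr (r - q)) + 1"
  have r0: "0 \<le> r" "r < q" using b q by (auto simp: r_def)
  have K0: "0 \<le> K" using C0 by (simp add: K_def)
  have "2 powr (r - q) < 1" using r0 by (simp add: powr_less_one)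
  then have T0: "0 < T" using K0 by (auto simp: T_def intro!: add_nonneg_pos divide_nonneg_pos)
  show thesis
  proof (rule that[of "T powr (1 / q)"])
    show "0 < T powr (1 / q)" using T0 by simp
    fix f :: "(real ^ 'k) \<times> real \<Rightarrow> complex" and N :: real
    assume f: "f \<in> borel_measurable borel" and N: "0 < N"
      and f2: "(\<integral>\<^sup>+x. ennreal (norm (f x) powr 2) \<partial>surface_measure w) \<le> ennreal (N powr 2)"
    define g where "g = fourier (surface_measure w) f"
    have gm[measurable]: "g \<in> borel_measurable borel"
      unfolding g_def by (rule borel_measurable_fourier) (use f \<mu>.sigma_finite_measure_axioms in auto)
    define u where "u \<xi> = norm (g \<xi>) / N" for \<xi>
    have "(\<integral>\<^sup>+\<xi>. ennreal (u \<xi> powr q) \<partial>lborel) \<le> ennreal (K * 2 powr r / (1 - 2 powr (r - q)))"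
    proof (rule nn_integral_powr_weak_type[OF _ _ _ _ K0 r0])
      show "u \<in> borel_measurable lborel" unfolding u_def by measurable
      show "0 \<le> u \<xi>" for \<xi> using N by (simp add: u_def)
      show "u \<xi> \<le> 1" for \<xi>
        using integrable_norm_fourier_surface_le(2)[OF w N f f2] N by (simp add: u_def g_def)
      fix s :: real assume s: "0 < s" "s \<le> 1"
      have "{\<xi>\<in>space lborel. s < u \<xi>} = {\<xi>. s * N < norm (fourier (surface_measure w) f \<xi>)}"
        using N by (auto simp: u_def g_def field_simps)
      then show "emeasure lborel {\<xi>\<in>space lborel. s < u \<xi>} \<le> ennreal (K * s powr (- r))"
        unfolding K_def r_def using fourier_surface_weak_type[OF w C0 C A b decay f N f2 s] by simp
    qed
    also have "\<dots> \<le> ennreal T" by (intro ennreal_leI) (simp add: T_def)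
    finally have uT: "(\<integral>\<^sup>+\<xi>. ennreal (u \<xi> powr q) \<partial>lborel) \<le> ennreal T" .
    have "(\<integral>\<^sup>+\<xi>. ennreal (norm (g \<xi>) powr q) \<partial>lborel) = (\<integral>\<^sup>+\<xi>. ennreal (N powr q) * ennreal (u \<xi> powr q) \<partial>lborel)"
      using N by (intro nn_integral_cong) (simp add: u_def powr_divide ennreal_mult'[symmetric])
    also have "\<dots> = ennreal (N powr q) * (\<integral>\<^sup>+\<xi>. ennreal (u \<xi> powr q) \<partial>lborel)"
      by (rule nn_integral_cmult) (simp add: u_def)
    also have "\<dots> \<le> ennreal (N powr q) * ennreal T" by (intro mult_left_mono uT) simp
    also have "\<dots> = ennreal ((T powr (1 / q) * N) powr q)"
      using T0 N r0 by (simp add: ennreal_mult'[symmetric] powr_mult powr_powr mult.commute)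
    finally show "(\<integral>\<^sup>+\<xi>. ennreal (norm (fourier (surface_measure w) f \<xi>) powr q) \<partial>lborel) \<le> ennreal ((T powr (1 / q) * N) powr q)"
      by (simp add: g_def)
  qed
qed

section \<open>Density of Schwartz functions\<close>

lemma schwartzD:
  assumes "schwartz f" "set vs \<subseteq> Basis"
  shows "iterated_partial vs f differentiable at x"
    and "bounded (range (\<lambda>x. (1 + norm x) ^ N *\<^sub>R iterated_partial vs f x))"
  using assms by (auto simp: schwartz_def)

lemma schwartz_continuous:
  assumes "schwartz f"
  shows "continuous_on UNIV f"
  using schwartzD(1)[OF assms, of "[]"]
  by (auto intro!: continuous_at_imp_continuous_on differentiable_imp_continuous_within)

lemma schwartz_borel_measurable:
  "schwartz f \<Longrightarrow> f \<in> borel_measurable borel"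
  by (intro borel_measurable_continuous_onI schwartz_continuous)

lemma iterated_partial_add:
  assumes f: "schwartz f" and g: "schwartz g" and vs: "set vs \<subseteq> Basis"
  shows "iterated_partial vs (\<lambda>x. f x + g x) = (\<lambda>x. iterated_partial vs f x + iterated_partial vs g x)"
  using vs
proof (induction vs)
  case (Cons v vs)
  have "(iterated_partial vs f has_derivative frechet_derivative (iterated_partial vs f) (at x)) (at x)"
     "(iterated_partial vs g has_derivative frechet_derivative (iterated_partial vs g) (at x)) (at x)" for x
    using schwartzD(1)[OF f, of vs x] schwartzD(1)[OF g, of vs x] Cons.prems
    by (auto simp: frechet_derivative_works)
  then have "((\<lambda>x. iterated_partial vs f x + iterated_partial vs g x) has_derivative
     (\<lambda>h. frechet_derivative (iterated_partial vs f) (at x) h + frechet_derivative (iterated_partial vs g) (at x) h)) (at x)" for x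
    by (intro has_derivative_add)
  from frechet_derivative_at[OF this] have "frechet_derivative (\<lambda>x. iterated_partial vs f x + iterated_partial vs g x) (at x)
     = (\<lambda>h. frechet_derivative (iterated_partial vs f) (at x) h + frechet_derivative (iterated_partial vs g) (at x) h)" for x
    by simp
  then show ?case using Cons by simp
qed simp

lemma iterated_partial_cmult:
  assumes f: "schwartz f" and vs: "set vs \<subseteq> Basis"
  shows "iterated_partial vs (\<lambda>x. c * f x) = (\<lambda>x. c * iterated_partial vs f x)"
  using vs
proof (induction vs)
  case (Cons v vs)
  have "(iterated_partial vs f has_derivative frechet_derivative (iterated_partial vs f) (at x)) (at x)" for x
    using schwartzD(1)[OF f, of vs x] Cons.prems by (auto simp: frechet_derivative_works)
  then have "((\<lambda>x. c * iterated_partial vs f x) has_derivative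
     (\<lambda>h. c * frechet_derivative (iterated_partial vs f) (at x) h)) (at x)" for x
    by (intro has_derivative_mult_right)
  from frechet_derivative_at[OF this] have "frechet_derivative (\<lambda>x. c * iterated_partial vs f x) (at x)
     = (\<lambda>h. c * frechet_derivative (iterated_partial vs f) (at x) h)" for x
    by simp
  then show ?case using Cons by simp
qed simp

lemma schwartz_add:
  assumes f: "schwartz f" and g: "schwartz g"
  shows "schwartz (\<lambda>x. f x + g x)"
  unfolding schwartz_def
proof (intro allI impI conjI)
  fix vs :: "'a list" and x :: 'a and N :: nat
  assume vs: "set vs \<subseteq> Basis"
  show "iterated_partial vs (\<lambda>x. f x + g x) differentiable at x"
    unfolding iterated_partial_add[OF f g vs] using schwartzD(1)[OF f vs] schwartzD(1)[OF g vs]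
    by (intro differentiable_add)
  have "bounded (range (\<lambda>x. (1 + norm x) ^ N *\<^sub>R iterated_partial vs f x + (1 + norm x) ^ N *\<^sub>R iterated_partial vs g x))"
    using schwartzD(2)[OF f vs] schwartzD(2)[OF g vs] by (rule bounded_plus_comp)
  then show "bounded (range (\<lambda>x. (1 + norm x) ^ N *\<^sub>R iterated_partial vs (\<lambda>x. f x + g x) x))"
    unfolding iterated_partial_add[OF f g vs] by (simp only: scaleR_add_right)
qed

lemma schwartz_cmult:
  assumes f: "schwartz f"
  shows "schwartz (\<lambda>x. c * f x)"
  unfolding schwartz_def
proof (intro allI impI conjI)
  fix vs :: "'a list" and x :: 'a and N :: nat
  assume vs: "set vs \<subseteq> Basis"
  show "iterated_partial vs (\<lambda>x. c * f x) differentiable at x"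
    unfolding iterated_partial_cmult[OF f vs] using schwartzD(1)[OF f vs]
    by (intro differentiable_mult) auto
  obtain B where B: "\<And>x. norm ((1 + norm x) ^ N *\<^sub>R iterated_partial vs f x) \<le> B"
    using schwartzD(2)[OF f vs, of N] by (auto simp: bounded_iff)
  show "bounded (range (\<lambda>x. (1 + norm x) ^ N *\<^sub>R iterated_partial vs (\<lambda>x. c * f x) x))"
    unfolding iterated_partial_cmult[OF f vs]
  proof (rule boundedI, safe)
    fix x
    have "norm ((1 + norm x) ^ N *\<^sub>R (c * iterated_partial vs f x)) = norm c * norm ((1 + norm x) ^ N *\<^sub>R iterated_partial vs f x)"
      by (simp add: norm_mult)
    also have "\<dots> \<le> norm c * B" by (intro mult_left_mono B) simp
    finally show "norm ((1 + norm x) ^ N *\<^sub>R (c * iterated_partial vs f x)) \<le> norm c * B" .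
  qed
qed

section \<open>Tensor products of one-dimensional bumps as Schwartz functions\<close>

lemma one_plus_sum_le_prod:
  fixes f :: "'a \<Rightarrow> real"
  assumes "finite S" "\<And>i. i \<in> S \<Longrightarrow> 0 \<le> f i"
  shows "1 + (\<Sum>i\<in>S. f i) \<le> (\<Prod>i\<in>S. 1 + f i)"
  using assms
proof (induction S)
  case (insert x S)
  have "0 \<le> (\<Sum>i\<in>S. f i)" using insert.prems by (intro sum_nonneg) auto
  then have "1 + (\<Sum>i\<in>insert x S. f i) \<le> (1 + f x) * (1 + (\<Sum>i\<in>S. f i))"
    using insert by (simp add: algebra_simps)
  also have "\<dots> \<le> (1 + f x) * (\<Prod>i\<in>S. 1 + f i)" using insert by (intro mult_left_mono) auto
  finally show ?case using insert.hyps by simp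
qed simp

lemma power_div_fact_le_exp:
  fixes x :: real
  assumes "0 \<le> x"
  shows "x ^ k / fact k \<le> exp x"
proof -
  have "(\<Sum>i\<in>{k}. x ^ i /\<^sub>R fact i) \<le> (\<Sum>i. x ^ i /\<^sub>R fact i)"
    by (rule sum_le_suminf[OF summable_exp_generic]) (use assms in auto)
  then show ?thesis by (simp add: exp_def field_simps)
qed

text \<open>Here \<open>v b m\<close> is the \<open>m\<close>-th derivative of the factor in
  direction \<open>b\<close>. Every iterated partial derivative of the tensor product is again a
  tensor product, whose orders count how often each direction occurs in the list, and the weight is
  dominated by the product of the weights of the coordinates.\<close>

lemma schwartz_tensor:
  fixes v :: "'a::euclidean_space \<Rightarrow> nat \<Rightarrow> real \<Rightarrow> real"
  assumes der: "\<And>b m t. b \<in> Basis \<Longrightarrow> (v b m has_real_derivative v b (Suc m) t) (at t)"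
    and bd: "\<And>b m N. b \<in> Basis \<Longrightarrow> \<exists>K. \<forall>t. (1 + \<bar>t\<bar>) ^ N * \<bar>v b m t\<bar> \<le> K"
  shows "schwartz (\<lambda>x. complex_of_real (\<Prod>b\<in>Basis. v b 0 (x \<bullet> b)))"
proof -
  define T where "T m x = complex_of_real (\<Prod>b\<in>Basis. v b (m b) (x \<bullet> b))" for m x
  have Td: "(T m has_derivative (\<lambda>y. complex_of_real (\<Sum>b\<in>Basis. (v b (Suc (m b)) (x \<bullet> b) * (y \<bullet> b)) * (\<Prod>j\<in>Basis - {b}. v j (m j) (x \<bullet> j))))) (at x)" for m x
    unfolding T_def
  proof (intro has_derivative_of_real has_derivative_prod)
    fix b :: 'a assume b: "b \<in> Basis"
    show "((\<lambda>x. v b (m b) (x \<bullet> b)) has_derivative (\<lambda>y. v b (Suc (m b)) (x \<bullet> b) * (y \<bullet> b))) (at x)"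
      by (rule has_derivative_compose[of "\<lambda>x. x \<bullet> b" "\<lambda>y. y \<bullet> b" x UNIV "v b (m b)" "(*) (v b (Suc (m b)) (x \<bullet> b))"])
        (use der[OF b, of "m b" "x \<bullet> b"] in \<open>simp_all add: has_field_derivative_def bounded_linear_imp_has_derivative bounded_linear_inner_left\<close>)
  qed
  have Tp: "frechet_derivative (T m) (at x) u = T (m(u := Suc (m u))) x" if u: "u \<in> Basis" for m x u
  proof -
    have "frechet_derivative (T m) (at x) u = complex_of_real (\<Sum>b\<in>Basis. (v b (Suc (m b)) (x \<bullet> b) * (u \<bullet> b)) * (\<Prod>j\<in>Basis - {b}. v j (m j) (x \<bullet> j)))"
      by (simp only: frechet_derivative_at[OF Td[of m x], symmetric])
    also have "(\<Sum>b\<in>Basis. (v b (Suc (m b)) (x \<bullet> b) * (u \<bullet> b)) * (\<Prod>j\<in>Basis - {b}. v j (m j) (x \<bullet> j)))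
       = (\<Sum>b\<in>Basis. if b = u then v u (Suc (m u)) (x \<bullet> u) * (\<Prod>j\<in>Basis - {u}. v j (m j) (x \<bullet> j)) else 0)"
      using u by (intro sum.cong refl) (auto simp: inner_Basis)
    also have "\<dots> = v u (Suc (m u)) (x \<bullet> u) * (\<Prod>j\<in>Basis - {u}. v j (m j) (x \<bullet> j))"
      using u by simp
    also have "(\<Prod>j\<in>Basis - {u}. v j (m j) (x \<bullet> j)) = (\<Prod>j\<in>Basis - {u}. v j ((m(u := Suc (m u))) j) (x \<bullet> j))"
      by (intro prod.cong) auto
    also have "v u (Suc (m u)) (x \<bullet> u) * \<dots> = (\<Prod>j\<in>Basis. v j ((m(u := Suc (m u))) j) (x \<bullet> j))"
      using u by (subst prod.remove[OF finite_Basis u]) simp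
    finally show ?thesis by (simp only: T_def[abs_def])
  qed
  have it: "iterated_partial vs (T (\<lambda>_. 0)) = T (count_list vs)" if "set vs \<subseteq> Basis" for vs
    using that
  proof (induction vs)
    case (Cons u vs)
    have "T ((count_list vs)(u := Suc (count_list vs u))) = T (count_list (u # vs))"
      by (rule arg_cong[where f=T]) auto
    then show ?case using Cons by (simp add: Tp del: count_list.simps)
  next
    case Nil
    have "count_list [] = (\<lambda>_::'a. 0)" by auto
    then show ?case by simp
  qed
  have "schwartz (T (\<lambda>_. 0))"
    unfolding schwartz_def
  proof (intro allI impI conjI)
    fix vs :: "'a list" and x :: 'a and N :: nat
    assume vs: "set vs \<subseteq> Basis"
    show "iterated_partial vs (T (\<lambda>_. 0)) differentiable at x"
      unfolding it[OF vs] differentiable_def using Td by blast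
    define m where "m = count_list vs"
    have "\<forall>b\<in>Basis. \<exists>K. \<forall>t. (1 + \<bar>t\<bar>) ^ N * \<bar>v b (m b) t\<bar> \<le> K" using bd by blast
    then obtain K where K: "\<And>b t. b \<in> Basis \<Longrightarrow> (1 + \<bar>t\<bar>) ^ N * \<bar>v b (m b) t\<bar> \<le> K b" by metis
    show "bounded (range (\<lambda>x. (1 + norm x) ^ N *\<^sub>R iterated_partial vs (T (\<lambda>_. 0)) x))"
      unfolding it[OF vs] m_def[symmetric]
    proof (rule boundedI, safe)
      fix x :: 'a
      have "1 + norm x \<le> 1 + (\<Sum>b\<in>Basis. \<bar>x \<bullet> b\<bar>)" using norm_le_l1[of x] by simp
      also have "\<dots> \<le> (\<Prod>b\<in>Basis. 1 + \<bar>x \<bullet> b\<bar>)" by (rule one_plus_sum_le_prod) auto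
      finally have "(1 + norm x) ^ N \<le> (\<Prod>b\<in>Basis. (1 + \<bar>x \<bullet> b\<bar>) ^ N)"
        unfolding prod_power_distrib[symmetric] by (intro power_mono) auto
      then have "(1 + norm x) ^ N * (\<Prod>b\<in>Basis. \<bar>v b (m b) (x \<bullet> b)\<bar>) \<le> (\<Prod>b\<in>Basis. (1 + \<bar>x \<bullet> b\<bar>) ^ N) * (\<Prod>b\<in>Basis. \<bar>v b (m b) (x \<bullet> b)\<bar>)"
        by (intro mult_right_mono prod_nonneg) auto
      also have "\<dots> = (\<Prod>b\<in>Basis. (1 + \<bar>x \<bullet> b\<bar>) ^ N * \<bar>v b (m b) (x \<bullet> b)\<bar>)" by (simp add: prod.distrib)
      also have "\<dots> \<le> (\<Prod>b\<in>Basis. K b)" by (intro prod_mono conjI K) auto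
      finally show "norm ((1 + norm x) ^ N *\<^sub>R T m x) \<le> (\<Prod>b\<in>Basis. K b)"
        by (simp add: T_def prod_norm[symmetric])
    qed
  qed
  then show ?thesis by (simp only: T_def[abs_def])
qed

lemma power_times_exp_even_power_bounded:
  fixes y :: real
  assumes n: "1 \<le> n"
  shows "\<bar>y\<bar> ^ k * exp (- (y ^ (2 * n))) \<le> fact k"
proof (cases "\<bar>y\<bar> \<le> 1")
  case True
  have "\<bar>y\<bar> ^ k * exp (- (y ^ (2 * n))) \<le> 1 * 1"
    using True by (intro mult_mono) (auto simp: power_le_one power_mult)
  then show ?thesis using fact_ge_1[of k, where 'a=real] by linarith
next
  case False
  have "\<bar>y\<bar> ^ 1 \<le> \<bar>y\<bar> ^ (2 * n)" using False n by (intro power_increasing) auto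
  then have "\<bar>y\<bar> \<le> y ^ (2 * n)" by (simp add: power_mult)
  then have "\<bar>y\<bar> ^ k * exp (- (y ^ (2 * n))) \<le> \<bar>y\<bar> ^ k * exp (- \<bar>y\<bar>)"
    by (intro mult_left_mono) auto
  also have "\<dots> \<le> fact k"
  proof -
    have "\<bar>y\<bar> ^ k / fact k \<le> exp \<bar>y\<bar>" by (rule power_div_fact_le_exp) simp
    then show ?thesis by (simp add: exp_minus field_simps)
  qed
  finally show ?thesis .
qed

lemma poly_times_exp_even_power_bounded:
  fixes s :: "real poly"
  assumes n: "1 \<le> n" and \<rho>: "0 < \<rho>"
  shows "\<exists>K. \<forall>t. \<bar>poly s t\<bar> * exp (- (((t - c) / \<rho>) ^ (2 * n))) \<le> K"
proof -
  define s' where "s' = pcompose s [:c, \<rho>:]"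
  have s': "poly s t = poly s' ((t - c) / \<rho>)" for t using \<rho> by (simp add: s'_def poly_pcompose)
  define K where "K = (\<Sum>i\<le>degree s'. \<bar>coeff s' i\<bar> * fact i)"
  have "\<bar>poly s' y\<bar> * exp (- (y ^ (2 * n))) \<le> K" for y
  proof -
    have "\<bar>poly s' y\<bar> \<le> (\<Sum>i\<le>degree s'. \<bar>coeff s' i\<bar> * \<bar>y\<bar> ^ i)"
      unfolding poly_altdef by (rule order_trans[OF sum_abs]) (simp add: abs_mult power_abs)
    then have "\<bar>poly s' y\<bar> * exp (- (y ^ (2 * n))) \<le> (\<Sum>i\<le>degree s'. \<bar>coeff s' i\<bar> * \<bar>y\<bar> ^ i) * exp (- (y ^ (2 * n)))"
      by (intro mult_right_mono) auto
    also have "\<dots> = (\<Sum>i\<le>degree s'. \<bar>coeff s' i\<bar> * (\<bar>y\<bar> ^ i * exp (- (y ^ (2 * n)))))"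
      by (simp add: sum_distrib_right mult.assoc)
    also have "\<dots> \<le> K" unfolding K_def
      by (intro sum_mono mult_left_mono power_times_exp_even_power_bounded n) auto
    finally show ?thesis .
  qed
  then show ?thesis unfolding s' by blast
qed

text \<open>As \<open>n\<close> grows, the bump tends to the indicator of an interval of radius \<open>\<rho>\<close> around \<open>c\<close>, while
  its derivatives remain polynomial multiples of it.\<close>

definition bump :: "nat \<Rightarrow> real \<Rightarrow> real \<Rightarrow> real \<Rightarrow> real" where
  "bump n c \<rho> t = exp (- (((t - c) / \<rho>) ^ (2 * n)))"

text \<open>Differentiating \<open>p * exp (- r)\<close> gives
  \<open>(p' - p * r') * exp (- r)\<close>, so all derivatives are polynomial multiples of the bump,
  with the polynomials given by that recursion.\<close>

lemma bump_derivatives: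
  assumes n: "1 \<le> n" and \<rho>: "0 < \<rho>"
  obtains v :: "nat \<Rightarrow> real \<Rightarrow> real" where "v 0 = bump n c \<rho>"
    "\<And>m t. (v m has_real_derivative v (Suc m) t) (at t)"
    "\<And>m N. \<exists>K. \<forall>t. (1 + \<bar>t\<bar>) ^ N * \<bar>v m t\<bar> \<le> K"
proof -
  define r where "r = (smult (1 / \<rho>) [:-c, 1:]) ^ (2 * n)"
  have r: "poly r t = ((t - c) / \<rho>) ^ (2 * n)" for t by (simp add: r_def poly_power diff_divide_distrib)
  define p where "p = rec_nat (1 :: real poly) (\<lambda>_ q. pderiv q - q * pderiv r)"
  have p0: "p 0 = 1" and pS: "p (Suc m) = pderiv (p m) - p m * pderiv r" for m by (simp_all add: p_def)
  define v where "v m t = poly (p m) t * exp (- poly r t)" for m t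
  show thesis
  proof (rule that[of v])
    show "v 0 = bump n c \<rho>" by (simp add: fun_eq_iff v_def p0 bump_def r)
    show "(v m has_real_derivative v (Suc m) t) (at t)" for m t
      unfolding v_def[abs_def] pS
      by (rule derivative_eq_intros refl poly_DERIV)+ (simp add: algebra_simps)
    show "\<exists>K. \<forall>t. (1 + \<bar>t\<bar>) ^ N * \<bar>v m t\<bar> \<le> K" for m N
    proof -
      \<comment> \<open>The polynomial 2 + t^2 dominates 1 + |t|, so the weight can be merged with
        the polynomial factor of the derivative.\<close>
      obtain K where K: "\<And>t. \<bar>poly ([:2, 0, 1:] ^ N * p m) t\<bar> * exp (- (((t - c) / \<rho>) ^ (2 * n))) \<le> K"
        using poly_times_exp_even_power_bounded[OF n \<rho>] by blast
      have "(1 + \<bar>t\<bar>) ^ N * \<bar>v m t\<bar> \<le> K" for t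
      proof -
        have "1 + \<bar>t\<bar> \<le> 2 + t * t"
        proof (cases "\<bar>t\<bar> \<le> 1")
          case False
          then have "\<bar>t\<bar> * 1 \<le> \<bar>t\<bar> * \<bar>t\<bar>" by (intro mult_left_mono) auto
          then show ?thesis by simp
        qed (simp add: add_increasing2)
        then have "(1 + \<bar>t\<bar>) ^ N \<le> (2 + t * t) ^ N" by (intro power_mono) auto
        then have "(1 + \<bar>t\<bar>) ^ N * \<bar>v m t\<bar> \<le> (2 + t * t) ^ N * \<bar>v m t\<bar>" by (intro mult_right_mono) auto
        also have "\<dots> = \<bar>poly ([:2, 0, 1:] ^ N * p m) t\<bar> * exp (- (((t - c) / \<rho>) ^ (2 * n)))"
          by (simp add: v_def abs_mult poly_power r power_abs)
        also have "\<dots> \<le> K" by (rule K)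
        finally show ?thesis .
      qed
      then show ?thesis by blast
    qed
  qed
qed

lemma schwartz_bump_tensor:
  fixes c \<rho> :: "'a::euclidean_space \<Rightarrow> real"
  assumes n: "1 \<le> n" and \<rho>: "\<And>b. b \<in> Basis \<Longrightarrow> 0 < \<rho> b"
  shows "schwartz (\<lambda>x::'a. complex_of_real (\<Prod>b\<in>Basis. bump n (c b) (\<rho> b) (x \<bullet> b)))"
proof -
  define Q where "Q b v \<longleftrightarrow> v 0 = bump n (c b) (\<rho> b) \<and> (\<forall>m t. (v m has_real_derivative v (Suc m) t) (at t)) \<and>
     (\<forall>m N. \<exists>K. \<forall>t. (1 + \<bar>t\<bar>) ^ N * \<bar>v m t\<bar> \<le> K)" for b and v :: "nat \<Rightarrow> real \<Rightarrow> real"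
  have ex: "\<exists>v. Q b v" if "b \<in> Basis" for b
    using bump_derivatives[OF n \<rho>[OF that], of "c b"] unfolding Q_def by metis
  define v where "v b = (SOME v. Q b v)" for b
  have v: "Q b (v b)" if "b \<in> Basis" for b unfolding v_def by (rule someI_ex[OF ex[OF that]])
  have "schwartz (\<lambda>x::'a. complex_of_real (\<Prod>b\<in>Basis. v b 0 (x \<bullet> b)))"
    by (rule schwartz_tensor) (use v in \<open>auto simp: Q_def\<close>)
  also have "(\<lambda>x::'a. complex_of_real (\<Prod>b\<in>Basis. v b 0 (x \<bullet> b))) = (\<lambda>x::'a. complex_of_real (\<Prod>b\<in>Basis. bump n (c b) (\<rho> b) (x \<bullet> b)))"
    using v by (intro ext arg_cong[where f=complex_of_real] prod.cong) (auto simp: Q_def)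
  finally show ?thesis .
qed

section \<open>Approximation in L^p by Schwartz functions\<close>

lemma norm_add_powr_le:
  fixes a b :: "'a::real_normed_vector"
  assumes P: "0 < P"
  shows "norm (a + b) powr P \<le> 2 powr P * (norm a powr P + norm b powr P)"
proof -
  have "norm (a + b) \<le> 2 * max (norm a) (norm b)" using norm_triangle_ineq[of a b] by linarith
  then have "norm (a + b) powr P \<le> (2 * max (norm a) (norm b)) powr P" using P by (intro powr_mono2) auto
  also have "\<dots> = 2 powr P * max (norm a) (norm b) powr P" by (simp add: powr_mult)
  also have "\<dots> \<le> 2 powr P * (norm a powr P + norm b powr P)"
    by (intro mult_left_mono) (auto simp: max_def)
  finally show ?thesis .
qed

lemma nn_integral_norm_add_powr_le:
  fixes f g :: "'a \<Rightarrow> complex"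
  assumes [measurable]: "f \<in> borel_measurable M" "g \<in> borel_measurable M" and P: "0 < P"
  shows "(\<integral>\<^sup>+x. ennreal (norm (f x + g x) powr P) \<partial>M)
     \<le> ennreal (2 powr P) * ((\<integral>\<^sup>+x. ennreal (norm (f x) powr P) \<partial>M) + (\<integral>\<^sup>+x. ennreal (norm (g x) powr P) \<partial>M))"
proof -
  have "(\<integral>\<^sup>+x. ennreal (norm (f x + g x) powr P) \<partial>M)
     \<le> (\<integral>\<^sup>+x. ennreal (2 powr P) * (ennreal (norm (f x) powr P) + ennreal (norm (g x) powr P)) \<partial>M)"
  proof (intro nn_integral_mono)
    fix x
    have "ennreal (norm (f x + g x) powr P) \<le> ennreal (2 powr P * (norm (f x) powr P + norm (g x) powr P))"
      by (intro ennreal_leI norm_add_powr_le P)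
    then show "ennreal (norm (f x + g x) powr P) \<le> ennreal (2 powr P) * (ennreal (norm (f x) powr P) + ennreal (norm (g x) powr P))"
      by (simp add: ennreal_mult')
  qed
  also have "\<dots> = ennreal (2 powr P) * ((\<integral>\<^sup>+x. ennreal (norm (f x) powr P) \<partial>M) + (\<integral>\<^sup>+x. ennreal (norm (g x) powr P) \<partial>M))"
    by (subst nn_integral_cmult) (auto simp: nn_integral_add)
  finally show ?thesis .
qed

lemma Lp_dominated_convergence:
  fixes f :: "'a \<Rightarrow> complex" and w :: "'a \<Rightarrow> real"
  assumes [measurable]: "\<And>n. u n \<in> borel_measurable M" "f \<in> borel_measurable M" "w \<in> borel_measurable M"
    and b: "\<And>n x. norm (u n x) \<le> w x" "\<And>x. norm (f x) \<le> w x"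
    and w: "(\<integral>\<^sup>+x. ennreal (w x powr P) \<partial>M) < \<infinity>" and P: "0 < P"
    and lim: "AE x in M. (\<lambda>n. u n x) \<longlonglongrightarrow> f x"
  shows "(\<lambda>n. \<integral>\<^sup>+x. ennreal (norm (u n x - f x) powr P) \<partial>M) \<longlonglongrightarrow> 0"
proof -
  have w0: "0 \<le> w x" for x using b(2)[of x] norm_ge_zero order_trans by blast
  have "(\<lambda>n. \<integral>\<^sup>+x. ennreal (norm (u n x - f x) powr P) \<partial>M) \<longlonglongrightarrow> (\<integral>\<^sup>+x. 0 \<partial>M)"
  proof (rule nn_integral_dominated_convergence[where w="\<lambda>x. ennreal (2 powr P) * ennreal (w x powr P)"])
    fix n
    show "AE x in M. ennreal (norm (u n x - f x) powr P) \<le> ennreal (2 powr P) * ennreal (w x powr P)"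
    proof (rule AE_I2)
      fix x
      have "norm (u n x - f x) \<le> 2 * w x" using norm_triangle_ineq4[of "u n x" "f x"] b(1)[of n x] b(2)[of x] by linarith
      then have "norm (u n x - f x) powr P \<le> (2 * w x) powr P" using P by (intro powr_mono2) auto
      then show "ennreal (norm (u n x - f x) powr P) \<le> ennreal (2 powr P) * ennreal (w x powr P)"
        using w0 by (simp add: powr_mult ennreal_mult'[symmetric] ennreal_leI)
    qed
  next
    show "(\<integral>\<^sup>+x. ennreal (2 powr P) * ennreal (w x powr P) \<partial>M) < \<infinity>"
      using w by (simp add: nn_integral_cmult ennreal_mult_less_top)
    show "AE x in M. (\<lambda>n. ennreal (norm (u n x - f x) powr P)) \<longlonglongrightarrow> 0"
      using lim
    proof eventually_elim
      fix x assume "(\<lambda>n. u n x) \<longlonglongrightarrow> f x"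
      then have "(\<lambda>n. norm (u n x - f x)) \<longlonglongrightarrow> 0" by (simp add: LIM_zero tendsto_norm_zero)
      then have "(\<lambda>n. norm (u n x - f x) powr P) \<longlonglongrightarrow> 0 powr P"
        using P by (intro tendsto_powr') auto
      then show "(\<lambda>n. ennreal (norm (u n x - f x) powr P)) \<longlonglongrightarrow> 0"
        using P tendsto_ennrealI by fastforce
    qed
  qed measurable
  then show ?thesis by simp
qed

text \<open>Distances are measured by the integral of the \<open>P\<close>-th power rather than by
  its root: the quasi-triangle inequality \<open>norm_add_powr_le\<close> is enough for all closure
  properties below.\<close>

definition schwartz_closure :: "real \<Rightarrow> ('a::euclidean_space \<Rightarrow> complex) set" where
  "schwartz_closure P = {f \<in> borel_measurable borel.
     \<forall>e>0. \<exists>u. schwartz u \<and> (\<integral>\<^sup>+x. ennreal (norm (u x - f x) powr P) \<partial>lborel) < ennreal e}"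

lemma schwartz_closureD:
  assumes "f \<in> schwartz_closure P"
  shows "f \<in> borel_measurable borel"
    and "0 < e \<Longrightarrow> \<exists>u. schwartz u \<and> (\<integral>\<^sup>+x. ennreal (norm (u x - f x) powr P) \<partial>lborel) < ennreal e"
  using assms by (auto simp: schwartz_closure_def)

lemma ennreal_split_less:
  assumes "a < ennreal (e / (2 * K))" "b < ennreal (e / (2 * K))" "0 < K" "0 < e"
  shows "ennreal K * (a + b) < ennreal e"
proof -
  have "a < top" "b < top" using assms(1,2) ennreal_less_top less_trans by blast+
  obtain a' where a': "a = ennreal a'" "0 \<le> a'" using \<open>a < top\<close> by (cases a) auto
  obtain b' where b': "b = ennreal b'" "0 \<le> b'" using \<open>b < top\<close> by (cases b) auto
  have "a' < e / (2 * K)" "b' < e / (2 * K)" using assms a' b' by (auto simp: ennreal_less_iff)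
  then have "K * (a' + b') < K * (e / (2 * K) + e / (2 * K))" using assms by (intro mult_strict_left_mono) auto
  also have "\<dots> = e" using assms by (simp add: field_simps)
  finally show ?thesis using a' b' assms by (simp add: ennreal_mult'[symmetric] ennreal_less_iff flip: ennreal_plus)
qed

lemma schwartz_closure_limit:
  assumes f[measurable]: "f \<in> borel_measurable borel" and P: "0 < P"
    and g: "\<And>n. g n \<in> schwartz_closure P"
    and lim: "(\<lambda>n. \<integral>\<^sup>+x. ennreal (norm (g n x - f x) powr P) \<partial>lborel) \<longlonglongrightarrow> 0"
  shows "f \<in> schwartz_closure P"
  unfolding schwartz_closure_def
proof (safe intro!: f)
  fix e :: real assume e: "0 < e"
  define e' where "e' = e / (2 * 2 powr P)"
  have e': "0 < e'" using e by (simp add: e'_def)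
  have "\<forall>\<^sub>F n in sequentially. (\<integral>\<^sup>+x. ennreal (norm (g n x - f x) powr P) \<partial>lborel) < ennreal e'"
    by (rule order_tendstoD(2)[OF lim]) (use e' in simp)
  then obtain n where n: "(\<integral>\<^sup>+x. ennreal (norm (g n x - f x) powr P) \<partial>lborel) < ennreal e'"
    using eventually_happens' sequentially_bot by blast
  obtain u where u: "schwartz u" "(\<integral>\<^sup>+x. ennreal (norm (u x - g n x) powr P) \<partial>lborel) < ennreal e'"
    using schwartz_closureD(2)[OF g e'] by blast
  have [measurable]: "u \<in> borel_measurable borel" "g n \<in> borel_measurable borel"
    using u schwartz_borel_measurable schwartz_closureD(1)[OF g] by auto
  have "(\<integral>\<^sup>+x. ennreal (norm (u x - f x) powr P) \<partial>lborel) = (\<integral>\<^sup>+x. ennreal (norm ((u x - g n x) + (g n x - f x)) powr P) \<partial>lborel)"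
    by simp
  also have "\<dots> \<le> ennreal (2 powr P) * ((\<integral>\<^sup>+x. ennreal (norm (u x - g n x) powr P) \<partial>lborel) + (\<integral>\<^sup>+x. ennreal (norm (g n x - f x) powr P) \<partial>lborel))"
    by (rule nn_integral_norm_add_powr_le[OF _ _ P]) measurable
  also have "\<dots> < ennreal e"
    by (rule ennreal_split_less) (use u n e in \<open>auto simp: e'_def\<close>)
  finally show "\<exists>u. schwartz u \<and> (\<integral>\<^sup>+x. ennreal (norm (u x - f x) powr P) \<partial>lborel) < ennreal e"
    using u by blast
qed

lemma schwartz_closure_add:
  assumes f: "f \<in> schwartz_closure P" and g: "g \<in> schwartz_closure P" and P: "0 < P"
  shows "(\<lambda>x. f x + g x) \<in> schwartz_closure P"
  unfolding schwartz_closure_def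
proof (safe)
  have [measurable]: "f \<in> borel_measurable borel" "g \<in> borel_measurable borel"
    using schwartz_closureD(1)[OF f] schwartz_closureD(1)[OF g] by auto
  show "(\<lambda>x. f x + g x) \<in> borel_measurable borel" by measurable
  fix e :: real assume e: "0 < e"
  define e' where "e' = e / (2 * 2 powr P)"
  have e': "0 < e'" using e by (simp add: e'_def)
  obtain u where u: "schwartz u" "(\<integral>\<^sup>+x. ennreal (norm (u x - f x) powr P) \<partial>lborel) < ennreal e'"
    using schwartz_closureD(2)[OF f e'] by blast
  obtain v where v: "schwartz v" "(\<integral>\<^sup>+x. ennreal (norm (v x - g x) powr P) \<partial>lborel) < ennreal e'"
    using schwartz_closureD(2)[OF g e'] by blast
  have [measurable]: "u \<in> borel_measurable borel" "v \<in> borel_measurable borel"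
    using u v schwartz_borel_measurable by auto
  have "(\<integral>\<^sup>+x. ennreal (norm ((u x + v x) - (f x + g x)) powr P) \<partial>lborel) = (\<integral>\<^sup>+x. ennreal (norm ((u x - f x) + (v x - g x)) powr P) \<partial>lborel)"
    by (simp add: algebra_simps)
  also have "\<dots> \<le> ennreal (2 powr P) * ((\<integral>\<^sup>+x. ennreal (norm (u x - f x) powr P) \<partial>lborel) + (\<integral>\<^sup>+x. ennreal (norm (v x - g x) powr P) \<partial>lborel))"
    by (rule nn_integral_norm_add_powr_le[OF _ _ P]) measurable
  also have "\<dots> < ennreal e"
    by (rule ennreal_split_less) (use u v e in \<open>auto simp: e'_def\<close>)
  finally show "\<exists>u. schwartz u \<and> (\<integral>\<^sup>+x. ennreal (norm (u x - (f x + g x)) powr P) \<partial>lborel) < ennreal e"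
    using schwartz_add[OF u(1) v(1)] by blast
qed

lemma schwartz_zero: "schwartz (\<lambda>x::'a::euclidean_space. 0)"
proof -
  have "iterated_partial vs (\<lambda>x::'a. 0::complex) = (\<lambda>x. 0)" for vs
    by (induction vs) (auto simp: frechet_derivative_const)
  then show ?thesis by (simp add: schwartz_def)
qed

lemma schwartz_closure_schwartz:
  assumes "schwartz u"
  shows "u \<in> schwartz_closure P"
  using assms schwartz_borel_measurable[OF assms] by (auto simp: schwartz_closure_def intro!: exI[of _ u])

lemma schwartz_closure_cmult:
  assumes f: "f \<in> schwartz_closure P" and P: "0 < P"
  shows "(\<lambda>x. c * f x) \<in> schwartz_closure P"
  unfolding schwartz_closure_def
proof (safe)
  have [measurable]: "f \<in> borel_measurable borel"
    using schwartz_closureD(1)[OF f] by auto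
  show "(\<lambda>x. c * f x) \<in> borel_measurable borel" by measurable
  fix e :: real assume e: "0 < e"
  define K where "K = norm c powr P + 1"
  have K: "0 < K" by (simp add: K_def add_nonneg_pos)
  obtain u where u: "schwartz u" "(\<integral>\<^sup>+x. ennreal (norm (u x - f x) powr P) \<partial>lborel) < ennreal (e / (2 * K))"
    using schwartz_closureD(2)[OF f, of "e / (2 * K)"] e K by auto
  have [measurable]: "u \<in> borel_measurable borel" using u schwartz_borel_measurable by auto
  have "(\<integral>\<^sup>+x. ennreal (norm (c * u x - c * f x) powr P) \<partial>lborel) = (\<integral>\<^sup>+x. ennreal (norm c powr P) * ennreal (norm (u x - f x) powr P) \<partial>lborel)"
    by (simp add: right_diff_distrib[symmetric] norm_mult powr_mult ennreal_mult'[symmetric])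
  also have "\<dots> = ennreal (norm c powr P) * (\<integral>\<^sup>+x. ennreal (norm (u x - f x) powr P) \<partial>lborel)"
    by (rule nn_integral_cmult) measurable
  also have "\<dots> \<le> ennreal K * ((\<integral>\<^sup>+x. ennreal (norm (u x - f x) powr P) \<partial>lborel) + 0)"
    unfolding add_0_right by (intro mult_right_mono ennreal_leI) (auto simp: K_def)
  also have "\<dots> < ennreal e"
    by (rule ennreal_split_less) (use u e K in auto)
  finally show "\<exists>u. schwartz u \<and> (\<integral>\<^sup>+x. ennreal (norm (u x - c * f x) powr P) \<partial>lborel) < ennreal e"
    using schwartz_cmult[OF u(1)] by blast
qed

lemma schwartz_closure_sum:
  assumes "\<And>i. i \<in> I \<Longrightarrow> f i \<in> schwartz_closure P" and P: "0 < P" and "finite I"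
  shows "(\<lambda>x. \<Sum>i\<in>I. f i x) \<in> schwartz_closure P"
  using assms(3,1)
proof (induction I)
  case empty
  then show ?case using schwartz_closure_schwartz[OF schwartz_zero] by simp
next
  case (insert i I)
  have "(\<lambda>x. f i x + (\<Sum>i\<in>I. f i x)) \<in> schwartz_closure P"
    by (rule schwartz_closure_add[OF _ _ P]) (use insert in auto)
  then show ?case using insert.hyps by simp
qed

text \<open>On the faces of a box the bumps do not converge to its indicator, as a one-dimensional
  bump always equals \<open>exp (- 1)\<close> at its endpoints. The faces lie in such
  hyperplanes.\<close>

lemma AE_lborel_inner_neq:
  fixes b :: "'a::euclidean_space"
  assumes "b \<in> Basis"
  shows "AE x in lborel. x \<bullet> b \<noteq> k"
proof -
  have "negligible {x. x \<bullet> b = k}" by (rule negligible_standard_hyperplane[OF assms])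
  then have "{x. x \<bullet> b = k} \<in> null_sets lebesgue" by (simp add: negligible_iff_null_sets)
  moreover have "{x. x \<bullet> b = k} \<in> sets lborel" by simp
  ultimately have "{x. x \<bullet> b = k} \<in> null_sets lborel"
    using null_sets_completion_iff by blast
  then show ?thesis by (rule AE_I') auto
qed

text \<open>A Gaussian majorant independent of \<open>n\<close>, needed for dominated convergence.
  For y = (t - c) / \<rho> it amounts to \<open>y\<^sup>2 - 1 \<le> y ^ (2 * n)\<close>.\<close>

lemma bump_le:
  assumes "1 \<le> n"
  shows "bump n c \<rho> t \<le> exp 1 * exp (- (((t - c) / \<rho>)\<^sup>2))"
proof -
  define y where "y = (t - c) / \<rho>"
  have "y\<^sup>2 - 1 \<le> y ^ (2 * n)"
  proof (cases "y\<^sup>2 \<le> 1")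
    case False
    then have "(y\<^sup>2) ^ 1 \<le> (y\<^sup>2) ^ n" using assms by (intro power_increasing) auto
    then show ?thesis by (simp add: power_mult)
  next
    case True
    moreover have "0 \<le> y ^ (2 * n)" by (simp add: power_mult)
    ultimately show ?thesis by linarith
  qed
  then show ?thesis by (simp add: bump_def y_def[symmetric] exp_add[symmetric])
qed

lemma bump_tendsto:
  assumes "\<bar>(t - c) / \<rho>\<bar> \<noteq> 1"
  shows "(\<lambda>n. bump (Suc n) c \<rho> t) \<longlonglongrightarrow> (if \<bar>(t - c) / \<rho>\<bar> < 1 then 1 else 0)"
proof -
  define y where "y = (t - c) / \<rho>"
  have e: "y ^ (2 * Suc n) = (y\<^sup>2) ^ Suc n" for n by (simp only: power_mult)
  show ?thesis
  proof (cases "\<bar>y\<bar> < 1")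
    case True
    then have "y\<^sup>2 < 1" by (simp add: abs_square_less_1)
    then have "(\<lambda>n. (y\<^sup>2) ^ Suc n) \<longlonglongrightarrow> 0" by (intro LIMSEQ_Suc LIMSEQ_power_zero) simp
    then have "(\<lambda>n. exp (- ((y\<^sup>2) ^ Suc n))) \<longlonglongrightarrow> exp (- 0)" by (intro tendsto_intros)
    then show ?thesis using True by (simp only: bump_def y_def[symmetric] e) simp
  next
    case False
    then have "1 < \<bar>y\<bar>" using assms unfolding y_def[symmetric] by linarith
    then have "1 < y\<^sup>2" by (simp add: one_less_power power2_eq_square abs_square_less_1 flip: power2_abs)
      (metis \<open>1 < \<bar>y\<bar>\<close> abs_mult_self_eq less_1_mult)
    moreover have "filterlim (\<lambda>n. z ^ n) at_top sequentially" if "1 < z" for z :: real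
      by (intro filterlim_at_infinity_imp_filterlim_at_top filterlim_realpow_sequentially_gt1)
        (use that in \<open>auto intro!: always_eventually\<close>)
    ultimately have "filterlim (\<lambda>n. (y\<^sup>2) ^ n) at_top sequentially" by blast
    then have "filterlim (\<lambda>n. (y\<^sup>2) ^ Suc n) at_top sequentially" by (simp only: filterlim_sequentially_Suc)
    then have "filterlim (\<lambda>n. - ((y\<^sup>2) ^ Suc n)) at_bot sequentially" by (simp only: filterlim_uminus_at_bot minus_minus)
    then have "(\<lambda>n. exp (- ((y\<^sup>2) ^ Suc n))) \<longlonglongrightarrow> 0" by (rule filterlim_compose[OF exp_at_bot])
    then show ?thesis using False by (simp only: bump_def y_def[symmetric] e) simp
  qed
qed

lemma integrable_gaussian:
  fixes k c :: real
  assumes k: "0 < k"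
  shows "integrable lborel (\<lambda>t. exp (- (k * (t - c)\<^sup>2)))"
proof -
  define \<sigma> where "\<sigma> = sqrt (1 / (2 * k))"
  have \<sigma>: "0 < \<sigma>" "\<sigma>\<^sup>2 = 1 / (2 * k)" using k by (auto simp: \<sigma>_def)
  have "integrable lborel (\<lambda>t. sqrt (2 * pi * \<sigma>\<^sup>2) * normal_density c \<sigma> t)"
    using integrable_normal_density[OF \<sigma>(1)] by simp
  also have "(\<lambda>t. sqrt (2 * pi * \<sigma>\<^sup>2) * normal_density c \<sigma> t) = (\<lambda>t. exp (- (k * (t - c)\<^sup>2)))"
    using k \<sigma>(1) by (auto simp: fun_eq_iff normal_density_def \<sigma>(2))
  finally show ?thesis .
qed

text \<open>Tensor products of bumps fitted to the sides converge to the indicator off the faces of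
  the box, and one Gaussian product \<open>w\<close> dominates all of them as well as the
  indicator.\<close>

lemma schwartz_closure_box:
  fixes a b :: "'a::euclidean_space"
  assumes P: "0 < P"
  shows "(\<lambda>x. complex_of_real (indicator (box a b) x)) \<in> schwartz_closure P"
proof (cases "box a b = {}")
  case True
  then show ?thesis using schwartz_closure_schwartz[OF schwartz_zero] by simp
next
  case False
  then have ab: "a \<bullet> i < b \<bullet> i" if "i \<in> Basis" for i using that by (auto simp: box_ne_empty)
  define c where "c i = (a \<bullet> i + b \<bullet> i) / 2" for i
  define \<rho> where "\<rho> i = (b \<bullet> i - a \<bullet> i) / 2" for i
  have \<rho>: "0 < \<rho> i" if "i \<in> Basis" for i using ab[OF that] by (simp add: \<rho>_def)
  define y where "y x i = (x \<bullet> i - c i) / \<rho> i" for x i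
  have y_lt: "\<bar>y x i\<bar> < 1 \<longleftrightarrow> a \<bullet> i < x \<bullet> i \<and> x \<bullet> i < b \<bullet> i" if "i \<in> Basis" for x i
  proof -
    have "\<bar>y x i\<bar> < 1 \<longleftrightarrow> \<bar>x \<bullet> i - c i\<bar> < \<rho> i" using \<rho>[OF that] by (simp add: y_def field_simps)
    then show ?thesis by (auto simp: c_def \<rho>_def abs_less_iff field_simps)
  qed
  have y_eq: "\<bar>y x i\<bar> = 1 \<longleftrightarrow> x \<bullet> i = a \<bullet> i \<or> x \<bullet> i = b \<bullet> i" if "i \<in> Basis" for x i
  proof -
    have "\<bar>y x i\<bar> = 1 \<longleftrightarrow> \<bar>x \<bullet> i - c i\<bar> = \<rho> i" using \<rho>[OF that] by (auto simp: y_def field_simps)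
    then show ?thesis using ab[OF that] by (auto simp: c_def \<rho>_def abs_if field_simps)
  qed
  define u where "u n x = complex_of_real (\<Prod>i\<in>Basis. bump (Suc n) (c i) (\<rho> i) (x \<bullet> i))" for n x
  define w where "w x = (\<Prod>i\<in>Basis. exp 1 * exp (- ((y x i)\<^sup>2)))" for x
  have us: "schwartz (u n)" for n unfolding u_def by (rule schwartz_bump_tensor) (auto simp: \<rho>)
  show ?thesis
  proof (rule schwartz_closure_limit[OF _ P])
    show "(\<lambda>x. complex_of_real (indicator (box a b) x)) \<in> borel_measurable borel" by measurable
    show "u n \<in> schwartz_closure P" for n by (rule schwartz_closure_schwartz[OF us])
    show "(\<lambda>n. \<integral>\<^sup>+x. ennreal (norm (u n x - complex_of_real (indicator (box a b) x)) powr P) \<partial>lborel) \<longlonglongrightarrow> 0"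
    proof (rule Lp_dominated_convergence[of _ _ _ w, OF _ _ _ _ _ _ P])
      show "u n \<in> borel_measurable lborel" for n using schwartz_borel_measurable[OF us] by simp
      show "(\<lambda>x. complex_of_real (indicator (box a b) x)) \<in> borel_measurable lborel" by measurable
      show "w \<in> borel_measurable lborel" unfolding w_def y_def by measurable
      show "norm (u n x) \<le> w x" for n x
      proof -
        have "norm (u n x) = (\<Prod>i\<in>Basis. bump (Suc n) (c i) (\<rho> i) (x \<bullet> i))"
          unfolding u_def norm_of_real by (intro abs_of_nonneg prod_nonneg) (auto simp: bump_def)
        also have "\<dots> \<le> w x" unfolding w_def y_def
          by (intro prod_mono conjI bump_le) (auto simp: bump_def)
        finally show ?thesis .
      qed
      show "norm (complex_of_real (indicator (box a b) x)) \<le> w x" for x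
      proof (cases "x \<in> box a b")
        case True
        have "1 = (\<Prod>i\<in>(Basis::'a set). 1::real)" by simp
        also have "\<dots> \<le> w x" unfolding w_def
        proof (intro prod_mono conjI)
          fix i :: 'a assume i: "i \<in> Basis"
          have "\<bar>y x i\<bar> \<le> 1" using y_lt[OF i, of x] True i by (auto simp: mem_box)
          then have "(y x i)\<^sup>2 \<le> 1" by (simp add: abs_square_le_1)
          then show "1 \<le> exp 1 * exp (- ((y x i)\<^sup>2))" by (simp add: exp_add[symmetric])
        qed auto
        finally show ?thesis using True by simp
      qed (auto simp: w_def intro!: prod_nonneg)
      show "(\<integral>\<^sup>+x. ennreal (w x powr P) \<partial>lborel) < \<infinity>"
      proof -
        have int: "integrable lborel (\<lambda>x::'a. \<Prod>i\<in>Basis. exp P * exp (- ((P / (\<rho> i)\<^sup>2) * (x \<bullet> i - c i)\<^sup>2)))"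
        proof (rule lborel_integral_tensor(2)[of "\<lambda>i t. exp P * exp (- ((P / (\<rho> i)\<^sup>2) * (t - c i)\<^sup>2))"])
          fix i :: 'a assume "i \<in> Basis"
          then have "0 < P / (\<rho> i)\<^sup>2" using P \<rho>[of i] by simp
          then show "integrable lborel (\<lambda>t. exp P * exp (- ((P / (\<rho> i)\<^sup>2) * (t - c i)\<^sup>2)))"
            by (intro integrable_mult_right integrable_gaussian)
        qed
        have "w x powr P = (\<Prod>i\<in>Basis. exp P * exp (- ((P / (\<rho> i)\<^sup>2) * (x \<bullet> i - c i)\<^sup>2)))" for x
        proof -
          have "w x powr P = (\<Prod>i\<in>Basis. (exp 1 * exp (- ((y x i)\<^sup>2))) powr P)"
            unfolding w_def by (rule prod_powr_distrib)
          also have "\<dots> = (\<Prod>i\<in>Basis. exp P * exp (- ((P / (\<rho> i)\<^sup>2) * (x \<bullet> i - c i)\<^sup>2)))"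
            by (intro prod.cong refl) (simp add: exp_add[symmetric] exp_powr_real y_def power_divide algebra_simps)
          finally show ?thesis .
        qed
        then have "integrable lborel (\<lambda>x. w x powr P)" using int by simp
        from integrableD(2)[OF this] show ?thesis by (simp add: top.not_eq_extremum less_top)
      qed
      show "AE x in lborel. (\<lambda>n. u n x) \<longlonglongrightarrow> complex_of_real (indicator (box a b) x)"
      proof -
        have "AE x in lborel. \<forall>i\<in>Basis. x \<bullet> i \<noteq> a \<bullet> i \<and> x \<bullet> i \<noteq> b \<bullet> i"
          by (intro AE_finite_allI AE_conjI AE_lborel_inner_neq) auto
        then show ?thesis
        proof eventually_elim
          fix x :: 'a assume x: "\<forall>i\<in>Basis. x \<bullet> i \<noteq> a \<bullet> i \<and> x \<bullet> i \<noteq> b \<bullet> i"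
          have "(\<lambda>n. \<Prod>i\<in>Basis. bump (Suc n) (c i) (\<rho> i) (x \<bullet> i)) \<longlonglongrightarrow> (\<Prod>i\<in>Basis. if \<bar>y x i\<bar> < 1 then 1 else 0)"
            unfolding y_def by (intro tendsto_prod bump_tendsto) (use x y_eq y_def in auto)
          also have "(\<Prod>i\<in>Basis. if \<bar>y x i\<bar> < 1 then 1 else 0) = (indicator (box a b) x :: real)"
          proof (cases "x \<in> box a b")
            case True
            then show ?thesis using y_lt by (auto simp: mem_box)
          next
            case False
            then obtain i where "i \<in> Basis" "\<not> (a \<bullet> i < x \<bullet> i \<and> x \<bullet> i < b \<bullet> i)" by (auto simp: mem_box)
            then show ?thesis using y_lt[of i x] False by (auto intro!: prod_zero bexI[of _ i])
          qed
          finally show "(\<lambda>n. u n x) \<longlonglongrightarrow> complex_of_real (indicator (box a b) x)"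
            unfolding u_def by (rule tendsto_of_real)
        qed
      qed
    qed
  qed
qed

text \<open>A Dynkin class argument starting from boxes, which are stable under intersection.
  Intersecting with a fixed bounded box keeps all sets of finite measure, so that complements become
  differences inside that box and disjoint unions converge in L^P by domination.\<close>

lemma schwartz_closure_indicator:
  fixes A :: "'a::euclidean_space set"
  assumes P: "0 < P" and A: "A \<in> sets borel"
  shows "(\<lambda>x. complex_of_real (indicator (A \<inter> box c d) x)) \<in> schwartz_closure P"
proof -
  define G where "G = range (\<lambda>(a, b). box a b :: 'a set)"
  have G: "sets (borel :: 'a measure) = sigma_sets UNIV G"
    unfolding G_def by (subst borel_eq_box) (simp add: sets_measure_of)
  have IG: "Int_stable G"
    unfolding G_def Int_stable_def by (auto simp: box_Int_box)
  have "G \<subseteq> Pow UNIV" "A \<in> sigma_sets UNIV G" using A G by auto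
  with IG show ?thesis
  proof (induction A rule: sigma_sets_induct_disjoint)
    case (basic A)
    then obtain a b where "A = box a b" by (auto simp: G_def)
    then have "\<exists>a' b'. A \<inter> box c d = box a' b'" by (auto simp: box_Int_box)
    then show ?case using schwartz_closure_box[OF P] by metis
  next
    case empty
    then show ?case using schwartz_closure_schwartz[OF schwartz_zero] by simp
  next
    case (compl A)
    have "(\<lambda>x. complex_of_real (indicator (box c d) x) + (-1) * complex_of_real (indicator (A \<inter> box c d) x)) \<in> schwartz_closure P"
      by (intro schwartz_closure_add schwartz_closure_cmult schwartz_closure_box compl P)
    also have "(\<lambda>x. complex_of_real (indicator (box c d) x) + (-1) * complex_of_real (indicator (A \<inter> box c d) x))
       = (\<lambda>x. complex_of_real (indicator ((UNIV - A) \<inter> box c d) x))"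
      by (auto simp: fun_eq_iff split: split_indicator)
    finally show ?case .
  next
    case (union A)
    have Am: "A i \<in> sets borel" for i using union(2) G by auto
    have Um: "(\<Union>i. A i) \<in> sets borel" using Am by auto
    show ?case
    proof (rule schwartz_closure_limit[OF _ P])
      show "(\<lambda>x. complex_of_real (indicator ((\<Union>i. A i) \<inter> box c d) x)) \<in> borel_measurable borel"
        using Um by measurable
      show "(\<lambda>x. \<Sum>i<n. complex_of_real (indicator (A i \<inter> box c d) x)) \<in> schwartz_closure P" for n
        by (intro schwartz_closure_sum union P) auto
      have eq: "(\<Sum>i<n. complex_of_real (indicator (A i \<inter> box c d) x)) = complex_of_real (indicator ((\<Union>i<n. A i) \<inter> box c d) x)" for n x
      proof -
        have "(\<Sum>i<n. indicator (A i) x :: real) = indicator (\<Union>i<n. A i) x"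
          using union(1) by (intro indicator_UN_disjoint[symmetric]) (auto simp: disjoint_family_on_def)
        then show ?thesis
          by (simp add: indicator_inter_arith sum_distrib_right[symmetric] flip: of_real_sum of_real_mult)
      qed
      show "(\<lambda>n. \<integral>\<^sup>+x. ennreal (norm ((\<Sum>i<n. complex_of_real (indicator (A i \<inter> box c d) x)) - complex_of_real (indicator ((\<Union>i. A i) \<inter> box c d) x)) powr P) \<partial>lborel) \<longlonglongrightarrow> 0"
        unfolding eq
      proof (rule Lp_dominated_convergence[of _ _ _ "indicat_real (box c d)", OF _ _ _ _ _ _ P])
        show "(\<lambda>x. complex_of_real (indicator ((\<Union>i<n. A i) \<inter> box c d) x)) \<in> borel_measurable lborel" for n
          using Am by measurable
        show "(\<lambda>x. complex_of_real (indicator ((\<Union>i. A i) \<inter> box c d) x)) \<in> borel_measurable lborel"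
          using Um by measurable
        have "(\<integral>\<^sup>+x. ennreal (indicat_real (box c d) x powr P) \<partial>lborel) = (\<integral>\<^sup>+x. indicator (box c d) x \<partial>lborel)"
          using P by (intro nn_integral_cong) (auto split: split_indicator)
        also have "\<dots> < \<infinity>" using emeasure_bounded_finite[OF bounded_box, of c d] by simp
        finally show "(\<integral>\<^sup>+x. ennreal (indicat_real (box c d) x powr P) \<partial>lborel) < \<infinity>" .
        show "AE x in lborel. (\<lambda>n. complex_of_real (indicator ((\<Union>i<n. A i) \<inter> box c d) x)) \<longlonglongrightarrow> complex_of_real (indicator ((\<Union>i. A i) \<inter> box c d) x)"
        proof (rule AE_I2, rule tendsto_of_real)
          fix x
          show "(\<lambda>n. indicat_real ((\<Union>i<n. A i) \<inter> box c d) x) \<longlonglongrightarrow> indicator ((\<Union>i. A i) \<inter> box c d) x"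
          proof (cases "\<exists>i. x \<in> A i")
            case True
            then obtain i where i: "x \<in> A i" ..
            have "indicat_real ((\<Union>i<n. A i) \<inter> box c d) x = indicator ((\<Union>i. A i) \<inter> box c d) x" if "Suc i \<le> n" for n
              using i that by (auto simp: indicator_def)
            then show ?thesis
              by (intro tendsto_eventually) (auto simp: eventually_sequentially intro!: exI[of _ "Suc i"])
          qed (auto simp: indicator_def)
        qed
      qed (auto split: split_indicator)
    qed
  qed
qed

text \<open>Simple functions dominated by \<open>2 * norm (f x)\<close>, cut off to growing cubes,
  converge to \<open>f\<close> in L^P. Each is a finite combination of indicators of bounded Borel
  sets.\<close>

lemma Lp_space_subset_schwartz_closure:
  fixes f :: "'a::euclidean_space \<Rightarrow> complex"
  assumes P: "0 < P" and f[measurable]: "f \<in> borel_measurable borel"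
    and fin: "(\<integral>\<^sup>+x. ennreal (norm (f x) powr P) \<partial>lborel) < \<infinity>"
  shows "f \<in> schwartz_closure P"
proof -
  have f': "f \<in> borel_measurable lborel" by simp
  from borel_measurable_implies_sequence_metric[OF f', of 0] obtain F where
    F: "\<And>i. simple_function lborel (F i)" "\<And>x. (\<lambda>i. F i x) \<longlonglongrightarrow> f x" "\<And>i x. norm (F i x) \<le> 2 * norm (f x)"
    by auto
  define Q where "Q n = box (- (real n *\<^sub>R One)) (real n *\<^sub>R One :: 'a)" for n
  define g where "g n x = F n x * complex_of_real (indicator (Q n) x)" for n x
  have Fm[measurable]: "F n \<in> borel_measurable borel" for n using F(1)[of n] borel_measurable_simple_function by fastforce
  have "g n \<in> schwartz_closure P" for n
  proof -
    have fr: "finite (range (F n))" using F(1)[of n] by (auto simp: simple_function_def)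
    have "g n = (\<lambda>x. \<Sum>z\<in>range (F n). z * complex_of_real (indicator ((F n -` {z}) \<inter> Q n) x))"
    proof
      fix x
      have "(\<Sum>z\<in>range (F n). z * complex_of_real (indicator ((F n -` {z}) \<inter> Q n) x))
         = (\<Sum>z\<in>range (F n). if z = F n x then z * complex_of_real (indicator (Q n) x) else 0)"
        by (intro sum.cong refl) (auto split: split_indicator)
      also have "\<dots> = g n x" using fr by (simp add: g_def)
      finally show "g n x = (\<Sum>z\<in>range (F n). z * complex_of_real (indicator ((F n -` {z}) \<inter> Q n) x))" ..
    qed
    moreover have "F n -` {z} \<in> sets borel" for z
      using measurable_sets[OF Fm[of n], of "{z}"] by simp
    ultimately show ?thesis unfolding Q_def
      by (auto intro!: schwartz_closure_sum[OF _ P fr] schwartz_closure_cmult[OF _ P] schwartz_closure_indicator[OF P])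
  qed
  moreover have "(\<lambda>n. \<integral>\<^sup>+x. ennreal (norm (g n x - f x) powr P) \<partial>lborel) \<longlonglongrightarrow> 0"
  proof (rule Lp_dominated_convergence[of _ _ _ "\<lambda>x. 2 * norm (f x)", OF _ _ _ _ _ _ P])
    show "g n \<in> borel_measurable lborel" for n unfolding g_def Q_def by measurable
    show "norm (g n x) \<le> 2 * norm (f x)" for n x
      using F(3)[of n x] by (auto simp: g_def norm_mult split: split_indicator)
    have "(\<integral>\<^sup>+x. ennreal ((2 * norm (f x)) powr P) \<partial>lborel) = (\<integral>\<^sup>+x. ennreal (2 powr P) * ennreal (norm (f x) powr P) \<partial>lborel)"
      by (simp add: powr_mult ennreal_mult'[symmetric])
    also have "\<dots> = ennreal (2 powr P) * (\<integral>\<^sup>+x. ennreal (norm (f x) powr P) \<partial>lborel)"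
      by (rule nn_integral_cmult) measurable
    also have "\<dots> < \<infinity>" using fin by (simp add: ennreal_mult_less_top)
    finally show "(\<integral>\<^sup>+x. ennreal ((2 * norm (f x)) powr P) \<partial>lborel) < \<infinity>" .
    show "AE x in lborel. (\<lambda>n. g n x) \<longlonglongrightarrow> f x"
    proof (rule AE_I2)
      fix x :: 'a
      obtain N :: nat where N: "norm x < real N" using reals_Archimedean2 by blast
      have "x \<in> Q n" if "N \<le> n" for n
      proof -
        have "- real n < x \<bullet> i \<and> x \<bullet> i < real n" if "i \<in> Basis" for i
          using Basis_le_norm[OF that, of x] N \<open>N \<le> n\<close> by linarith
        then show ?thesis by (auto simp: Q_def mem_box)
      qed
      then have "\<forall>\<^sub>F n in sequentially. F n x = g n x"
        by (auto simp: eventually_sequentially g_def intro!: exI[of _ N])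
      then show "(\<lambda>n. g n x) \<longlonglongrightarrow> f x" using F(2)[of x] by (rule Lim_transform_eventually[rotated])
    qed
  qed (use f in auto)
  ultimately show ?thesis by (rule schwartz_closure_limit[OF f P])
qed

section \<open>Extension and restriction estimates\<close>

text \<open>The estimates are proved for positive real bounds \<open>N\<close> on a norm. Adding a
  small slack recovers the norm itself even when it vanishes, and an infinite norm makes the claim
  trivial.\<close>

lemma ennreal_le_cmultI:
  fixes X Y :: ennreal
  assumes c: "0 < c" and le: "\<And>N. 0 < N \<Longrightarrow> X \<le> ennreal N \<Longrightarrow> Y \<le> ennreal (c * N)"
  shows "Y \<le> ennreal c * X"
proof (cases X)
  case (real x)
  have "Y \<le> ennreal (c * x)"
  proof (rule ennreal_le_epsilon)
    fix e :: real assume e: "0 < e"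
    have "0 < x + e / c" using real(1) e c by (simp add: add_nonneg_pos)
    moreover have "X \<le> ennreal (x + e / c)" unfolding real(2) using e c by (intro ennreal_leI) simp
    ultimately have "Y \<le> ennreal (c * (x + e / c))" by (rule le)
    also have "c * (x + e / c) = c * x + e" using c by (simp add: distrib_left)
    also have "ennreal \<dots> = ennreal (c * x) + ennreal e"
      using real(1) c e by (intro ennreal_plus) auto
    finally show "Y \<le> ennreal (c * x) + ennreal e" .
  qed
  also have "\<dots> = ennreal c * X" unfolding real(2) using c by (intro ennreal_mult') simp
  finally show ?thesis .
next
  case top
  have "ennreal c * X = top" unfolding top using c by (simp only: ennreal_mult_top) simp
  then show ?thesis by simp
qed

text \<open>A quasi-triangle inequality, sufficient for limits and for unspecified constants. One
  factor 2 comes from \<open>norm_add_powr_le\<close>, the other from bounding the number 2 of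
  summands by \<open>2 powr P\<close>, which uses \<open>P \<ge> 1\<close>.\<close>

lemma Lp_norm_add_le:
  assumes f: "f \<in> borel_measurable M" and g: "g \<in> borel_measurable M" and P: "1 \<le> P"
  shows "Lp_norm (ennreal P) M (\<lambda>x. f x + g x) \<le> 4 * (Lp_norm (ennreal P) M f + Lp_norm (ennreal P) M g)"
proof (cases "Lp_norm (ennreal P) M f + Lp_norm (ennreal P) M g = top")
  case True
  then show ?thesis by (simp only: ennreal_mult_top) simp
next
  case False
  then have ntop: "Lp_norm (ennreal P) M f \<noteq> top" "Lp_norm (ennreal P) M g \<noteq> top" by auto
  obtain a where a: "Lp_norm (ennreal P) M f = ennreal a" "0 \<le> a"
    using ntop(1) by (cases "Lp_norm (ennreal P) M f") auto
  obtain b where b: "Lp_norm (ennreal P) M g = ennreal b" "0 \<le> b"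
    using ntop(2) by (cases "Lp_norm (ennreal P) M g") auto
  have P0: "0 < P" using P by simp
  have fa: "(\<integral>\<^sup>+x. ennreal (norm (f x) powr P) \<partial>M) \<le> ennreal (a powr P)"
    using Lp_norm_le_iff[OF P0 a(2), of M f] a by simp
  have gb: "(\<integral>\<^sup>+x. ennreal (norm (g x) powr P) \<partial>M) \<le> ennreal (b powr P)"
    using Lp_norm_le_iff[OF P0 b(2), of M g] b by simp
  have "(\<integral>\<^sup>+x. ennreal (norm (f x + g x) powr P) \<partial>M)
     \<le> ennreal (2 powr P) * ((\<integral>\<^sup>+x. ennreal (norm (f x) powr P) \<partial>M) + (\<integral>\<^sup>+x. ennreal (norm (g x) powr P) \<partial>M))"
    by (rule nn_integral_norm_add_powr_le[OF f g P0])
  also have "\<dots> \<le> ennreal (2 powr P) * (ennreal (a powr P) + ennreal (b powr P))"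
    by (intro mult_left_mono add_mono fa gb) simp
  also have "\<dots> = ennreal (2 powr P * (a powr P + b powr P))" by (simp add: ennreal_mult')
  also have "\<dots> \<le> ennreal ((4 * (a + b)) powr P)"
  proof (rule ennreal_leI)
    have "a powr P \<le> (a + b) powr P" "b powr P \<le> (a + b) powr P" using a b P0 by (auto intro!: powr_mono2)
    then have "2 powr P * (a powr P + b powr P) \<le> 2 powr P * (2 * (a + b) powr P)" by (intro mult_left_mono) auto
    also have "\<dots> \<le> 2 powr P * (2 powr P * (a + b) powr P)"
      using powr_mono[of 1 P 2] P by (intro mult_left_mono mult_right_mono) auto
    also have "\<dots> = (4 * (a + b)) powr P" by (simp add: powr_mult[symmetric] mult.assoc[symmetric])
    finally show "2 powr P * (a powr P + b powr P) \<le> (4 * (a + b)) powr P" .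
  qed
  finally have "Lp_norm (ennreal P) M (\<lambda>x. f x + g x) \<le> ennreal (4 * (a + b))"
    using a b by (subst Lp_norm_le_iff[OF P0]) auto
  also have "\<dots> = ennreal 4 * ennreal (a + b)" by (rule ennreal_mult') simp
  also have "ennreal (a + b) = Lp_norm (ennreal P) M f + Lp_norm (ennreal P) M g"
    unfolding a(1) b(1) by (rule ennreal_plus[OF a(2) b(2)])
  also have "ennreal 4 = 4" by (rule ennreal_numeral)
  finally show ?thesis .
qed

lemma Lp_norm_minus_commute: "Lp_norm p M (\<lambda>x. f x - g x) = Lp_norm p M (\<lambda>x. g x - f x)"
  by (simp add: Lp_norm_def norm_minus_commute)

lemma Lp_norm_triangle3:
  assumes f: "f \<in> borel_measurable M" and g: "g \<in> borel_measurable M" and h: "h \<in> borel_measurable M" and P: "1 \<le> P"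
  shows "Lp_norm (ennreal P) M (\<lambda>x. f x - h x) \<le> 4 * (Lp_norm (ennreal P) M (\<lambda>x. f x - g x) + Lp_norm (ennreal P) M (\<lambda>x. g x - h x))"
  using Lp_norm_add_le[of "\<lambda>x. f x - g x" M "\<lambda>x. g x - h x" P] f g h P by simp

lemma Lp_norm_tendsto_0:
  assumes P: "0 < P" and lim: "(\<lambda>n. \<integral>\<^sup>+x. ennreal (norm (f n x) powr P) \<partial>M) \<longlonglongrightarrow> 0"
  shows "(\<lambda>n. Lp_norm (ennreal P) M (f n)) \<longlonglongrightarrow> 0"
proof (rule order_tendstoI)
  fix e :: ennreal assume e: "0 < e"
  obtain d where d: "0 < d" "ennreal d < e"
  proof (cases e)
    case (real r)
    then show thesis using e by (intro that[of "r / 2"]) (auto simp: ennreal_less_iff)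
  next
    case top
    then show thesis by (intro that[of 1]) auto
  qed
  have "\<forall>\<^sub>F n in sequentially. (\<integral>\<^sup>+x. ennreal (norm (f n x) powr P) \<partial>M) < ennreal (d powr P)"
    by (rule order_tendstoD(2)[OF lim]) (use d in simp)
  then show "\<forall>\<^sub>F n in sequentially. Lp_norm (ennreal P) M (f n) < e"
  proof eventually_elim
    fix n assume "(\<integral>\<^sup>+x. ennreal (norm (f n x) powr P) \<partial>M) < ennreal (d powr P)"
    then have "Lp_norm (ennreal P) M (f n) \<le> ennreal d"
      using d by (subst Lp_norm_le_iff[OF P]) auto
    then show "Lp_norm (ennreal P) M (f n) < e" using d by (rule_tac le_less_trans)
  qed
qed simp

lemma schwartz_approx_exists:
  fixes f :: "'a::euclidean_space \<Rightarrow> complex"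
  assumes P: "1 \<le> P" and f: "f \<in> Lp_space (ennreal P) lborel"
  shows "\<exists>u. schwartz_approx (ennreal P) f u"
proof -
  have P0: "0 < P" using P by simp
  have fm: "f \<in> borel_measurable borel" using f by (simp add: Lp_space_def)
  have "(\<integral>\<^sup>+x. ennreal (norm (f x) powr P) \<partial>lborel) < \<infinity>"
    using f Lp_norm_finite_iff[OF P0, of lborel f] by (simp add: Lp_space_def)
  then have fc: "f \<in> schwartz_closure P" by (rule Lp_space_subset_schwartz_closure[OF P0 fm])
  have ex: "\<exists>u. schwartz u \<and> (\<integral>\<^sup>+x. ennreal (norm (u x - f x) powr P) \<partial>lborel) < ennreal (1 / real (Suc n))" for n
    by (rule schwartz_closureD(2)[OF fc]) simp
  define u where "u n = (SOME u. schwartz u \<and> (\<integral>\<^sup>+x. ennreal (norm (u x - f x) powr P) \<partial>lborel) < ennreal (1 / real (Suc n)))" for n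
  have u: "schwartz (u n)" "(\<integral>\<^sup>+x. ennreal (norm (u n x - f x) powr P) \<partial>lborel) < ennreal (1 / real (Suc n))" for n
    unfolding u_def using someI_ex[OF ex[of n]] by blast+
  have "(\<lambda>n. \<integral>\<^sup>+x. ennreal (norm (u n x - f x) powr P) \<partial>lborel) \<longlonglongrightarrow> 0"
  proof (rule tendsto_sandwich[of "\<lambda>_. 0" _ _ "\<lambda>n. ennreal (1 / real (Suc n))"])
    have "(\<lambda>n. 1 / real (Suc n)) \<longlonglongrightarrow> 0" by (rule lim_1_over_n[THEN LIMSEQ_Suc])
    then show "(\<lambda>n. ennreal (1 / real (Suc n))) \<longlonglongrightarrow> 0" using tendsto_ennrealI by fastforce
  qed (use u(2) in \<open>auto intro!: always_eventually less_imp_le\<close>)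
  from Lp_norm_tendsto_0[OF P0 this] show ?thesis using u(1) by (auto simp: schwartz_approx_def)
qed

text \<open>The weight of degree \<open>2 * DIM('a)\<close> dominates the product of the factors 1 +
  x_b^2 over all coordinates, and the reciprocal of that product is integrable as a tensor
  product.\<close>

lemma schwartz_integrable:
  fixes f :: "'a::euclidean_space \<Rightarrow> complex"
  assumes f: "schwartz f"
  shows "integrable lborel f"
proof -
  let ?N = "2 * DIM('a)"
  obtain B where B: "\<And>x. norm ((1 + norm x) ^ ?N *\<^sub>R iterated_partial [] f x) \<le> B"
    using schwartzD(2)[OF f, of "[]" ?N] by (auto simp: bounded_iff)
  have 1: "integrable lborel (\<lambda>t::real. 1 / (1 + t\<^sup>2))"
  proof -
    have "set_integrable lborel (einterval (-\<infinity>) \<infinity>) (\<lambda>t::real. inverse (1 + t\<^sup>2))"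
      by (rule integrable_inverse_1_plus_square)
    then show ?thesis by (simp add: set_integrable_def einterval_eq inverse_eq_divide)
  qed
  have "integrable lborel (\<lambda>x::'a. \<Prod>b\<in>Basis. 1 / (1 + (x \<bullet> b)\<^sup>2))"
    by (rule lborel_integral_tensor(2)[of "\<lambda>_ t. 1 / (1 + t\<^sup>2)", OF 1])
  then have 2: "integrable lborel (\<lambda>x::'a. B * (\<Prod>b\<in>Basis. 1 / (1 + (x \<bullet> b)\<^sup>2)))" by simp
  show ?thesis
  proof (rule Bochner_Integration.integrable_bound[OF 2])
    show "f \<in> borel_measurable lborel" using schwartz_borel_measurable[OF f] by simp
    show "AE x in lborel. norm (f x) \<le> norm (B * (\<Prod>b\<in>Basis. 1 / (1 + (x \<bullet> b)\<^sup>2)))"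
    proof (rule AE_I2)
      fix x :: 'a
      have p: "0 < (\<Prod>b\<in>Basis. 1 + (x \<bullet> b)\<^sup>2)" by (intro prod_pos) (auto intro: add_pos_nonneg)
      have "(\<Prod>b\<in>Basis. 1 + (x \<bullet> b)\<^sup>2) \<le> (\<Prod>b\<in>(Basis::'a set). (1 + norm x)\<^sup>2)"
      proof (intro prod_mono conjI)
        fix b :: 'a assume b: "b \<in> Basis"
        have "(x \<bullet> b)\<^sup>2 \<le> (norm x)\<^sup>2" using Basis_le_norm[OF b, of x] by (metis abs_le_square_iff abs_norm_cancel)
        moreover have "(1 + norm x)\<^sup>2 = 1 + (norm x)\<^sup>2 + 2 * norm x" by (simp add: power2_sum)
        ultimately show "1 + (x \<bullet> b)\<^sup>2 \<le> (1 + norm x)\<^sup>2" using norm_ge_zero[of x] by linarith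
      qed auto
      also have "\<dots> = (1 + norm x) ^ ?N" by (simp add: power_mult)
      finally have "norm (f x) * (\<Prod>b\<in>Basis. 1 + (x \<bullet> b)\<^sup>2) \<le> norm (f x) * (1 + norm x) ^ ?N"
        by (intro mult_left_mono) auto
      also have "\<dots> \<le> B" using B[of x] by (simp add: mult.commute)
      finally have "norm (f x) \<le> B / (\<Prod>b\<in>Basis. 1 + (x \<bullet> b)\<^sup>2)" using p by (simp add: field_simps)
      also have "\<dots> = B * (\<Prod>b\<in>Basis. 1 / (1 + (x \<bullet> b)\<^sup>2))" by (simp add: prod_dividef)
      finally show "norm (f x) \<le> norm (B * (\<Prod>b\<in>Basis. 1 / (1 + (x \<bullet> b)\<^sup>2)))" by simp
    qed
  qed
qed

lemma fourier_diff:
  assumes f: "integrable lborel f" and g: "integrable lborel g"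
  shows "fourier lborel (\<lambda>x. f x - g x) \<xi> = fourier lborel f \<xi> - fourier lborel g \<xi>"
proof -
  have i: "integrable lborel (\<lambda>x. echar (\<xi> \<bullet> x) * h x)" if h: "integrable lborel h" for h
  proof (rule Bochner_Integration.integrable_bound[OF h])
    have [measurable]: "h \<in> borel_measurable borel" using h by auto
    show "(\<lambda>x. echar (\<xi> \<bullet> x) * h x) \<in> borel_measurable lborel" by measurable
  qed (simp add: norm_mult)
  show ?thesis unfolding fourier_eq_echar right_diff_distrib
    by (rule Bochner_Integration.integral_diff[OF i[OF f] i[OF g]])
qed

text \<open>The squared differences, weighted by \<open>2 ^ n\<close>, have summable integrals.
  Hence almost everywhere the differences are at most a constant times
  \<open>(1 / sqrt 2) ^ n\<close>, and the sequence converges pointwise. Fatou's lemma carries the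
  Cauchy rate over to the limit.\<close>

lemma L2_complete:
  fixes F :: "nat \<Rightarrow> 'a \<Rightarrow> complex"
  assumes F[measurable]: "\<And>n. F n \<in> borel_measurable M"
    and D: "\<And>n m. n \<le> m \<Longrightarrow> (\<integral>\<^sup>+x. ennreal ((norm (F m x - F n x))\<^sup>2) \<partial>M) \<le> ennreal (D * (1 / 4) ^ n)"
  obtains g where "g \<in> borel_measurable M" "\<And>n. (\<integral>\<^sup>+x. ennreal ((norm (F n x - g x))\<^sup>2) \<partial>M) \<le> ennreal (D * (1 / 4) ^ n)"
proof -
  define d where "d n x = F (Suc n) x - F n x" for n x
  define g where "g x = lim (\<lambda>n. F n x)" for x
  have gm: "g \<in> borel_measurable M" unfolding g_def by (rule borel_measurable_lim_metric) measurable
  have [measurable]: "d n \<in> borel_measurable M" for n unfolding d_def by measurable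
  have D': "ennreal (D * (1 / 4) ^ n) \<le> ennreal (\<bar>D\<bar> * (1 / 4) ^ n)" for n
    by (intro ennreal_leI mult_right_mono) auto
  have "(\<integral>\<^sup>+x. (\<Sum>n. ennreal (2 ^ n) * ennreal ((norm (d n x))\<^sup>2)) \<partial>M) = (\<Sum>n. \<integral>\<^sup>+x. ennreal (2 ^ n) * ennreal ((norm (d n x))\<^sup>2) \<partial>M)"
    by (rule nn_integral_suminf) measurable
  also have "\<dots> = (\<Sum>n. ennreal (2 ^ n) * (\<integral>\<^sup>+x. ennreal ((norm (d n x))\<^sup>2) \<partial>M))"
    by (intro suminf_cong nn_integral_cmult) measurable
  also have "\<dots> \<le> (\<Sum>n. ennreal (\<bar>D\<bar> * (1 / 2) ^ n))"
  proof (intro suminf_le)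
    fix n
    have "(\<integral>\<^sup>+x. ennreal ((norm (d n x))\<^sup>2) \<partial>M) \<le> ennreal (\<bar>D\<bar> * (1 / 4) ^ n)"
      using D[of n "Suc n"] D'[of n] unfolding d_def by (meson le_SucI order_refl order_trans)
    then have "ennreal (2 ^ n) * (\<integral>\<^sup>+x. ennreal ((norm (d n x))\<^sup>2) \<partial>M) \<le> ennreal (2 ^ n) * ennreal (\<bar>D\<bar> * (1 / 4) ^ n)"
      by (intro mult_left_mono) auto
    also have "\<dots> = ennreal (\<bar>D\<bar> * (2 ^ n * (1 / 4) ^ n))" by (simp add: ennreal_mult'[symmetric] mult_ac)
    also have "(2::real) ^ n * (1 / 4) ^ n = (1 / 2) ^ n" by (simp add: power_mult_distrib[symmetric])
    finally show "ennreal (2 ^ n) * (\<integral>\<^sup>+x. ennreal ((norm (d n x))\<^sup>2) \<partial>M) \<le> ennreal (\<bar>D\<bar> * (1 / 2) ^ n)" .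
  qed auto
  also have "\<dots> < \<infinity>"
  proof -
    have "summable (\<lambda>n. \<bar>D\<bar> * (1 / 2) ^ n)" by (intro summable_mult summable_geometric) simp
    then show ?thesis by (subst suminf_ennreal2) simp_all
  qed
  finally have fin: "(\<integral>\<^sup>+x. (\<Sum>n. ennreal (2 ^ n) * ennreal ((norm (d n x))\<^sup>2)) \<partial>M) < \<infinity>" .
  have mT: "(\<lambda>x. \<Sum>n. ennreal (2 ^ n) * ennreal ((norm (d n x))\<^sup>2)) \<in> borel_measurable M" by measurable
  have "AE x in M. (\<Sum>n. ennreal (2 ^ n) * ennreal ((norm (d n x))\<^sup>2)) \<noteq> \<infinity>"
    by (rule nn_integral_PInf_AE[OF mT less_imp_neq[OF fin]])
  then have conv: "AE x in M. (\<lambda>n. F n x) \<longlonglongrightarrow> g x"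
  proof eventually_elim
    fix x
    define T where "T = (\<Sum>n. ennreal (2 ^ n) * ennreal ((norm (d n x))\<^sup>2))"
    assume "(\<Sum>n. ennreal (2 ^ n) * ennreal ((norm (d n x))\<^sup>2)) \<noteq> \<infinity>"
    then have "T \<noteq> top" by (simp add: T_def)
    then obtain S where S: "0 \<le> S" "T = ennreal S" by (cases T) auto
    have b: "norm (d n x) \<le> sqrt S * (1 / sqrt 2) ^ n" for n
    proof -
      have "(\<Sum>n\<in>{n}. ennreal (2 ^ n) * ennreal ((norm (d n x))\<^sup>2)) \<le> ennreal S"
        unfolding S(2)[symmetric] T_def by (rule sum_le_suminf) simp_all
      then have "2 ^ n * (norm (d n x))\<^sup>2 \<le> S" using S(1) by (simp add: ennreal_mult'[symmetric] ennreal_le_iff)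
      then have "(norm (d n x))\<^sup>2 \<le> S / 2 ^ n" by (simp add: field_simps)
      then have "norm (d n x) \<le> sqrt (S / 2 ^ n)" by (rule real_le_rsqrt)
      then show ?thesis by (simp add: real_sqrt_divide real_sqrt_power power_one_over)
    qed
    have "summable (\<lambda>n. sqrt S * (1 / sqrt 2) ^ n)"
      by (intro summable_mult summable_geometric) simp
    then have "summable (\<lambda>n. d n x)" by (rule summable_comparison_test'[of _ 0]) (use b in auto)
    then have "convergent (\<lambda>n. \<Sum>i<n. d i x)" by (simp add: summable_iff_convergent)
    then have "convergent (\<lambda>n. (\<Sum>i<n. d i x) + F 0 x)" by (intro convergent_add convergent_const)
    moreover have "(\<Sum>i<n. d i x) + F 0 x = F n x" for n
      using sum_lessThan_telescope[of "\<lambda>i. F i x" n] unfolding d_def by (simp only: diff_add_cancel)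
    ultimately have "convergent (\<lambda>n. F n x)" by (simp only:)
    then show "(\<lambda>n. F n x) \<longlonglongrightarrow> g x" unfolding g_def convergent_LIMSEQ_iff .
  qed
  have "(\<integral>\<^sup>+x. ennreal ((norm (F n x - g x))\<^sup>2) \<partial>M) \<le> ennreal (D * (1 / 4) ^ n)" for n
  proof -
    have l: "AE x in M. (\<lambda>m. (norm (F m x - F n x))\<^sup>2) \<longlonglongrightarrow> (norm (g x - F n x))\<^sup>2"
      using conv by eventually_elim (intro tendsto_intros)
    have e: "\<forall>\<^sub>F m in sequentially. (\<integral>\<^sup>+x. ennreal ((norm (F m x - F n x))\<^sup>2) \<partial>M) \<le> ennreal (D * (1 / 4) ^ n)"
      using eventually_ge_at_top[of n] by eventually_elim (rule D)
    obtain h where h: "h \<in> borel_measurable M" "AE x in M. h x = ennreal ((norm (g x - F n x))\<^sup>2)" "(\<integral>\<^sup>+x. h x \<partial>M) \<le> ennreal (D * (1 / 4) ^ n)"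
      by (rule nn_integral_AE_limit_le[OF _ l e]) measurable
    have "(\<integral>\<^sup>+x. ennreal ((norm (F n x - g x))\<^sup>2) \<partial>M) = (\<integral>\<^sup>+x. h x \<partial>M)"
      using h(2) by (intro nn_integral_cong_AE) (auto simp: norm_minus_commute)
    then show ?thesis using h(3) by simp
  qed
  then show thesis using that gm by blast
qed

lemma Lp_norm_2_le_iff:
  assumes "0 \<le> c"
  shows "Lp_norm 2 M f \<le> ennreal c \<longleftrightarrow> (\<integral>\<^sup>+x. ennreal (norm (f x) powr 2) \<partial>M) \<le> ennreal (c powr 2)"
  using Lp_norm_le_iff[of 2 c M f] assms by simp

lemma extension_estimate_surface_measure:
  fixes w :: "real ^ 'k::finite \<Rightarrow> real"
  assumes w: "continuous_on (cbox 0 1) w" and A: "1 \<le> A" and b: "0 < b"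
    and decay: "\<And>\<xi> \<eta>. 1 \<le> \<bar>\<eta>\<bar> \<Longrightarrow> norm (fourier (surface_measure w) (\<lambda>_. 1) (\<xi>, \<eta>)) \<le> A * \<bar>\<eta>\<bar> powr (- b)"
    and q: "ennreal (2 + 2 / b) < q"
  shows "extension_estimate q (surface_measure w)"
proof (cases q)
  case (real Q)
  have Q: "2 + 2 / b < Q" using q unfolding real(2) by (rule ennreal_less_iff[THEN iffD1, rotated]) (use b in simp)
  then have Q0: "0 < Q" using b by (meson add_pos_pos divide_pos_pos order_less_trans zero_less_numeral)
  obtain c where c: "0 < c" "\<And>f N. f \<in> borel_measurable borel \<Longrightarrow> 0 < N \<Longrightarrow>
      (\<integral>\<^sup>+x. ennreal (norm (f x) powr 2) \<partial>surface_measure w) \<le> ennreal (N powr 2) \<Longrightarrow>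
      (\<integral>\<^sup>+\<xi>. ennreal (norm (fourier (surface_measure w) f \<xi>) powr Q) \<partial>lborel) \<le> ennreal ((c * N) powr Q)"
    using fourier_surface_strong_type[OF w A b decay Q] by blast
  show ?thesis
    unfolding extension_estimate_def
  proof (intro exI[of _ c] ballI ennreal_le_cmultI[OF c(1)])
    fix f N assume f: "f \<in> Lp_space 2 (surface_measure w)" and N: "0 < N" and fN: "Lp_norm 2 (surface_measure w) f \<le> ennreal N"
    have "f \<in> borel_measurable borel" using f by (simp add: Lp_space_def measurable_cong_sets[OF sets_surface_measure refl])
    from c(2)[OF this N] fN N have "(\<integral>\<^sup>+\<xi>. ennreal (norm (fourier (surface_measure w) f \<xi>) powr Q) \<partial>lborel) \<le> ennreal ((c * N) powr Q)"
      by (simp add: Lp_norm_2_le_iff)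
    then show "Lp_norm q lborel (fourier (surface_measure w) f) \<le> ennreal (c * N)"
      unfolding real(2) using c(1) N by (subst Lp_norm_le_iff[OF Q0]) auto
  qed
next
  \<comment> \<open>For the infinite exponent the pointwise bound by Cauchy-Schwarz already gives
    the constant 1.\<close>
  case top
  interpret \<mu>: prob_space "surface_measure w" by (rule prob_space_surface_measure[OF w])
  show ?thesis
    unfolding extension_estimate_def
  proof (intro exI[of _ 1] ballI ennreal_le_cmultI)
    fix f N assume f: "f \<in> Lp_space 2 (surface_measure w)" and N: "0 < N" and fN: "Lp_norm 2 (surface_measure w) f \<le> ennreal N"
    have fm: "f \<in> borel_measurable borel" using f by (simp add: Lp_space_def measurable_cong_sets[OF sets_surface_measure refl])
    have f2: "(\<integral>\<^sup>+x. ennreal (norm (f x) powr 2) \<partial>surface_measure w) \<le> ennreal (N powr 2)"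
      using fN N by (simp add: Lp_norm_2_le_iff)
    have [measurable]: "fourier (surface_measure w) f \<in> borel_measurable borel"
      by (rule borel_measurable_fourier) (use fm \<mu>.sigma_finite_measure_axioms in auto)
    have "esssup lborel (\<lambda>x. ennreal (norm (fourier (surface_measure w) f x))) \<le> ennreal N"
    proof (rule esssup_I)
      show "AE x in lborel. ennreal (norm (fourier (surface_measure w) f x)) \<le> ennreal N"
        by (intro AE_I2 ennreal_leI integrable_norm_fourier_surface_le(2)[OF w N fm f2])
    qed measurable
    then show "Lp_norm q lborel (fourier (surface_measure w) f) \<le> ennreal (1 * N)"
      by (simp add: Lp_norm_def top)
  qed simp
qed

text \<open>The endpoint \<open>P = 1\<close>, whose conjugate exponent is infinite: the transform
  is bounded by the L^1 norm, and \<mu> has total mass 1.\<close>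

lemma fourier_restriction_integrable_L1:
  fixes \<mu> :: "'a::euclidean_space measure"
  assumes "prob_space \<mu>" and f: "integrable lborel f" and N: "0 < N"
    and fN: "(\<integral>\<^sup>+x. ennreal (norm (f x) powr 1) \<partial>lborel) \<le> ennreal (N powr 1)"
  shows "Lp_norm 2 \<mu> (fourier lborel f) \<le> ennreal (1 * N)"
proof -
  interpret prob_space \<mu> by fact
  have "norm (fourier lborel f x) \<le> N" for x
  proof -
    have "ennreal (norm (fourier lborel f x)) \<le> ennreal N"
      unfolding fourier_eq_echar
      by (rule order_trans[OF norm_integral_le_nn_integral]) (use fN N in \<open>simp add: norm_mult\<close>)
    then show ?thesis using N by (simp add: ennreal_le_iff)
  qed
  then have "(\<integral>\<^sup>+x. ennreal (norm (fourier lborel f x) powr 2) \<partial>\<mu>) \<le> (\<integral>\<^sup>+x. ennreal (N powr 2) \<partial>\<mu>)"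
    by (intro nn_integral_mono ennreal_leI powr_mono2) auto
  also have "\<dots> = ennreal (N powr 2)" by (simp add: emeasure_space_1)
  finally show ?thesis using N by (simp add: Lp_norm_2_le_iff)
qed

text \<open>Duality: test the extension operator on the conjugate of the restricted transform.\<close>

lemma fourier_restriction_integrable_dual:
  fixes w :: "real ^ 'k::finite \<Rightarrow> real"
  assumes w: "continuous_on (cbox 0 1) w" and PQ: "1 < P" "1 < Q" "1 / P + 1 / Q = 1" and c: "0 < c"
    and ext: "\<And>f N. f \<in> borel_measurable borel \<Longrightarrow> 0 < N \<Longrightarrow>
      (\<integral>\<^sup>+x. ennreal (norm (f x) powr 2) \<partial>surface_measure w) \<le> ennreal (N powr 2) \<Longrightarrow>
      (\<integral>\<^sup>+\<xi>. ennreal (norm (fourier (surface_measure w) f \<xi>) powr Q) \<partial>lborel) \<le> ennreal ((c * N) powr Q)"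
    and f: "integrable lborel f" and N: "0 < N"
    and fN: "(\<integral>\<^sup>+x. ennreal (norm (f x) powr P) \<partial>lborel) \<le> ennreal (N powr P)"
  shows "Lp_norm 2 (surface_measure w) (fourier lborel f) \<le> ennreal (c * N)"
proof -
  let ?\<mu> = "surface_measure w"
  interpret \<mu>: prob_space ?\<mu> by (rule prob_space_surface_measure[OF w])
  have fm[measurable]: "f \<in> borel_measurable borel" using f by auto
  define F where "F = fourier lborel f"
  have Fm[measurable]: "F \<in> borel_measurable borel" unfolding F_def
    by (rule borel_measurable_fourier) (auto simp: sigma_finite_lborel)
  define B where "B = (LINT x|lborel. norm (f x))"
  have FB: "norm (F x) \<le> B" for x unfolding F_def B_def by (rule norm_fourier_le[OF f])
  \<comment> \<open>Integrability of \<open>f\<close> makes \<open>F\<close> bounded, so the norm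
    \<open>n2\<close> is finite and can be cancelled at the end.\<close>
  have F2i: "integrable ?\<mu> (\<lambda>x. (norm (F x))\<^sup>2)"
  proof (rule \<mu>.integrable_const_bound[of _ "B\<^sup>2"])
    show "AE x in ?\<mu>. norm ((norm (F x))\<^sup>2) \<le> B\<^sup>2" using FB by (intro AE_I2) (simp add: power_mono)
  qed measurable
  define n2 where "n2 = sqrt (LINT x|?\<mu>. (norm (F x))\<^sup>2)"
  have n20: "0 \<le> n2" by (simp add: n2_def)
  have n2: "(\<integral>\<^sup>+x. ennreal (norm (F x) powr 2) \<partial>?\<mu>) = ennreal (n2\<^sup>2)"
    unfolding n2_def using F2i by (simp add: nn_integral_eq_integral)
  have "n2 \<le> c * N"
  proof (cases "n2 = 0")
    case True then show ?thesis using c N by simp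
  next
    case False
    then have n2p: "0 < n2" using n20 by simp
    define G where "G x = cnj (F x)" for x
    have Gm[measurable]: "G \<in> borel_measurable borel" unfolding G_def by measurable
    have G2: "(\<integral>\<^sup>+x. ennreal (norm (G x) powr 2) \<partial>?\<mu>) \<le> ennreal (n2 powr 2)"
      using n2 n2p by (simp add: G_def)
    have Gi: "integrable ?\<mu> G" by (rule integrable_norm_fourier_surface_le(1)[OF w n2p Gm G2])
    have Ghat: "fourier ?\<mu> G \<in> borel_measurable borel"
      by (rule borel_measurable_fourier) (use Gm \<mu>.sigma_finite_measure_axioms in auto)
    have "ennreal (n2\<^sup>2) = ennreal (norm (LINT x|?\<mu>. G x * F x))"
    proof -
      have "G x * F x = of_real ((norm (F x))\<^sup>2)" for x
        unfolding G_def complex_norm_square by (rule mult.commute)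
      then have "(LINT x|?\<mu>. G x * F x) = of_real (LINT x|?\<mu>. (norm (F x))\<^sup>2)" by (simp del: of_real_power)
      then show ?thesis by (simp add: n2_def)
    qed
    also have "(LINT x|?\<mu>. G x * F x) = (LINT \<xi>|lborel. fourier ?\<mu> G \<xi> * f \<xi>)"
      unfolding F_def by (rule fourier_duality[OF \<mu>.finite_measure_axioms _ Gi f, symmetric]) simp
    also have "ennreal (norm \<dots>) \<le> (\<integral>\<^sup>+\<xi>. ennreal (norm (f \<xi>) * norm (fourier ?\<mu> G \<xi>)) \<partial>lborel)"
      by (rule order_trans[OF norm_integral_le_nn_integral]) (simp add: norm_mult mult.commute)
    also have "\<dots> \<le> ennreal (N * (c * n2))"
      by (rule nn_integral_Holder[OF PQ N _ _ _ _ _ fN ext[OF Gm n2p G2]]) (use c n2p Ghat in auto)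
    finally have "n2\<^sup>2 \<le> N * (c * n2)" using N c n2p by (simp add: ennreal_le_iff)
    then have "n2 * n2 \<le> n2 * (c * N)" by (simp add: power2_eq_square mult_ac)
    then show ?thesis using n2p by (simp only: mult_le_cancel_left_pos)
  qed
  then have "n2\<^sup>2 \<le> (c * N)\<^sup>2" using n20 by (rule power_mono)
  then have "ennreal (n2\<^sup>2) \<le> ennreal ((c * N)\<^sup>2)" by (rule ennreal_leI)
  then show ?thesis using c N n2 by (simp add: Lp_norm_2_le_iff F_def)
qed

text \<open>Extension by density. Transforms along a fast subsequence of Schwartz approximations are
  Cauchy in L^2(\<mu>), and their limit is the restriction. The constant 16 stems from two uses of
  the quasi-triangle inequality with constant 4.\<close>

lemma restriction_estimate_of_integrable:
  fixes \<mu> :: "'a::euclidean_space measure"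
  assumes s\<mu>[measurable_cong]: "sets \<mu> = sets borel" and P: "1 \<le> P" and c0: "0 < c0"
    and R: "\<And>f N. integrable lborel f \<Longrightarrow> 0 < N \<Longrightarrow> (\<integral>\<^sup>+x. ennreal (norm (f x) powr P) \<partial>lborel) \<le> ennreal (N powr P) \<Longrightarrow>
        Lp_norm 2 \<mu> (fourier lborel f) \<le> ennreal (c0 * N)"
  shows "restriction_estimate (ennreal P) \<mu>"
proof -
  have P0: "0 < P" using P by simp
  let ?L = "Lp_norm (ennreal P) lborel"
  let ?M = "Lp_norm 2 \<mu>"
  have R': "?M (fourier lborel f) \<le> ennreal c0 * ?L f" if f: "integrable lborel f" for f
  proof (rule ennreal_le_cmultI[OF c0])
    fix N :: real assume "0 < N" "?L f \<le> ennreal N"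
    then show "?M (fourier lborel f) \<le> ennreal (c0 * N)"
      using R[OF f] by (simp add: Lp_norm_le_iff[OF P0])
  qed
  have fm: "fourier lborel f \<in> borel_measurable \<mu>" if "f \<in> borel_measurable borel" for f :: "'a \<Rightarrow> complex"
  proof -
    have "fourier lborel f \<in> borel_measurable borel"
      by (rule borel_measurable_fourier) (use that in \<open>auto simp: sigma_finite_lborel\<close>)
    then show ?thesis by (simp cong: measurable_cong_sets add: s\<mu>)
  qed
  have tri: "?M (\<lambda>x. f x - h x) \<le> 4 * (?M (\<lambda>x. f x - g x) + ?M (\<lambda>x. g x - h x))"
    if "f \<in> borel_measurable \<mu>" "g \<in> borel_measurable \<mu>" "h \<in> borel_measurable \<mu>" for f g h
    using Lp_norm_triangle3[OF that, of 2] by simp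
  have diff: "?M (\<lambda>x. fourier lborel u x - fourier lborel v x) \<le> ennreal c0 * (4 * (?L (\<lambda>x. u x - f x) + ?L (\<lambda>x. v x - f x)))"
    if u: "schwartz u" and v: "schwartz v" and f: "f \<in> borel_measurable borel" for u v f
  proof -
    have iu: "integrable lborel u" and iv: "integrable lborel v" using u v by (auto intro: schwartz_integrable)
    have "?M (\<lambda>x. fourier lborel u x - fourier lborel v x) = ?M (fourier lborel (\<lambda>x. u x - v x))"
      by (simp only: fourier_diff[OF iu iv, symmetric])
    also have "\<dots> \<le> ennreal c0 * ?L (\<lambda>x. u x - v x)" by (rule R') (use iu iv in auto)
    also have "\<dots> \<le> ennreal c0 * (4 * (?L (\<lambda>x. u x - f x) + ?L (\<lambda>x. f x - v x)))"
      by (intro mult_left_mono Lp_norm_triangle3 P) (use u v f schwartz_borel_measurable in auto)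
    finally show ?thesis by (simp only: Lp_norm_minus_commute[of _ _ f v])
  qed
  have main: "\<exists>g. fourier_restriction (ennreal P) \<mu> f g \<and> ?M g \<le> ennreal (16 * c0) * ?L f"
    if f: "f \<in> Lp_space (ennreal P) lborel" for f
  proof -
    have fb: "f \<in> borel_measurable borel" and fL: "?L f < \<infinity>" using f by (auto simp: Lp_space_def)
    obtain u where "schwartz_approx (ennreal P) f u" using schwartz_approx_exists[OF P f] by blast
    then have us: "\<And>n. schwartz (u n)" and ul: "(\<lambda>n. ?L (\<lambda>x. u n x - f x)) \<longlonglongrightarrow> 0" by (auto simp: schwartz_approx_def)
    \<comment> \<open>The divisor \<open>8 * c0\<close> makes
      \<open>c0 * 4 * (2 * \<delta> j)\<close> equal to \<open>(1 / 2) ^ j\<close>, whose square is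
      the rate that \<open>L2_complete\<close> asks for.\<close>
    define \<delta> where "\<delta> j = (1 / 2) ^ j / (8 * c0)" for j :: nat
    have \<delta>0: "0 < \<delta> j" for j using c0 by (simp add: \<delta>_def)
    have ex: "\<exists>n. ?L (\<lambda>x. u n x - f x) < ennreal (\<delta> j)" for j
    proof -
      have "\<forall>\<^sub>F n in sequentially. ?L (\<lambda>x. u n x - f x) < ennreal (\<delta> j)"
        by (rule order_tendstoD(2)[OF ul]) (use \<delta>0 in simp)
      then show ?thesis by (rule eventually_happens'[OF sequentially_bot])
    qed
    define k where "k j = (SOME n. ?L (\<lambda>x. u n x - f x) < ennreal (\<delta> j))" for j
    have k: "?L (\<lambda>x. u (k j) x - f x) < ennreal (\<delta> j)" for j unfolding k_def by (rule someI_ex[OF ex])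
    define v where "v j = u (k j)" for j
    have vs: "schwartz (v j)" and vL: "?L (\<lambda>x. v j x - f x) \<le> ennreal (\<delta> j)" for j
      using us k[of j] by (auto simp: v_def)
    have vm: "v j \<in> borel_measurable borel" for j by (rule schwartz_borel_measurable[OF vs])
    have vhm: "fourier lborel (v j) \<in> borel_measurable \<mu>" for j by (rule fm[OF vm])
    have cau: "(\<integral>\<^sup>+x. ennreal ((norm (fourier lborel (v m) x - fourier lborel (v j) x))\<^sup>2) \<partial>\<mu>) \<le> ennreal (1 * (1 / 4) ^ j)" if "j \<le> m" for j m
    proof -
      have "\<delta> m \<le> \<delta> j" unfolding \<delta>_def using that c0 by (intro divide_right_mono power_decreasing) auto
      then have s: "\<delta> m + \<delta> j \<le> 2 * \<delta> j" by simp
      have "?M (\<lambda>x. fourier lborel (v m) x - fourier lborel (v j) x) \<le> ennreal c0 * (4 * (?L (\<lambda>x. v m x - f x) + ?L (\<lambda>x. v j x - f x)))"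
        by (rule diff[OF vs vs fb])
      also have "\<dots> \<le> ennreal c0 * (4 * (ennreal (\<delta> m) + ennreal (\<delta> j)))"
        by (intro mult_left_mono add_mono vL) auto
      also have "\<dots> = ennreal c0 * (ennreal 4 * ennreal (\<delta> m + \<delta> j))"
        using \<delta>0[of m] \<delta>0[of j] by (subst ennreal_plus) auto
      also have "\<dots> = ennreal (c0 * (4 * (\<delta> m + \<delta> j)))"
        using c0 by (simp only: ennreal_mult'[symmetric] zero_le_numeral less_imp_le)
      also have "\<dots> \<le> ennreal ((1 / 2) ^ j)"
      proof (rule ennreal_leI)
        have "c0 * (4 * (\<delta> m + \<delta> j)) \<le> c0 * (4 * (2 * \<delta> j))" using s c0 by (intro mult_left_mono) auto
        also have "\<dots> = (1 / 2) ^ j" using c0 by (simp add: \<delta>_def)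
        finally show "c0 * (4 * (\<delta> m + \<delta> j)) \<le> (1 / 2) ^ j" .
      qed
      finally have "(\<integral>\<^sup>+x. ennreal (norm (fourier lborel (v m) x - fourier lborel (v j) x) powr 2) \<partial>\<mu>) \<le> ennreal (((1 / 2) ^ j) powr 2)"
        by (subst (asm) Lp_norm_2_le_iff) auto
      also have "((1 / 2 :: real) ^ j) powr 2 = 1 * (1 / 4) ^ j" by (simp add: power_mult[symmetric] power_divide power2_eq_square power_mult_distrib[symmetric])
      finally show ?thesis by simp
    qed
    obtain g where g: "g \<in> borel_measurable \<mu>" "\<And>n. (\<integral>\<^sup>+x. ennreal ((norm (fourier lborel (v n) x - g x))\<^sup>2) \<partial>\<mu>) \<le> ennreal (1 * (1 / 4) ^ n)"
      using L2_complete[of "\<lambda>n. fourier lborel (v n)" \<mu> 1, OF vhm cau] by blast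
    have vg: "?M (\<lambda>x. fourier lborel (v n) x - g x) \<le> ennreal ((1 / 2) ^ n)" for n
    proof -
      have "((1 / 2 :: real) ^ n) powr 2 = 1 * (1 / 4) ^ n" by (simp add: power_mult[symmetric] power_divide power2_eq_square power_mult_distrib[symmetric])
      then show ?thesis using g(2)[of n] by (subst Lp_norm_2_le_iff) auto
    qed
    have half0: "(\<lambda>n. ennreal ((1 / 2) ^ n)) \<longlonglongrightarrow> 0"
    proof -
      have "(\<lambda>n. (1 / 2 :: real) ^ n) \<longlonglongrightarrow> 0" by (intro LIMSEQ_power_zero) simp
      then have "(\<lambda>n. ennreal ((1 / 2) ^ n)) \<longlonglongrightarrow> ennreal 0" by (rule tendsto_ennrealI)
      then show ?thesis by simp
    qed
    have vg0: "(\<lambda>n. ?M (\<lambda>x. fourier lborel (v n) x - g x)) \<longlonglongrightarrow> 0"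
      by (rule tendsto_sandwich[OF _ _ tendsto_const half0]) (use vg in auto)
    have vf0: "(\<lambda>n. ?L (\<lambda>x. v n x - f x)) \<longlonglongrightarrow> 0"
    proof (rule tendsto_sandwich[OF _ _ tendsto_const])
      have "(\<lambda>n. (1 / 2 :: real) ^ n / (8 * c0)) \<longlonglongrightarrow> 0 / (8 * c0)"
        by (intro tendsto_divide LIMSEQ_power_zero tendsto_const) (use c0 in auto)
      then have "(\<lambda>n. ennreal (\<delta> n)) \<longlonglongrightarrow> ennreal 0" unfolding \<delta>_def by (intro tendsto_ennrealI) simp
      then show "(\<lambda>n. ennreal (\<delta> n)) \<longlonglongrightarrow> 0" by simp
    qed (use vL in auto)
    have gbound: "?M g \<le> ennreal (16 * c0) * ?L f"
    proof -
      let ?X = "\<lambda>n. 4 * (?M (\<lambda>x. fourier lborel (v n) x - g x) + ennreal c0 * (4 * (?L (\<lambda>x. v n x - f x) + ?L f)))"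
      have "?M g \<le> ?X n" for n
      proof -
        have "?M (\<lambda>x. g x - 0) \<le> 4 * (?M (\<lambda>x. g x - fourier lborel (v n) x) + ?M (\<lambda>x. fourier lborel (v n) x - 0))"
          by (rule tri[OF g(1) vhm]) simp
        moreover have "?M (\<lambda>x. fourier lborel (v n) x - 0) \<le> ennreal c0 * (4 * (?L (\<lambda>x. v n x - f x) + ?L f))"
        proof -
          have "?L (\<lambda>x. v n x - 0) \<le> 4 * (?L (\<lambda>x. v n x - f x) + ?L (\<lambda>x. f x - 0))"
            by (rule Lp_norm_triangle3) (use vm fb P in auto)
          then have "ennreal c0 * ?L (v n) \<le> ennreal c0 * (4 * (?L (\<lambda>x. v n x - f x) + ?L f))"
            by (intro mult_left_mono) auto
          then show ?thesis using R'[OF schwartz_integrable[OF vs[of n]]] by simp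
        qed
        ultimately have "?M (\<lambda>x. g x - 0) \<le> 4 * (?M (\<lambda>x. g x - fourier lborel (v n) x) + ennreal c0 * (4 * (?L (\<lambda>x. v n x - f x) + ?L f)))"
          by (meson add_left_mono mult_left_mono order_trans zero_le)
        then show ?thesis by (simp only: diff_zero Lp_norm_minus_commute[of _ _ g])
      qed
      moreover have "?X \<longlonglongrightarrow> 4 * (0 + ennreal c0 * (4 * (0 + ?L f)))"
        by (intro ennreal_tendsto_cmult tendsto_add vg0 vf0 tendsto_const) auto
      ultimately have "?M g \<le> 4 * (0 + ennreal c0 * (4 * (0 + ?L f)))"
        by (intro LIMSEQ_le_const) auto
      also have "\<dots> = ennreal (16 * c0) * ?L f"
      proof -
        have "ennreal (16 * c0) = 16 * ennreal c0" using ennreal_mult'[of 16 c0] by simp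
        moreover have "(16 :: ennreal) = 4 * 4" by simp
        ultimately show ?thesis by (simp only: add_0 mult_ac)
      qed
      finally show ?thesis .
    qed
    have "fourier_restriction (ennreal P) \<mu> f g"
      unfolding fourier_restriction_def
    proof (intro conjI allI impI)
      show "g \<in> Lp_space 2 \<mu>"
      proof -
        have "ennreal (16 * c0) * ?L f < \<infinity>" using fL by (simp add: ennreal_mult_less_top)
        then show ?thesis using g(1) le_less_trans[OF gbound] by (simp add: Lp_space_def)
      qed
      show "\<exists>u. schwartz_approx (ennreal P) f u" by (rule schwartz_approx_exists[OF P f])
      fix z assume "schwartz_approx (ennreal P) f z"
      then have zs: "\<And>n. schwartz (z n)" and zl: "(\<lambda>n. ?L (\<lambda>x. z n x - f x)) \<longlonglongrightarrow> 0" by (auto simp: schwartz_approx_def)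
      \<comment> \<open>An arbitrary approximating sequence \<open>z\<close> is compared with
        \<open>v\<close> by way of \<open>f\<close>, so that the limit \<open>g\<close> does not
        depend on the sequence.\<close>
      let ?X = "\<lambda>n. 4 * (ennreal c0 * (4 * (?L (\<lambda>x. z n x - f x) + ?L (\<lambda>x. v n x - f x))) + ?M (\<lambda>x. fourier lborel (v n) x - g x))"
      have le: "?M (\<lambda>x. fourier lborel (z n) x - g x) \<le> ?X n" for n
      proof -
        have "?M (\<lambda>x. fourier lborel (z n) x - g x) \<le> 4 * (?M (\<lambda>x. fourier lborel (z n) x - fourier lborel (v n) x) + ?M (\<lambda>x. fourier lborel (v n) x - g x))"
          by (rule tri[OF fm[OF schwartz_borel_measurable[OF zs]] vhm g(1)])
        also have "\<dots> \<le> ?X n" by (intro mult_left_mono add_right_mono diff[OF zs vs fb]) auto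
        finally show ?thesis .
      qed
      have "?X \<longlonglongrightarrow> 4 * (ennreal c0 * (4 * (0 + 0)) + 0)"
        by (intro ennreal_tendsto_cmult tendsto_add vg0 vf0 zl) auto
      then have X0: "?X \<longlonglongrightarrow> 0" by simp
      show "(\<lambda>n. ?M (\<lambda>\<xi>. fourier lborel (z n) \<xi> - g \<xi>)) \<longlonglongrightarrow> 0"
        by (rule tendsto_sandwich[OF _ _ tendsto_const X0]) (use le in auto)
    qed
    then show ?thesis using gbound by blast
  qed
  show ?thesis
    unfolding restriction_estimate_def
  proof (intro exI[of _ "16 * c0"] conjI allI impI ballI main)
    fix f :: "'a \<Rightarrow> complex" assume "schwartz f"
    then have "?M (fourier lborel f) \<le> ennreal c0 * ?L f" by (intro R' schwartz_integrable)
    also have "\<dots> \<le> ennreal (16 * c0) * ?L f" using c0 by (intro mult_right_mono ennreal_leI) auto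
    finally show "?M (fourier lborel f) \<le> ennreal (16 * c0) * ?L f" .
  qed
qed

section \<open>The additive Brownian sheet\<close>

lemma osc_eq_lebesgue_integral:
  assumes x: "continuous_on {0..1} x"
  shows "osc x \<xi> \<eta> = (LINT t|lborel. indicator {0..1} t *\<^sub>R echar (\<xi> * t + \<eta> * x t))"
    and "integrable lborel (\<lambda>t. indicator {0..1} t *\<^sub>R echar (\<xi> * t + \<eta> * x t))"
proof -
  have "set_integrable lborel {0..1} (\<lambda>t. echar (\<xi> * t + \<eta> * x t))"
    unfolding echar_def by (intro borel_integrable_atLeastAtMost' continuous_on_osc_integrand x)
  then show "integrable lborel (\<lambda>t. indicator {0..1} t *\<^sub>R echar (\<xi> * t + \<eta> * x t))"
    and "osc x \<xi> \<eta> = (LINT t|lborel. indicator {0..1} t *\<^sub>R echar (\<xi> * t + \<eta> * x t))"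
    using set_borel_integral_eq_integral(2)[of "{0..1}" "\<lambda>t. echar (\<xi> * t + \<eta> * x t)"]
    by (simp_all add: set_integrable_def set_lebesgue_integral_def osc_def echar_def)
qed

lemma fourier_surface_measure_additive:
  fixes x :: "'k::finite \<Rightarrow> real \<Rightarrow> real" and w :: "real ^ 'k \<Rightarrow> real"
  assumes x: "\<And>i. continuous_on {0..1} (x i)" and w: "\<And>t. t \<in> cbox 0 1 \<Longrightarrow> w t = (\<Sum>i\<in>UNIV. x i (t $ i))"
  shows "continuous_on (cbox 0 1) w"
    and "fourier (surface_measure w) (\<lambda>_. 1) (\<xi>, \<eta>) = (\<Prod>i\<in>UNIV. osc (x i) (\<xi> $ i) \<eta>)"
proof -
  have "continuous_on (cbox 0 1) (\<lambda>t :: real ^ 'k. \<Sum>i\<in>UNIV. x i (t $ i))"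
    by (intro continuous_on_sum continuous_on_compose2[OF x] continuous_intros) (auto simp: mem_box_cart)
  then show cw: "continuous_on (cbox 0 1) w" by (subst continuous_on_cong[OF refl w]) auto
  have "fourier (surface_measure w) (\<lambda>_. 1) (\<xi>, \<eta>) = (LINT t|lborel. indicator (cbox 0 1) t *\<^sub>R echar ((\<xi>, \<eta>) \<bullet> (t, w t)))"
    unfolding fourier_eq_echar mult_1_right
    by (rule integral_surface_measure[OF cw])
      (intro measurable_compose[OF _ borel_measurable_echar] borel_measurable_continuous_onI continuous_intros)
  also have "\<dots> = (LINT t|lborel. (\<Prod>i\<in>UNIV. indicator {0..1} (t $ i) *\<^sub>R echar (\<xi> $ i * t $ i + \<eta> * x i (t $ i))))"
  proof (intro Bochner_Integration.integral_cong refl)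
    fix t :: "real ^ 'k"
    show "indicator (cbox 0 1) t *\<^sub>R echar ((\<xi>, \<eta>) \<bullet> (t, w t)) = (\<Prod>i\<in>UNIV. indicator {0..1} (t $ i) *\<^sub>R echar (\<xi> $ i * t $ i + \<eta> * x i (t $ i)))"
    proof (cases "t \<in> cbox 0 1")
      case True
      have "(\<xi>, \<eta>) \<bullet> (t, w t) = (\<Sum>i\<in>UNIV. \<xi> $ i * t $ i + \<eta> * x i (t $ i))"
        by (simp add: inner_vec_def w[OF True] sum.distrib sum_distrib_left)
      moreover have "echar (\<Sum>i\<in>I. g i) = (\<Prod>i\<in>I. echar (g i))" if "finite I" for I :: "'k set" and g
        using that by (induction I) (auto simp: echar_add, simp add: echar_def)
      ultimately have "echar ((\<xi>, \<eta>) \<bullet> (t, w t)) = (\<Prod>i\<in>UNIV. echar (\<xi> $ i * t $ i + \<eta> * x i (t $ i)))" by simp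
      then show ?thesis using True by (simp add: mem_box_cart)
    next
      case False
      then obtain i where "t $ i \<notin> {0..1}" by (auto simp: mem_box_cart)
      then have "(\<Prod>i\<in>UNIV. indicator {0..1} (t $ i) *\<^sub>R echar (\<xi> $ i * t $ i + \<eta> * x i (t $ i))) = 0"
        by (intro prod_zero bexI[of _ i]) auto
      then show ?thesis using False by simp
    qed
  qed
  also have "\<dots> = (\<Prod>i\<in>UNIV. osc (x i) (\<xi> $ i) \<eta>)"
    unfolding osc_eq_lebesgue_integral(1)[OF x]
    by (rule lborel_integral_tensor_vec(1)[OF osc_eq_lebesgue_integral(2)[OF x]])
  finally show "fourier (surface_measure w) (\<lambda>_. 1) (\<xi>, \<eta>) = (\<Prod>i\<in>UNIV. osc (x i) (\<xi> $ i) \<eta>)" .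
qed

text \<open>The transform of the surface measure is a product over the coordinates, so the
  one-dimensional decay exponents add up; finitely many coordinates need only one null set.\<close>

lemma AE_additive_brownian_sheet_decay:
  fixes W :: "'w \<Rightarrow> real ^ 'k::finite \<Rightarrow> real"
  assumes W: "additive_brownian_sheet M W" and eps: "0 < \<epsilon>"
  shows "AE \<omega> in M. continuous_on (cbox 0 1) (W \<omega>) \<and>
    (\<exists>A\<ge>1. \<forall>\<xi> \<eta>. 1 \<le> \<bar>\<eta>\<bar> \<longrightarrow>
      norm (fourier (surface_measure (W \<omega>)) (\<lambda>_. 1) (\<xi>, \<eta>)) \<le> A * \<bar>\<eta>\<bar> powr (- (real CARD('k) * (1 - \<epsilon>))))"
proof -
  obtain B where B: "\<And>i::'k. brownian_motion M (B i)" "\<And>\<omega> t. t \<in> cbox 0 1 \<Longrightarrow> W \<omega> t = (\<Sum>i\<in>UNIV. B i (t $ i) \<omega>)"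
    using W unfolding additive_brownian_sheet_def by blast
  have "AE \<omega> in M. \<forall>i\<in>UNIV. continuous_on {0..1} (\<lambda>t. B i t \<omega>) \<and>
     (\<exists>C\<ge>0. \<forall>\<xi> \<eta>. 1 \<le> \<bar>\<eta>\<bar> \<longrightarrow> norm (osc (\<lambda>t. B i t \<omega>) \<xi> \<eta>) \<le> C * \<bar>\<eta>\<bar> powr (- (1 - \<epsilon>)))"
    by (intro AE_finite_allI AE_conjI brownian_motionD(3) AE_brownian_osc_decay B(1) eps) auto
  then show ?thesis
  proof eventually_elim
    fix \<omega>
    assume *: "\<forall>i\<in>UNIV. continuous_on {0..1} (\<lambda>t. B i t \<omega>) \<and>
     (\<exists>C\<ge>0. \<forall>\<xi> \<eta>. 1 \<le> \<bar>\<eta>\<bar> \<longrightarrow> norm (osc (\<lambda>t. B i t \<omega>) \<xi> \<eta>) \<le> C * \<bar>\<eta>\<bar> powr (- (1 - \<epsilon>)))"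
    then have c: "continuous_on {0..1} (\<lambda>t. B i t \<omega>)" for i by blast
    have "\<forall>i. \<exists>C. 0 \<le> C \<and> (\<forall>\<xi> \<eta>. 1 \<le> \<bar>\<eta>\<bar> \<longrightarrow> norm (osc (\<lambda>t. B i t \<omega>) \<xi> \<eta>) \<le> C * \<bar>\<eta>\<bar> powr (- (1 - \<epsilon>)))"
      using * by blast
    from choice[OF this] obtain C where C: "\<And>i. 0 \<le> C i" "\<And>i \<xi> \<eta>. 1 \<le> \<bar>\<eta>\<bar> \<Longrightarrow> norm (osc (\<lambda>t. B i t \<omega>) \<xi> \<eta>) \<le> C i * \<bar>\<eta>\<bar> powr (- (1 - \<epsilon>))"
      by blast
    note F = fourier_surface_measure_additive[of "\<lambda>i t. B i t \<omega>" "W \<omega>", OF c B(2)]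
    define A where "A = max 1 (\<Prod>i\<in>UNIV. C i)"
    have dec: "norm (fourier (surface_measure (W \<omega>)) (\<lambda>_. 1) (\<xi>, \<eta>)) \<le> A * \<bar>\<eta>\<bar> powr (- (real CARD('k) * (1 - \<epsilon>)))"
      if eta: "1 \<le> \<bar>\<eta>\<bar>" for \<xi> \<eta>
    proof -
      have "norm (fourier (surface_measure (W \<omega>)) (\<lambda>_. 1) (\<xi>, \<eta>)) = (\<Prod>i\<in>UNIV. norm (osc (\<lambda>t. B i t \<omega>) (\<xi> $ i) \<eta>))"
        by (simp only: F(2) prod_norm)
      also have "\<dots> \<le> (\<Prod>i\<in>UNIV. C i * \<bar>\<eta>\<bar> powr (- (1 - \<epsilon>)))"
        by (intro prod_mono conjI C(2) eta) auto
      also have "\<dots> = (\<Prod>i\<in>UNIV. C i) * (\<bar>\<eta>\<bar> powr (- (1 - \<epsilon>))) ^ CARD('k)" by (simp add: prod.distrib)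
      also have "(\<bar>\<eta>\<bar> powr (- (1 - \<epsilon>))) ^ CARD('k) = \<bar>\<eta>\<bar> powr (- (real CARD('k) * (1 - \<epsilon>)))"
        using eta by (subst powr_realpow[symmetric]) (auto simp: powr_powr algebra_simps)
      also have "(\<Prod>i\<in>UNIV. C i) * \<bar>\<eta>\<bar> powr (- (real CARD('k) * (1 - \<epsilon>))) \<le> A * \<bar>\<eta>\<bar> powr (- (real CARD('k) * (1 - \<epsilon>)))"
        by (intro mult_right_mono) (auto simp: A_def)
      finally show ?thesis .
    qed
    show "continuous_on (cbox 0 1) (W \<omega>) \<and> (\<exists>A\<ge>1. \<forall>\<xi> \<eta>. 1 \<le> \<bar>\<eta>\<bar> \<longrightarrow>
      norm (fourier (surface_measure (W \<omega>)) (\<lambda>_. 1) (\<xi>, \<eta>)) \<le> A * \<bar>\<eta>\<bar> powr (- (real CARD('k) * (1 - \<epsilon>))))"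
      using F(1) dec by (intro conjI exI[of _ A]) (auto simp: A_def)
  qed
qed

text \<open>Solves \<open>2 + 2 / b = s\<close> for the decay rate. The hypothesis on
  \<open>s\<close> says exactly that this \<open>b\<close> is below \<open>CARD('k)\<close>, so that
  some \<epsilon> > 0 gives \<open>b = k * (1 - \<epsilon>)\<close> with
  \<open>k = CARD('k)\<close>.\<close>

lemma AE_additive_brownian_sheet_decay_exponent:
  fixes W :: "'w \<Rightarrow> real ^ 'k::finite \<Rightarrow> real"
  assumes W: "additive_brownian_sheet M W" and s: "2 + 2 / real CARD('k) < s"
  obtains b where "0 < b" "2 + 2 / b = s"
    "AE \<omega> in M. continuous_on (cbox 0 1) (W \<omega>) \<and>
      (\<exists>A\<ge>1. \<forall>\<xi> \<eta>. 1 \<le> \<bar>\<eta>\<bar> \<longrightarrow>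
        norm (fourier (surface_measure (W \<omega>)) (\<lambda>_. 1) (\<xi>, \<eta>)) \<le> A * \<bar>\<eta>\<bar> powr (- b))"
proof -
  let ?k = "real CARD('k)"
  have k: "0 < ?k" by simp
  define b where "b = 2 / (s - 2)"
  define \<epsilon> where "\<epsilon> = 1 - b / ?k"
  have "0 < 2 / ?k" using k by (intro divide_pos_pos) auto
  then have s2: "0 < s - 2" using s by linarith
  have "2 / ?k < s - 2" using s by linarith
  then have "b < ?k" unfolding b_def using k s2 by (simp add: field_simps)
  then have eps: "0 < \<epsilon>" using k by (simp add: \<epsilon>_def)
  have b: "?k * (1 - \<epsilon>) = b" using k by (simp add: \<epsilon>_def)
  show thesis
  proof (rule that[of b])
    show "0 < b" using s2 by (simp add: b_def)
    have "2 / b = s - 2" using s2 by (simp add: b_def field_simps)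
    then show "2 + 2 / b = s" by linarith
  qed (use AE_additive_brownian_sheet_decay[OF W eps] in \<open>simp only: b\<close>)
qed

lemma AE_extension_estimate_sheet:
  fixes W :: "'w \<Rightarrow> real ^ 'k::finite \<Rightarrow> real"
  assumes W: "additive_brownian_sheet M W" and q: "ennreal (2 + 2 / real CARD('k)) < q"
  shows "AE \<omega> in M. extension_estimate q (surface_measure (W \<omega>))"
proof -
  \<comment> \<open>An intermediate exponent is inserted because \<open>q\<close> may be infinite,
    whereas the decay rate is computed from a real number.\<close>
  obtain e where e: "ennreal (2 + 2 / real CARD('k)) < e" "e < q" using dense[OF q] by blast
  then obtain s where s: "e = ennreal s" "0 \<le> s" by (cases e) auto
  have "2 + 2 / real CARD('k) < s"
    using e(1) unfolding s(1) by (rule ennreal_less_iff[THEN iffD1, rotated]) simp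
  then obtain b where b: "0 < b" "2 + 2 / b = s"
    and AE: "AE \<omega> in M. continuous_on (cbox 0 1) (W \<omega>) \<and>
      (\<exists>A\<ge>1. \<forall>\<xi> \<eta>. 1 \<le> \<bar>\<eta>\<bar> \<longrightarrow>
        norm (fourier (surface_measure (W \<omega>)) (\<lambda>_. 1) (\<xi>, \<eta>)) \<le> A * \<bar>\<eta>\<bar> powr (- b))"
    by (rule AE_additive_brownian_sheet_decay_exponent[OF W])
  have "ennreal (2 + 2 / b) < q" using e(2) s(1) by (simp only: b(2))
  note ext = extension_estimate_surface_measure[OF _ _ b(1) _ this]
  from AE show ?thesis
  proof (rule eventually_mono, elim conjE exE)
    fix \<omega> A
    assume "continuous_on (cbox 0 1) (W \<omega>)" "1 \<le> A"
      "\<forall>\<xi> \<eta>. 1 \<le> \<bar>\<eta>\<bar> \<longrightarrow> norm (fourier (surface_measure (W \<omega>)) (\<lambda>_. 1) (\<xi>, \<eta>)) \<le> A * \<bar>\<eta>\<bar> powr (- b)"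
    then show "extension_estimate q (surface_measure (W \<omega>))" using ext by blast
  qed
qed

lemma AE_restriction_estimate_sheet:
  fixes W :: "'w \<Rightarrow> real ^ 'k::finite \<Rightarrow> real"
  assumes W: "additive_brownian_sheet M W" and P: "1 \<le> P" and PQ: "1 < P \<Longrightarrow> 2 + 2 / real CARD('k) < P / (P - 1)"
  shows "AE \<omega> in M. restriction_estimate (ennreal P) (surface_measure (W \<omega>))"
proof (cases "P = 1")
  case True
  \<comment> \<open>Only continuity of the sheet is wanted here, so any positive \<epsilon>
    serves.\<close>
  have "(0::real) < 1" by simp
  from AE_additive_brownian_sheet_decay[OF W this] show ?thesis
  proof (rule eventually_mono)
    fix \<omega>
    assume "continuous_on (cbox 0 1) (W \<omega>) \<and> (\<exists>A\<ge>1. \<forall>\<xi> \<eta>. 1 \<le> \<bar>\<eta>\<bar> \<longrightarrow>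
      norm (fourier (surface_measure (W \<omega>)) (\<lambda>_. 1) (\<xi>, \<eta>)) \<le> A * \<bar>\<eta>\<bar> powr (- (real CARD('k) * (1 - 1))))"
    then have p: "prob_space (surface_measure (W \<omega>))" by (intro prob_space_surface_measure) blast
    show "restriction_estimate (ennreal P) (surface_measure (W \<omega>))"
      unfolding True
      by (rule restriction_estimate_of_integrable[OF sets_surface_measure _ _ fourier_restriction_integrable_L1[OF p]]) auto
  qed
next
  case False
  then have P1: "1 < P" using P by simp
  define Q where "Q = P / (P - 1)"
  have Q1: "1 < Q" "1 / P + 1 / Q = 1" using P1 by (auto simp: Q_def field_simps)
  \<comment> \<open>The midpoint between the threshold and the conjugate exponent: it fixes a decay
    rate below \<open>CARD('k)\<close> and leaves room for the passage from weak to strong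
    type.\<close>
  define s where "s = (2 + 2 / real CARD('k) + Q) / 2"
  have "2 + 2 / real CARD('k) < Q" using PQ[OF P1] by (simp only: Q_def)
  then have s: "2 + 2 / real CARD('k) < s" "s < Q" by (auto simp: s_def)
  obtain b where b: "0 < b" "2 + 2 / b = s"
    and AE: "AE \<omega> in M. continuous_on (cbox 0 1) (W \<omega>) \<and>
      (\<exists>A\<ge>1. \<forall>\<xi> \<eta>. 1 \<le> \<bar>\<eta>\<bar> \<longrightarrow>
        norm (fourier (surface_measure (W \<omega>)) (\<lambda>_. 1) (\<xi>, \<eta>)) \<le> A * \<bar>\<eta>\<bar> powr (- b))"
    by (rule AE_additive_brownian_sheet_decay_exponent[OF W s(1)])
  have bQ: "2 + 2 / b < Q" using s(2) by (simp only: b(2))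
  from AE show ?thesis
  proof (rule eventually_mono, elim conjE exE)
    fix \<omega> A
    assume w: "continuous_on (cbox 0 1) (W \<omega>)" and A: "1 \<le> A"
      and dec: "\<forall>\<xi> \<eta>. 1 \<le> \<bar>\<eta>\<bar> \<longrightarrow> norm (fourier (surface_measure (W \<omega>)) (\<lambda>_. 1) (\<xi>, \<eta>)) \<le> A * \<bar>\<eta>\<bar> powr (- b)"
    obtain c where c: "0 < c" and ext: "\<And>f N. f \<in> borel_measurable borel \<Longrightarrow> 0 < N \<Longrightarrow>
      (\<integral>\<^sup>+x. ennreal (norm (f x) powr 2) \<partial>surface_measure (W \<omega>)) \<le> ennreal (N powr 2) \<Longrightarrow>
      (\<integral>\<^sup>+\<xi>. ennreal (norm (fourier (surface_measure (W \<omega>)) f \<xi>) powr Q) \<partial>lborel) \<le> ennreal ((c * N) powr Q)"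
      using fourier_surface_strong_type[OF w A b(1) _ bQ] dec by blast
    show "restriction_estimate (ennreal P) (surface_measure (W \<omega>))"
      by (rule restriction_estimate_of_integrable[OF sets_surface_measure P c
            fourier_restriction_integrable_dual[OF w P1 Q1 c ext]])
  qed
qed

theorem theorem2p4:
  fixes M :: "'w measure" and W :: "'w \<Rightarrow> real ^ 'k::finite \<Rightarrow> real"
    and q q' :: ennreal
  assumes "additive_brownian_sheet M W"
    and "1 / q + 1 / q' = 1"
  shows
    "((CARD('k) = 1 \<and> q > 4 \<or>
      CARD('k) \<ge> 2 \<and> q > ennreal ((8 * real CARD('k) + 2) / (3 * real CARD('k)))) \<longrightarrow>
       (AE \<omega> in M. extension_estimate q (surface_measure (W \<omega>)))) \<and>
     ((CARD('k) = 1 \<and> 1 < q' \<and> q' < ennreal (4 / 3) \<or>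
      CARD('k) \<ge> 2 \<and> 1 \<le> q' \<and> q' < ennreal ((8 * real CARD('k) + 2) / (5 * real CARD('k) + 2))) \<longrightarrow>
       (AE \<omega> in M. restriction_estimate q' (surface_measure (W \<omega>))))"
proof (intro conjI impI)
  let ?k = "real CARD('k)"
  \<comment> \<open>After multiplication by 3 k this reads 6 k + 6 \<le> 8 k + 2, which holds from k
    = 2 on, with equality at k = 2.\<close>
  have exponent: "2 + 2 / ?k \<le> (8 * ?k + 2) / (3 * ?k)" if "2 \<le> CARD('k)"
  proof -
    have k: "2 \<le> ?k" using that by simp
    then have "(2 + 2 / ?k) * (3 * ?k) = 6 * ?k + 6" by (simp add: distrib_right)
    then show ?thesis using k by (subst pos_le_divide_eq) auto
  qed
  assume "CARD('k) = 1 \<and> q > 4 \<or> CARD('k) \<ge> 2 \<and> q > ennreal ((8 * ?k + 2) / (3 * ?k))"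
  then have "ennreal (2 + 2 / ?k) < q"
  proof (elim disjE conjE)
    assume "CARD('k) = 1" "4 < q"
    then show ?thesis by (simp del: ennreal_plus)
  next
    assume k: "2 \<le> CARD('k)" and "ennreal ((8 * ?k + 2) / (3 * ?k)) < q"
    then show ?thesis by (rule_tac le_less_trans[OF ennreal_leI[OF exponent[OF k]]])
  qed
  then show "AE \<omega> in M. extension_estimate q (surface_measure (W \<omega>))"
    by (rule AE_extension_estimate_sheet[OF assms(1)])
next
  let ?k = "real CARD('k)"
  assume "CARD('k) = 1 \<and> 1 < q' \<and> q' < ennreal (4 / 3) \<or>
      CARD('k) \<ge> 2 \<and> 1 \<le> q' \<and> q' < ennreal ((8 * ?k + 2) / (5 * ?k + 2))"
  then have *: "CARD('k) = 1 \<and> q' < ennreal (4 / 3) \<or> CARD('k) \<ge> 2 \<and> q' < ennreal ((8 * ?k + 2) / (5 * ?k + 2))" and q1: "1 \<le> q'"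
    by auto
  then have "q' < top" using less_trans[OF _ ennreal_less_top] by blast
  then obtain P where P: "q' = ennreal P" "0 \<le> P" by (cases q') auto
  have P1: "1 \<le> P" using q1 P by simp
  have "2 + 2 / ?k < P / (P - 1)" if "1 < P"
    using *
  proof (elim disjE conjE)
    assume "CARD('k) = 1" "q' < ennreal (4 / 3)"
    moreover from this have "P < 4 / 3" unfolding P(1) using P(2) by (simp add: ennreal_less_iff)
    ultimately show ?thesis using that by (simp add: field_simps)
  next
    assume k: "2 \<le> CARD('k)" and "q' < ennreal ((8 * ?k + 2) / (5 * ?k + 2))"
    then have "P < (8 * ?k + 2) / (5 * ?k + 2)" unfolding P(1) using P(2) by (simp add: ennreal_less_iff)
    then have P': "P * (5 * ?k + 2) < 8 * ?k + 2" by (subst (asm) pos_less_divide_eq) auto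
    have k2: "2 \<le> ?k" using k by simp
    have "(2 * ?k + 2) * (P - 1) < ?k * P"
    proof -
      \<comment> \<open>With k for \<open>?k\<close>, three times the gap k P - (2 k + 2) (P - 1)
        equals (8 k + 2 - P (5 k + 2)) + 2 (k - 2) (P - 1): the first part is positive by the bound
        on \<open>P\<close>, the second nonnegative as k \<ge> 2.\<close>
      have "0 \<le> (?k - 2) * (P - 1)" using k2 that by (intro mult_nonneg_nonneg) auto
      then show ?thesis using P' k2 by (simp add: algebra_simps)
    qed
    then have "(2 * ?k + 2) * (P - 1) / ?k < P"
      using k2 by (subst pos_divide_less_eq) (auto simp: mult.commute)
    moreover have "(2 * ?k + 2) * (P - 1) / ?k = (2 + 2 / ?k) * (P - 1)"
    proof -
      have "(2 * ?k + 2) / ?k = 2 + 2 / ?k" using k2 by (simp add: add_divide_distrib)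
      then show ?thesis by (simp only: times_divide_eq_left[symmetric])
    qed
    ultimately have "(2 + 2 / ?k) * (P - 1) < P" by (simp only:)
    then show ?thesis using that by (subst pos_less_divide_eq) auto
  qed
  from AE_restriction_estimate_sheet[OF assms(1) P1 this]
  show "AE \<omega> in M. restriction_estimate q' (surface_measure (W \<omega>))" by (simp add: P(1))
qed

end
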